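(* Let $(T(t))_{t\geq 0}$ be a $C_0$-semigroup of positive operators on a C$^\star$-algebra $\mathfrak{A}$, with generator $A$, spectral bound $\mathrm{s}(A)$ and growth bound $\omega_0$. Then: (i) $\mathrm{s}(A)=\omega_0$. (ii) If $\sigma(A)\neq\emptyset$, i.e. $-\infty<\mathrm{s}(A)$, then $\mathrm{s}(A)\in\sigma(A)$. (iii) If $\mathfrak{A}$ has a unit $\mathbb{1}$, then $\sigma(A)\neq\emptyset$ and there exists a state $\varphi\in\mathfrak{A}^*$ such that $\varphi$ belongs to the domain $D(A')$ and $A'\varphi=\mathrm{s}(A)\varphi$, where $A'$ is the adjoint operator of $A$ on $\mathfrak{A}^*$.
   Context: C$^\star$-algebras are complex and non-zero, and not assumed unital or commutative unless stated. A $C_0$-semigroup is a strongly continuous one-parameter semigroup $(T(t))_{t\ge0}$ of bounded linear operators with $T(0)=I$; its generator is denoted $A$ and the spectrum of $A$ is $\sigma(A)\subseteq\mathbb{C}$. An operator on $\mathfrak{A}$ is positive if it maps the cone of positive elements of $\mathfrak{A}$ into itself. The spectral bound is $\mathrm{s}(A)=\sup\{\operatorname{Re}\lambda:\lambda\in\sigma(A)\}\in[-\infty,\infty)$, with $\mathrm{s}(A)=-\infty$ if $\sigma(A)=\emptyset$. The growth bound $\omega_0\in[-\infty,\infty)$ is determined by $r(T(t))=e^{\omega_0 t}$ for $t>0$, where $r(\cdot)$ is the spectral radius (with $e^{-\infty}=0$). A state is a positive linear functional on $\mathfrak{A}$ of norm $1$. *)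

theory Defs
  imports "HOL-Analysis.Analysis"
begin

class complex_normed_vector = real_normed_vector +
  fixes scaleC :: "complex \<Rightarrow> 'a \<Rightarrow> 'a"  (infixr "*\<^sub>C" 75)
  assumes scaleC_add_right: "a *\<^sub>C (x + y) = a *\<^sub>C x + a *\<^sub>C y"
    and scaleC_add_left: "(a + b) *\<^sub>C x = a *\<^sub>C x + b *\<^sub>C x"
    and scaleC_scaleC: "a *\<^sub>C (b *\<^sub>C x) = (a * b) *\<^sub>C x"
    and scaleC_of_real: "complex_of_real r *\<^sub>C x = r *\<^sub>R x"
    and norm_scaleC: "norm (a *\<^sub>C x) = cmod a * norm x"

instantiation complex :: complex_normed_vector
begin

definition scaleC_complex :: "complex \<Rightarrow> complex \<Rightarrow> complex" where
  "scaleC_complex a x = a * x"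

instance
  by standard (simp_all add: scaleC_complex_def algebra_simps norm_mult scaleR_conv_of_real)

end

text \<open>Non-zero C*-algebras, neither unital nor commutative in general: the class
  \<open>real_normed_algebra\<close> postulates no unit.\<close>

class cstar_algebra = complex_normed_vector + real_normed_algebra + banach +
  fixes star :: "'a \<Rightarrow> 'a"
  assumes scaleC_mult_left: "(a *\<^sub>C x) * y = a *\<^sub>C (x * y)"
    and scaleC_mult_right: "x * (a *\<^sub>C y) = a *\<^sub>C (x * y)"
    and star_star: "star (star x) = x"
    and star_add: "star (x + y) = star x + star y"
    and star_scaleC: "star (a *\<^sub>C x) = cnj a *\<^sub>C star x"
    and star_mult: "star (x * y) = star y * star x"
    and cstar_identity: "norm (star x * x) = (norm x)\<^sup>2"
    and nontrivial: "\<exists>x. x \<noteq> 0"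

definition has_unit :: "'a::cstar_algebra itself \<Rightarrow> bool" where
  "has_unit _ \<longleftrightarrow> (\<exists>e::'a. \<forall>x. e * x = x \<and> x * e = x)"

definition positive_cone :: "'a::cstar_algebra set" where
  "positive_cone = range (\<lambda>x. star x * x)"

definition positive_operator :: "('a::cstar_algebra \<Rightarrow> 'a) \<Rightarrow> bool" where
  "positive_operator S \<longleftrightarrow> (\<forall>x\<in>positive_cone. S x \<in> positive_cone)"

definition bounded_clinear ::
    "('a::complex_normed_vector \<Rightarrow> 'b::complex_normed_vector) \<Rightarrow> bool" where
  "bounded_clinear f \<longleftrightarrow> bounded_linear f \<and> (\<forall>c x. f (c *\<^sub>C x) = c *\<^sub>C f x)"

definition is_state :: "('a::cstar_algebra \<Rightarrow> complex) \<Rightarrow> bool" where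
  "is_state \<phi> \<longleftrightarrow>
     bounded_clinear \<phi> \<and> (\<forall>x\<in>positive_cone. \<phi> x \<in> \<real>\<^sub>\<ge>\<^sub>0) \<and> onorm \<phi> = 1"

text \<open>An unbounded operator is given by its domain \<open>D\<close> and a function \<open>A\<close> whose values outside
  \<open>D\<close> are irrelevant. An everywhere defined operator has \<open>D = UNIV\<close>.\<close>

definition resolvent_set ::
    "'a::complex_normed_vector set \<Rightarrow> ('a \<Rightarrow> 'a) \<Rightarrow> complex set" where
  "resolvent_set D A =
     {z. bij_betw (\<lambda>x. z *\<^sub>C x - A x) D UNIV \<and>
         bounded_clinear (the_inv_into D (\<lambda>x. z *\<^sub>C x - A x))}"

definition spectrum ::
    "'a::complex_normed_vector set \<Rightarrow> ('a \<Rightarrow> 'a) \<Rightarrow> complex set" where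
  "spectrum D A = - resolvent_set D A"

definition spectral_bound ::
    "'a::complex_normed_vector set \<Rightarrow> ('a \<Rightarrow> 'a) \<Rightarrow> ereal" where
  "spectral_bound D A = (SUP z\<in>spectrum D A. ereal (Re z))"

text \<open>Only used for bounded operators on non-zero Banach spaces, where the spectrum is non-empty
  and bounded.\<close>

definition spectral_radius :: "('a::complex_normed_vector \<Rightarrow> 'a) \<Rightarrow> real" where
  "spectral_radius S = (SUP z\<in>spectrum UNIV S. cmod z)"

text \<open>The dual space consists of the bounded complex-linear functionals; the adjoint is
  well-defined when \<open>D\<close> is dense.\<close>

definition adjoint_domain ::
    "'a::complex_normed_vector set \<Rightarrow> ('a \<Rightarrow> 'a) \<Rightarrow> ('a \<Rightarrow> complex) set" where
  "adjoint_domain D A =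
     {\<phi>. bounded_clinear \<phi> \<and> (\<exists>\<psi>. bounded_clinear \<psi> \<and> (\<forall>x\<in>D. \<phi> (A x) = \<psi> x))}"

definition adjoint_op ::
    "'a::complex_normed_vector set \<Rightarrow> ('a \<Rightarrow> 'a) \<Rightarrow> ('a \<Rightarrow> complex) \<Rightarrow> ('a \<Rightarrow> complex)" where
  "adjoint_op D A \<phi> = (THE \<psi>. bounded_clinear \<psi> \<and> (\<forall>x\<in>D. \<phi> (A x) = \<psi> x))"

text \<open>The values of \<open>T\<close> at negative times are irrelevant.\<close>

definition C0_semigroup :: "(real \<Rightarrow> 'a::complex_normed_vector \<Rightarrow> 'a) \<Rightarrow> bool" where
  "C0_semigroup T \<longleftrightarrow>
     (\<forall>t\<ge>0. bounded_clinear (T t)) \<and>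
     (\<forall>x. T 0 x = x) \<and>
     (\<forall>s\<ge>0. \<forall>t\<ge>0. \<forall>x. T (s + t) x = T s (T t x)) \<and>
     (\<forall>x. continuous_on {0..} (\<lambda>t. T t x))"

definition generator_domain :: "(real \<Rightarrow> 'a::complex_normed_vector \<Rightarrow> 'a) \<Rightarrow> 'a set" where
  "generator_domain T = {x. \<exists>y. ((\<lambda>t. (T t x - x) /\<^sub>R t) \<longlongrightarrow> y) (at_right 0)}"

definition generator :: "(real \<Rightarrow> 'a::complex_normed_vector \<Rightarrow> 'a) \<Rightarrow> 'a \<Rightarrow> 'a" where
  "generator T x = Lim (at_right 0) (\<lambda>t. (T t x - x) /\<^sub>R t)"

text \<open>The unique \<open>\<omega> \<in> [-\<infinity>, \<infinity>)\<close> such that the spectral radius of \<open>T t\<close> is \<open>exp (\<omega> t)\<close> for all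
  \<open>t > 0\<close>, where \<open>exp (-\<infinity>) = 0\<close>.\<close>

definition growth_bound :: "(real \<Rightarrow> 'a::complex_normed_vector \<Rightarrow> 'a) \<Rightarrow> ereal" where
  "growth_bound T =
     (THE \<omega>. \<omega> \<noteq> \<infinity> \<and>
        (\<forall>t>0. spectral_radius (T t) =
                 (if \<omega> = -\<infinity> then 0 else exp (real_of_ereal \<omega> * t))))"

end

theory Submission
  imports Defs
begin

text \<open>
  Let \<open>s\<close> be the infimum of all \<open>w\<close> such that \<open>\<parallel>T t\<parallel> \<le> M exp (w t)\<close> for some \<open>M\<close>. To the
  right of \<open>s\<close> the resolvent of the generator \<open>A\<close> is the Laplace transform of the
  semigroup, so \<open>\<sigma>(A)\<close> lies in the half-plane \<open>Re z \<le> s\<close>. The theorem rests on a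
  converse: if \<open>s\<close> is finite, it is a spectral value of \<open>A\<close>. Then \<open>s\<close> is the spectral
  bound, and \<open>exp (s t)\<close> is a spectral value of \<open>T t\<close> by the inclusion
  \<open>exp (t \<sigma>(A)) \<subseteq> \<sigma>(T t)\<close> and its spectral radius, so that \<open>s\<close> is also the growth bound.
  If \<open>s = -\<infinity>\<close>, then \<open>\<sigma>(A)\<close> is empty and every \<open>T t\<close> with \<open>t > 0\<close> has spectrum \<open>{0}\<close>.
  Neither analytic continuation of the resolvent nor the spectral radius formula is
  involved.

  For the converse suppose that \<open>s\<close> lies in the resolvent set. The resolvents \<open>R(m)\<close>
  stay bounded as \<open>m\<close> decreases to \<open>s\<close>, and by positivity they dominate the integrals of
  \<open>exp (-s t) T t x\<close> over \<open>[0, N]\<close> for positive \<open>x\<close>, up to a factor \<open>2\<close>. So these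
  integrals are bounded uniformly in \<open>N\<close> (\<open>resolvent_growth\<close>), and it is enough to
  deduce that \<open>exp (-s t) T t\<close> decays exponentially (\<open>bounded_integrals_decay\<close>), which
  contradicts the choice of \<open>s\<close>.

  The step from bounded integrals to decay is a theorem of Datko type, and it is here
  that the C*-algebra enters. The positive part of the open unit ball is upward directed
  (\<open>cone_directed\<close>). Finitely many positive elements \<open>x n\<close> of norm less than \<open>1\<close> have a
  common upper bound \<open>e\<close> of norm less than \<open>1\<close>, so for a positive functional \<open>\<phi>\<close> the sum
  of the \<open>\<phi> (T n (x n))\<close> is at most the value of \<open>\<phi>\<close> at the sum of the \<open>T n e\<close>. Taking
  suprema over the \<open>x n\<close>, the norms of the functionals \<open>\<phi> \<circ> T n\<close> have a sum of at most
  \<open>C \<parallel>\<phi>\<parallel>\<close>. With \<open>\<phi> \<circ> T m\<close> in place of \<open>\<phi>\<close> this says that the tails of the series shrink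
  by a fixed factor (\<open>geometric_decay_of_tails\<close>, \<open>exponential_decay\<close>). To pass from sums
  to integrals, the \<open>x n\<close> are replaced by a finite net in a compact set of positive
  contractions.

  The facts about the order that are needed are that the positive cone is closed and
  convex, that the norm is monotone on it, that self-adjoint elements are differences of
  positive ones without increase of norm, and directedness. They are first proved in
  unital algebras, by means of square roots given by the binomial series, and then
  transferred along the unitization, in which the algebra is an ideal that contains the
  positive square roots of its elements.

  In a unital algebra \<open>T t 1 \<ge> 1/2\<close> for small \<open>t\<close>, so \<open>s\<close> is finite
  (\<open>not_all_growth_rates\<close>). If \<open>(s - A) x \<ge> r 1\<close> held for some self-adjoint \<open>x\<close> and some
  \<open>r > 0\<close>, then \<open>R(m) 1\<close> would stay bounded as \<open>m\<close> decreases to \<open>s\<close>, and so would the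
  integrals considered above, which is impossible (\<open>range_misses_interior\<close>). By the
  Hahn-Banach theorem some positive functional with value \<open>1\<close> at the unit vanishes on
  the range of \<open>s - A\<close>; this is the required state (\<open>eigenstate\<close>).
\<close>

section \<open>Involution and self-adjoint elements\<close>

lemma star_zero: "star 0 = (0::'a::cstar_algebra)"
  using star_add[of "0::'a" 0] by simp

lemma star_uminus: "star (- x) = - star (x::'a::cstar_algebra)"
  using star_add[of x "-x"] by (simp add: star_zero eq_neg_iff_add_eq_0 add.commute)

lemma star_diff: "star (x - y) = star x - star (y::'a::cstar_algebra)"
  using star_add[of x "-y"] by (simp add: star_uminus)

lemma star_scaleR: "star (r *\<^sub>R x) = r *\<^sub>R star (x::'a::cstar_algebra)"
  using star_scaleC[of "complex_of_real r" x] by (simp add: scaleC_of_real)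

lemma norm_star: "norm (star x) = norm (x::'a::cstar_algebra)"
proof -
  have le: "norm y \<le> norm (star y)" for y :: 'a
  proof (cases "y = 0")
    case False
    have "norm y * norm y \<le> norm (star y) * norm y"
      using norm_mult_ineq[of "star y" y] cstar_identity[of y] by (simp add: power2_eq_square)
    then show ?thesis using False by simp
  qed simp
  show ?thesis using le[of x] le[of "star x"] by (simp add: star_star)
qed

lemma bounded_linear_star: "bounded_linear (star :: 'a::cstar_algebra \<Rightarrow> 'a)"
  by (rule bounded_linear_intro[where K=1]) (simp_all add: star_add star_scaleR norm_star)

lemma scaleC_zero_right: "c *\<^sub>C 0 = (0::'a::complex_normed_vector)"
  using scaleC_add_right[of c "0::'a" 0] by simp

lemma scaleC_zero_left: "0 *\<^sub>C x = (0::'a::complex_normed_vector)"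
  using scaleC_add_left[of 0 0 x] by simp

lemma scaleC_uminus_right: "c *\<^sub>C (- x) = - (c *\<^sub>C (x::'a::complex_normed_vector))"
  using scaleC_add_right[of c x "-x"]
  by (simp add: scaleC_zero_right eq_neg_iff_add_eq_0 add.commute)

lemma scaleC_uminus_left: "(- c) *\<^sub>C x = - (c *\<^sub>C (x::'a::complex_normed_vector))"
  using scaleC_add_left[of c "-c" x]
  by (simp add: scaleC_zero_left eq_neg_iff_add_eq_0 add.commute)

lemma scaleC_diff_right: "c *\<^sub>C (x - y) = c *\<^sub>C x - c *\<^sub>C (y::'a::complex_normed_vector)"
  using scaleC_add_right[of c x "-y"] by (simp add: scaleC_uminus_right)

lemma scaleC_diff_left: "(c - d) *\<^sub>C x = c *\<^sub>C x - d *\<^sub>C (x::'a::complex_normed_vector)"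
  using scaleC_add_left[of c "-d" x] by (simp add: scaleC_uminus_left)

lemma scaleC_one: "1 *\<^sub>C x = (x::'a::complex_normed_vector)"
  using scaleC_of_real[of 1 x] by simp

lemma scaleC_scaleR: "c *\<^sub>C (r *\<^sub>R x) = r *\<^sub>R (c *\<^sub>C (x::'a::complex_normed_vector))"
  by (metis scaleC_of_real scaleC_scaleC mult.commute)

lemma scaleC_i_i: "\<i> *\<^sub>C (\<i> *\<^sub>C x) = - (x::'a::complex_normed_vector)"
  by (simp add: scaleC_scaleC scaleC_uminus_left scaleC_one)

definition selfadjoint :: "'a::cstar_algebra \<Rightarrow> bool" where
  "selfadjoint x \<longleftrightarrow> star x = x"

definition real_part :: "'a::cstar_algebra \<Rightarrow> 'a" where
  "real_part x = (1/2) *\<^sub>R (x + star x)"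

definition imag_part :: "'a::cstar_algebra \<Rightarrow> 'a" where
  "imag_part x = real_part ((-\<i>) *\<^sub>C x)"

lemma selfadjoint_arith:
  fixes x y :: "'a::cstar_algebra"
  shows "selfadjoint x \<Longrightarrow> selfadjoint y \<Longrightarrow> selfadjoint (x + y)"
    and "selfadjoint x \<Longrightarrow> selfadjoint y \<Longrightarrow> selfadjoint (x - y)"
    and "selfadjoint x \<Longrightarrow> selfadjoint (- x)"
    and "selfadjoint x \<Longrightarrow> selfadjoint (r *\<^sub>R x)"
    and "selfadjoint (0::'a)"
  by (simp_all add: selfadjoint_def star_add star_diff star_uminus star_scaleR star_zero)

lemma selfadjoint_mult:
  "selfadjoint x \<Longrightarrow> selfadjoint y \<Longrightarrow> x * y = y * x \<Longrightarrow> selfadjoint (x * (y::'a::cstar_algebra))"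
  by (simp add: selfadjoint_def star_mult)

lemma selfadjoint_star_mult: "selfadjoint (star x * (x::'a::cstar_algebra))"
  by (simp add: selfadjoint_def star_mult star_star)

lemma selfadjoint_real_part: "selfadjoint (real_part (x::'a::cstar_algebra))"
  by (simp add: selfadjoint_def real_part_def star_scaleR star_add star_star add.commute)

lemma selfadjoint_imag_part: "selfadjoint (imag_part (x::'a::cstar_algebra))"
  by (simp add: imag_part_def selfadjoint_real_part)

lemma real_part_selfadjoint: "selfadjoint x \<Longrightarrow> real_part x = (x::'a::cstar_algebra)"
  by (simp add: selfadjoint_def real_part_def)

lemma real_part_imag_part: "real_part x + \<i> *\<^sub>C imag_part x = (x::'a::cstar_algebra)"
proof -
  have "\<i> *\<^sub>C imag_part x = (1/2) *\<^sub>R (x - star x)"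
    by (simp add: imag_part_def real_part_def scaleC_scaleR scaleC_add_right scaleC_uminus_left
        scaleC_uminus_right scaleC_diff_right star_uminus star_scaleC scaleC_i_i)
  then have "real_part x + \<i> *\<^sub>C imag_part x = (1/2) *\<^sub>R (x + x)"
    by (simp add: real_part_def scaleR_add_right[symmetric] del: scaleR_half_double)
  then show ?thesis by simp
qed

lemma norm_real_part: "norm (real_part x) \<le> norm (x::'a::cstar_algebra)"
  using norm_triangle_ineq[of x "star x"] by (simp add: real_part_def norm_star)

lemma norm_imag_part: "norm (imag_part x) \<le> norm (x::'a::cstar_algebra)"
  using norm_real_part[of "(-\<i>) *\<^sub>C x"] by (simp add: imag_part_def norm_scaleC)

lemma norm_selfadjoint_square: "selfadjoint h \<Longrightarrow> norm (h * h) = (norm (h::'a::cstar_algebra))\<^sup>2"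
  using cstar_identity[of h] by (simp add: selfadjoint_def)

section \<open>Square roots by the binomial series\<close>

class cstar_algebra_1 = cstar_algebra + real_normed_algebra_1

text \<open>
  The Taylor coefficients at \<open>0\<close> of the function \<open>sqrt (1 - t)\<close>.
\<close>

definition sqrt_coeff :: "nat \<Rightarrow> real" where
  "sqrt_coeff n = (-1) ^ n * ((1/2) gchoose n)"

lemma sqrt_coeff_0: "sqrt_coeff 0 = 1"
  by (simp add: sqrt_coeff_def)

lemma sqrt_coeff_Suc_nonpos: "sqrt_coeff (Suc n) \<le> 0"
proof (induction n)
  case 0 then show ?case by (simp add: sqrt_coeff_def)
next
  case (Suc n)
  have rec: "((1/2::real) gchoose Suc (Suc n)) = ((1/2) gchoose Suc n) * ((1/2 - real (Suc n)) / (real (Suc n) + 1))"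
    using gbinomial_absorption[of "Suc n" "1/2::real"] gbinomial_mult_1[of "1/2::real" "Suc n"]
    by (simp add: field_simps)
  have "sqrt_coeff (Suc (Suc n)) = sqrt_coeff (Suc n) * ((real (Suc n) - 1/2) / (real (Suc n) + 1))"
    unfolding sqrt_coeff_def rec by (simp add: field_simps)
  moreover have "(real (Suc n) - 1/2) / (real (Suc n) + 1) \<ge> 0" by simp
  ultimately show ?case using Suc by (metis mult_nonpos_nonneg)
qed

text \<open>
  The sums are bounded by \<open>1 - sqrt (1 - t)\<close> when weighted with powers of \<open>t < 1\<close>; let
  \<open>t\<close> tend to \<open>1\<close>. As a consequence the series converges absolutely on the whole closed
  unit ball, its boundary included.
\<close>

lemma sum_sqrt_coeff_bound: "(\<Sum>n<N. - sqrt_coeff (Suc n)) \<le> 1"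
proof -
  have le: "(\<Sum>n<N. - sqrt_coeff (Suc n) * t ^ Suc n) \<le> 1" if t: "0 < t" "t < 1" for t :: real
  proof -
    have "(\<lambda>n. ((1/2) gchoose n) * (-t) ^ n) sums (1 + (-t)) powr (1/2)"
      using t by (intro gen_binomial_real) auto
    moreover have "((1/2) gchoose n) * (-t) ^ n = sqrt_coeff n * t ^ n" for n
      by (simp add: sqrt_coeff_def power_minus[of t])
    ultimately have s: "(\<lambda>n. sqrt_coeff n * t ^ n) sums (1 - t) powr (1/2)" by simp
    then have s': "(\<lambda>n. sqrt_coeff (Suc n) * t ^ Suc n) sums ((1 - t) powr (1/2) - 1)"
      by (subst sums_Suc_iff) (simp add: sqrt_coeff_0)
    have s2: "(\<lambda>n. - sqrt_coeff (Suc n) * t ^ Suc n) sums (1 - (1 - t) powr (1/2))"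
      using sums_minus[OF s'] by simp
    have "(\<Sum>n<N. - sqrt_coeff (Suc n) * t ^ Suc n) \<le> 1 - (1 - t) powr (1/2)"
      unfolding sums_unique[OF s2]
      by (rule sum_le_suminf[OF sums_summable[OF s2]])
        (use t sqrt_coeff_Suc_nonpos in \<open>auto intro!: mult_nonpos_nonneg simp del: power_Suc\<close>)
    also have "\<dots> \<le> 1" by simp
    finally show ?thesis .
  qed
  have lim: "((\<lambda>t. \<Sum>n<N. - sqrt_coeff (Suc n) * t ^ Suc n) \<longlongrightarrow> (\<Sum>n<N. - sqrt_coeff (Suc n) * 1 ^ Suc n)) (at_left 1)"
    by (intro tendsto_intros)
  have ev: "\<forall>\<^sub>F t in at_left (1::real). (\<Sum>n<N. - sqrt_coeff (Suc n) * t ^ Suc n) \<le> 1"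
    using le by (auto simp: eventually_at_left_field intro!: exI[of _ 0])
  have "(\<Sum>n<N. - sqrt_coeff (Suc n) * 1 ^ Suc n) \<le> 1"
    by (rule tendsto_upperbound[OF lim ev]) simp
  then show ?thesis by simp
qed

lemma summable_sqrt_coeff: "summable (\<lambda>n. \<bar>sqrt_coeff n\<bar>)"
proof -
  have "summable (\<lambda>n. - sqrt_coeff (Suc n))"
    using sum_sqrt_coeff_bound sqrt_coeff_Suc_nonpos
    by (intro summableI_nonneg_bounded[where x=1]) auto
  then have "summable (\<lambda>n. \<bar>sqrt_coeff (Suc n)\<bar>)"
    using sqrt_coeff_Suc_nonpos by (simp add: abs_of_nonpos)
  then show ?thesis by (subst (asm) summable_Suc_iff)
qed

definition sqrt_one_minus :: "'a::cstar_algebra_1 \<Rightarrow> 'a" where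
  "sqrt_one_minus x = (\<Sum>n. sqrt_coeff n *\<^sub>R x ^ n)"

lemma summable_norm_sqrt_series:
  fixes x :: "'a::cstar_algebra_1"
  assumes "norm x \<le> 1"
  shows "summable (\<lambda>n. norm (sqrt_coeff n *\<^sub>R x ^ n))"
proof (rule summable_comparison_test'[OF summable_sqrt_coeff])
  fix n
  have "norm (x ^ n) \<le> 1" using norm_power_ineq[of x n] assms power_le_one[of "norm x" n] by simp
  then show "norm (norm (sqrt_coeff n *\<^sub>R x ^ n)) \<le> \<bar>sqrt_coeff n\<bar>"
    by (simp add: mult_left_le)
qed

lemma gbinomial_one: "((1::real) gchoose n) = (if n \<le> 1 then 1 else 0)"
  using binomial_gbinomial[of 1 n, where ?'a = real] by (cases n) (auto simp: binomial_eq_0)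

text \<open>
  By the Vandermonde convolution the coefficients of the Cauchy product are those of
  \<open>1 - t\<close>.
\<close>

lemma sqrt_one_minus_square:
  fixes x :: "'a::cstar_algebra_1"
  assumes "norm x \<le> 1"
  shows "sqrt_one_minus x * sqrt_one_minus x = 1 - x"
proof -
  note s = summable_norm_sqrt_series[OF assms]
  have c: "(\<Sum>i\<le>n. sqrt_coeff i * sqrt_coeff (n - i)) = (-1) ^ n * ((1::real) gchoose n)" for n
  proof -
    have "(\<Sum>i\<le>n. sqrt_coeff i * sqrt_coeff (n - i))
        = (\<Sum>i\<le>n. (-1) ^ n * (((1/2) gchoose i) * ((1/2) gchoose (n - i))))"
    proof (intro sum.cong refl)
      fix i assume "i \<in> {..n}"
      then have "(-1::real) ^ i * (-1) ^ (n - i) = (-1) ^ n" by (simp flip: power_add)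
      then show "sqrt_coeff i * sqrt_coeff (n - i) = (-1) ^ n * (((1/2) gchoose i) * ((1/2) gchoose (n - i)))"
        unfolding sqrt_coeff_def by (metis mult.assoc mult.left_commute)
    qed
    also have "\<dots> = (-1) ^ n * ((1::real) gchoose n)"
      using gbinomial_Vandermonde[of "1/2::real" "1/2" n]
      by (simp add: sum_distrib_left[symmetric] atMost_atLeast0)
    finally show ?thesis .
  qed
  have e: "(\<Sum>i\<le>n. sqrt_coeff i *\<^sub>R x ^ i * sqrt_coeff (n - i) *\<^sub>R x ^ (n - i))
     = (if n = 0 then 1 else if n = 1 then - x else 0)" for n
  proof -
    have "(\<Sum>i\<le>n. sqrt_coeff i *\<^sub>R x ^ i * sqrt_coeff (n - i) *\<^sub>R x ^ (n - i))
       = (\<Sum>i\<le>n. (sqrt_coeff i * sqrt_coeff (n - i)) *\<^sub>R x ^ n)"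
      by (intro sum.cong refl) (auto simp: power_add[symmetric] mult.commute)
    also have "\<dots> = ((-1) ^ n * ((1::real) gchoose n)) *\<^sub>R x ^ n"
      by (simp add: scaleR_sum_left[symmetric] c)
    also have "\<dots> = (if n = 0 then 1 else if n = 1 then - x else 0)"
      by (auto simp: gbinomial_one)
    finally show ?thesis .
  qed
  have "(\<lambda>n. if n = 0 then 1 else if n = 1 then - x else 0)
      sums (sqrt_one_minus x * sqrt_one_minus x)"
    using Cauchy_product_sums[OF s s] unfolding e sqrt_one_minus_def .
  moreover have "(\<lambda>n::nat. if n = 0 then 1 else if n = 1 then - x else 0) sums
     (\<Sum>n\<in>{0,1::nat}. (if n = 0 then 1 else if n = 1 then - x else 0))"
    by (rule sums_finite) auto
  ultimately show ?thesis using sums_unique2 by fastforce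
qed

lemma norm_one_minus_sqrt:
  fixes x :: "'a::cstar_algebra_1"
  assumes "norm x \<le> 1"
  shows "norm (1 - sqrt_one_minus x) \<le> 1"
proof -
  note s = summable_norm_sqrt_series[OF assms]
  have "(\<lambda>n. sqrt_coeff n *\<^sub>R x ^ n) sums sqrt_one_minus x"
    unfolding sqrt_one_minus_def using summable_norm_cancel[OF s] by (rule summable_sums)
  then have "(\<lambda>n. \<Sum>i<Suc n. sqrt_coeff i *\<^sub>R x ^ i) \<longlonglongrightarrow> sqrt_one_minus x"
    unfolding sums_def by (rule LIMSEQ_Suc)
  then have lim: "(\<lambda>n. norm (1 - (\<Sum>i<Suc n. sqrt_coeff i *\<^sub>R x ^ i))) \<longlonglongrightarrow> norm (1 - sqrt_one_minus x)"
    by (intro tendsto_intros)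
  have le: "norm (1 - (\<Sum>i<Suc n. sqrt_coeff i *\<^sub>R x ^ i)) \<le> 1" for n
  proof -
    have "1 - (\<Sum>i<Suc n. sqrt_coeff i *\<^sub>R x ^ i) = (\<Sum>i<n. (- sqrt_coeff (Suc i)) *\<^sub>R x ^ Suc i)"
      by (subst sum.lessThan_Suc_shift) (simp add: sqrt_coeff_0 sum_negf del: power_Suc)
    also have "norm \<dots> \<le> (\<Sum>i<n. - sqrt_coeff (Suc i))"
    proof (rule sum_norm_le)
      fix i
      have "norm (x ^ Suc i) \<le> 1"
        using norm_power_ineq[of x "Suc i"] assms power_le_one[of "norm x" "Suc i"] by simp
      then show "norm ((- sqrt_coeff (Suc i)) *\<^sub>R x ^ Suc i) \<le> - sqrt_coeff (Suc i)"
        using sqrt_coeff_Suc_nonpos[of i] mult_left_le[of "norm (x ^ Suc i)" "- sqrt_coeff (Suc i)"]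
        by (simp del: power_Suc)
    qed
    also have "\<dots> \<le> 1" by (rule sum_sqrt_coeff_bound)
    finally show ?thesis .
  qed
  show ?thesis by (rule LIMSEQ_le_const2[OF lim]) (use le in blast)
qed

lemma sqrt_one_minus_commute:
  fixes x :: "'a::cstar_algebra_1"
  assumes "norm x \<le> 1" "y * x = x * y"
  shows "y * sqrt_one_minus x = sqrt_one_minus x * y"
proof -
  note s = summable_norm_cancel[OF summable_norm_sqrt_series[OF assms(1)]]
  have "y * x ^ n = x ^ n * y" for n
    using assms(2) by (metis power_commuting_commutes)
  then show ?thesis
    unfolding sqrt_one_minus_def using suminf_mult[OF s, of y] suminf_mult2[OF s, of y] by simp
qed

lemma star_one: "star 1 = (1::'a::cstar_algebra_1)"
  by (metis mult.right_neutral mult_1 star_mult star_star)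

lemma star_power: "star (x ^ n) = star (x::'a::cstar_algebra_1) ^ n"
  by (induction n) (simp_all add: star_one star_mult power_commutes)

lemma selfadjoint_sqrt_one_minus:
  fixes x :: "'a::cstar_algebra_1"
  assumes "norm x \<le> 1" "selfadjoint x"
  shows "selfadjoint (sqrt_one_minus x)"
proof -
  note s = summable_norm_cancel[OF summable_norm_sqrt_series[OF assms(1)]]
  show ?thesis
    using bounded_linear.suminf[OF bounded_linear_star s] assms(2)
    by (simp add: selfadjoint_def sqrt_one_minus_def star_scaleR star_power)
qed

lemma selfadjoint_one: "selfadjoint (1::'a::cstar_algebra_1)"
  by (simp add: selfadjoint_def star_one)

lemma selfadjoint_of_real: "selfadjoint (of_real r ::'a::cstar_algebra_1)"
  by (simp add: of_real_def selfadjoint_arith selfadjoint_one)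

section \<open>The positive cone of a unital C*-algebra\<close>

text \<open>
  For self-adjoint \<open>a\<close> the inequality says that the spectrum of \<open>a\<close> lies between \<open>0\<close> and
  \<open>2 r\<close>. In this form the cone is convex by the triangle inequality.
\<close>

definition psd :: "'a::cstar_algebra_1 \<Rightarrow> bool" where
  "psd a \<longleftrightarrow> selfadjoint a \<and> (\<exists>r. norm (of_real r - a) \<le> r)"

lemma psd_selfadjoint: "psd a \<Longrightarrow> selfadjoint a"
  by (simp add: psd_def)

lemma psdI: "selfadjoint a \<Longrightarrow> norm (of_real r - a) \<le> r \<Longrightarrow> psd a"
  unfolding psd_def by (intro conjI exI)

lemma psd_0: "psd 0"
  by (auto simp: psd_def selfadjoint_arith intro!: exI[of _ 0])

lemma psd_add: "psd a \<Longrightarrow> psd b \<Longrightarrow> psd (a + b)"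
proof -
  assume "psd a" "psd b"
  then obtain r s where *: "norm (of_real r - a) \<le> r" "norm (of_real s - b) \<le> s"
    "selfadjoint a" "selfadjoint b" by (auto simp: psd_def)
  have "norm ((of_real r - a) + (of_real s - b)) \<le> r + s"
    using * by (intro norm_triangle_le) simp
  also have "(of_real r - a) + (of_real s - b) = of_real (r + s) - (a + b)" by simp
  finally show ?thesis using * by (intro psdI[where r="r+s"] selfadjoint_arith(1))
qed

lemma psd_scaleR: "psd a \<Longrightarrow> 0 \<le> t \<Longrightarrow> psd (t *\<^sub>R a)"
proof -
  assume "psd a" "0 \<le> t"
  then obtain r where *: "norm (of_real r - a) \<le> r" "selfadjoint a" by (auto simp: psd_def)
  have "of_real (t * r) - t *\<^sub>R a = t *\<^sub>R (of_real r - a)"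
    by (simp add: scaleR_diff_right of_real_def)
  then have "norm (of_real (t * r) - t *\<^sub>R a) \<le> t * r"
    using *(1) \<open>0 \<le> t\<close> by (simp add: mult_left_mono)
  then show ?thesis using * by (intro psdI[where r="t*r"] selfadjoint_arith(4))
qed

lemma psd_of_real: "0 \<le> r \<Longrightarrow> psd (of_real r)"
  by (auto simp: psd_def selfadjoint_of_real intro!: exI[of _ r])

lemma psd_one: "psd 1"
  using psd_of_real[of 1] by simp

lemma psd_norm_minus: "selfadjoint a \<Longrightarrow> psd (of_real (norm a) - a)"
  by (auto simp: psd_def selfadjoint_arith selfadjoint_of_real intro!: exI[of _ "norm a"])

text \<open>
  If \<open>\<parallel>r - a\<parallel> \<le> r\<close>, the binomial series applies to \<open>1 - a/r\<close>, which has norm at most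
  \<open>1\<close>. The commutation property stands in for functional calculus: the roots of
  commuting positive elements commute.
\<close>

lemma psd_sqrt:
  fixes a :: "'a::cstar_algebra_1"
  assumes "psd a"
  obtains h where "psd h" "h * h = a" "\<And>y. y * a = a * y \<Longrightarrow> y * h = h * y"
proof -
  obtain r where r: "norm (of_real r - a) \<le> r" and sa: "selfadjoint a"
    using assms by (auto simp: psd_def)
  show ?thesis
  proof (cases "r = 0")
    case True
    then have "a = 0" using r by simp
    then show ?thesis using that[of 0] psd_0 by simp
  next
    case False
    have "0 \<le> r" using r norm_ge_zero order_trans by blast
    with False have r0: "0 < r" by simp
    define x where "x = 1 - (1/r) *\<^sub>R a"
    have x: "x = (1/r) *\<^sub>R (of_real r - a)" using r0 by (simp add: x_def scaleR_diff_right of_real_def)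
    have nx: "norm x \<le> 1" unfolding x using r r0 by (simp add: divide_simps)
    have sx: "selfadjoint x" by (simp add: x_def sa selfadjoint_arith selfadjoint_one)
    define h where "h = sqrt r *\<^sub>R sqrt_one_minus x"
    have "of_real (sqrt r) - h = sqrt r *\<^sub>R (1 - sqrt_one_minus x)"
      by (simp add: h_def scaleR_diff_right of_real_def)
    then have "norm (of_real (sqrt r) - h) \<le> sqrt r"
      using norm_one_minus_sqrt[OF nx] r0 by (simp add: mult_left_le)
    moreover have "selfadjoint h"
      unfolding h_def by (intro selfadjoint_arith selfadjoint_sqrt_one_minus nx sx)
    ultimately have "psd h" by (auto simp: psd_def)
    moreover have "h * h = a"
      using r0 by (simp add: h_def sqrt_one_minus_square[OF nx]) (simp add: x_def)
    moreover have "y * h = h * y" if "y * a = a * y" for y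
    proof -
      have "y * x = x * y" using that by (simp add: x_def algebra_simps)
      then show ?thesis using sqrt_one_minus_commute[OF nx] by (simp add: h_def)
    qed
    ultimately show ?thesis using that by blast
  qed
qed

text \<open>
  The element \<open>u = h + \<i> k\<close> satisfies \<open>star u * u = r\<close>, hence \<open>\<parallel>u\<parallel>\<^sup>2 = \<bar>r\<bar>\<close>, and \<open>h\<close> and
  \<open>k\<close> are its real and imaginary parts.
\<close>

lemma norm_commuting_components:
  fixes h k :: "'a::cstar_algebra_1"
  assumes "selfadjoint h" "selfadjoint k" "h * k = k * h" "h * h + k * k = of_real r"
  shows "(norm h)\<^sup>2 \<le> \<bar>r\<bar>" "(norm k)\<^sup>2 \<le> \<bar>r\<bar>"
proof -
  define u where "u = h + \<i> *\<^sub>C k"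
  have su: "star u = h - \<i> *\<^sub>C k"
    using assms by (simp add: u_def star_add star_scaleC selfadjoint_def scaleC_uminus_left)
  have "star u * u = h * h + k * k"
    unfolding su unfolding u_def
    by (simp add: algebra_simps scaleC_mult_left scaleC_mult_right scaleC_i_i assms(3) scaleC_diff_right)
  then have nu: "(norm u)\<^sup>2 = \<bar>r\<bar>" using cstar_identity[of u] assms(4) by simp
  have "2 *\<^sub>R h = u + star u" unfolding su by (simp add: u_def scaleR_2)
  then have "norm (2 *\<^sub>R h) \<le> 2 * norm u" using norm_triangle_ineq[of u "star u"] by (simp add: norm_star)
  then have "norm h \<le> norm u" by simp
  then show "(norm h)\<^sup>2 \<le> \<bar>r\<bar>" using nu by (metis norm_ge_zero power_mono)
  have "2 *\<^sub>R (\<i> *\<^sub>C k) = u - star u" unfolding su by (simp add: u_def scaleR_2)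
  then have "norm (2 *\<^sub>R (\<i> *\<^sub>C k)) \<le> 2 * norm u" using norm_triangle_ineq4[of u "star u"] by (simp add: norm_star)
  then have "norm k \<le> norm u" by (simp add: norm_scaleC)
  then show "(norm k)\<^sup>2 \<le> \<bar>r\<bar>" using nu by (metis norm_ge_zero power_mono)
qed

text \<open>
  The element \<open>r - h\<^sup>2\<close> is the square of some self-adjoint \<open>k\<close> that commutes with \<open>h\<close>,
  so its norm is estimated by \<open>norm_commuting_components\<close>.
\<close>

lemma norm_of_real_minus_square:
  fixes h :: "'a::cstar_algebra_1"
  assumes h: "selfadjoint h" and r: "(norm h)\<^sup>2 \<le> r"
  shows "norm (of_real r - h * h) \<le> r"
proof (cases "r = 0")
  case True
  then show ?thesis using r by simp
next
  case False
  then have r0: "0 < r" using r by (smt (verit) zero_le_power2)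
  define x where "x = (1/r) *\<^sub>R (h * h)"
  have nx: "norm x \<le> 1" using r r0 by (simp add: x_def norm_selfadjoint_square[OF h])
  have sx: "selfadjoint x" by (simp add: x_def selfadjoint_arith selfadjoint_mult h)
  define k where "k = sqrt r *\<^sub>R sqrt_one_minus x"
  have kk: "k * k = of_real r - h * h"
    using r0 by (simp add: k_def sqrt_one_minus_square[OF nx]) (simp add: x_def scaleR_diff_right of_real_def)
  have sk: "selfadjoint k" unfolding k_def by (intro selfadjoint_arith selfadjoint_sqrt_one_minus nx sx)
  have "h * sqrt_one_minus x = sqrt_one_minus x * h"
    by (rule sqrt_one_minus_commute[OF nx]) (simp add: x_def mult.assoc)
  then have "h * k = k * h" by (simp add: k_def)
  from norm_commuting_components(2)[OF h sk this, of r] have "(norm k)\<^sup>2 \<le> r"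
    using r0 kk by simp
  then show ?thesis unfolding norm_selfadjoint_square[OF sk, symmetric] kk .
qed

lemma psd_square: "selfadjoint h \<Longrightarrow> psd (h * (h::'a::cstar_algebra_1))"
  by (rule psdI[OF _ norm_of_real_minus_square[OF _ order_refl]]) (simp_all add: selfadjoint_mult)

text \<open>
  Positive elements are squares, so \<open>norm_of_real_minus_square\<close> applies. A bounded
  sequence of positive elements thus has a common witness \<open>r\<close>, which makes the cone
  closed.
\<close>

lemma psd_norm_of_real_minus:
  fixes a :: "'a::cstar_algebra_1"
  assumes "psd a" "norm a \<le> r"
  shows "norm (of_real r - a) \<le> r"
proof -
  obtain h where h: "psd h" "h * h = a" using psd_sqrt[OF assms(1)] by blast
  then have sh: "selfadjoint h" by (simp add: psd_selfadjoint)
  show ?thesis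
    using norm_of_real_minus_square[OF sh, of r] assms(2) norm_selfadjoint_square[OF sh] h by simp
qed

lemma psd_closed:
  fixes a :: "nat \<Rightarrow> 'a::cstar_algebra_1"
  assumes "\<And>n. psd (a n)" "a \<longlonglongrightarrow> l"
  shows "psd l"
proof -
  have "Bseq a" using assms(2) by (intro convergent_imp_Bseq convergentI)
  then obtain K where K: "\<And>n. norm (a n) \<le> K" by (auto simp: Bseq_def)
  have "(\<lambda>n. norm (of_real K - a n)) \<longlonglongrightarrow> norm (of_real K - l)"
    by (intro tendsto_intros assms)
  then have "norm (of_real K - l) \<le> K"
    by (rule LIMSEQ_le_const2) (use psd_norm_of_real_minus[OF assms(1) K] in blast)
  moreover have "star l = l"
  proof (rule LIMSEQ_unique)
    show "(\<lambda>n. star (a n)) \<longlonglongrightarrow> star l"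
      by (rule bounded_linear.tendsto[OF bounded_linear_star assms(2)])
    show "(\<lambda>n. star (a n)) \<longlonglongrightarrow> l"
      using assms(2) psd_selfadjoint[OF assms(1)] by (simp add: selfadjoint_def)
  qed
  ultimately show ?thesis by (auto simp: psd_def selfadjoint_def)
qed

lemma psd_mult:
  fixes a b :: "'a::cstar_algebra_1"
  assumes "psd a" "psd b" "a * b = b * a"
  shows "psd (a * b)"
proof -
  obtain m where m: "psd m" "m * m = a" "\<And>y. y * a = a * y \<Longrightarrow> y * m = m * y"
    using psd_sqrt[OF assms(1)] by blast
  obtain n where n: "psd n" "n * n = b" "\<And>y. y * b = b * y \<Longrightarrow> y * n = n * y"
    using psd_sqrt[OF assms(2)] by blast
  have "b * m = m * b" using m(3) assms(3) by simp
  then have mn: "m * n = n * m" using n(3) by simp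
  then have "selfadjoint (m * n)" using m(1) n(1) by (intro selfadjoint_mult psd_selfadjoint)
  moreover have "(m * n) * (m * n) = a * b"
    using m(2) n(2) mn by (metis mult.assoc)
  ultimately show ?thesis using psd_square by metis
qed

text \<open>
  The roots of \<open>a\<close> and of \<open>r - a\<close> commute and their squares add up to \<open>r\<close>.
\<close>

lemma psd_norm_le:
  fixes a :: "'a::cstar_algebra_1"
  assumes "psd a" "psd (of_real r - a)" "0 \<le> r"
  shows "norm a \<le> r"
proof -
  obtain m where m: "psd m" "m * m = a" "\<And>y. y * a = a * y \<Longrightarrow> y * m = m * y"
    using psd_sqrt[OF assms(1)] by blast
  obtain n where n: "psd n" "n * n = of_real r - a"
    "\<And>y. y * (of_real r - a) = (of_real r - a) * y \<Longrightarrow> y * n = n * y"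
    using psd_sqrt[OF assms(2)] by blast
  have "m * a = a * m" using m(2) by (metis mult.assoc)
  then have "m * n = n * m" by (intro n(3)) (simp add: algebra_simps of_real_def)
  moreover have "m * m + n * n = of_real r" unfolding m(2) n(2) by simp
  ultimately have "(norm m)\<^sup>2 \<le> \<bar>r\<bar>"
    using m(1) n(1) by (intro norm_commuting_components(1) psd_selfadjoint)
  then show ?thesis using assms(3) norm_selfadjoint_square[of m] m(1,2) by (simp add: psd_selfadjoint)
qed

lemma psd_norm_mono:
  fixes a b :: "'a::cstar_algebra_1"
  assumes "psd a" "psd (b - a)"
  shows "norm a \<le> norm b"
proof -
  have "psd b" using psd_add[OF assms] by simp
  then have "psd (of_real (norm b) - b)" by (intro psd_norm_minus psd_selfadjoint)
  from psd_add[OF this assms(2)] show ?thesis using assms(1) by (intro psd_norm_le) simp_all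
qed

section \<open>Inverses\<close>

lemma neumann_inverse:
  fixes x :: "'a::cstar_algebra_1"
  assumes "norm x < 1"
  obtains v where "v * (1 - x) = 1" "(1 - x) * v = 1"
proof -
  have sm: "summable (\<lambda>n. x ^ n)"
  proof (rule summable_norm_cancel, rule summable_comparison_test'[where N=0])
    show "summable (\<lambda>n. norm x ^ n)" using assms by (intro summable_geometric) simp
    show "norm (norm (x ^ n)) \<le> norm x ^ n" for n by (simp add: norm_power_ineq)
  qed
  define v where "v = (\<Sum>n. x ^ n)"
  have "v = x ^ 0 + (\<Sum>n. x ^ Suc n)"
    unfolding v_def using suminf_split_head[OF sm] by simp
  then have e: "v = 1 + (\<Sum>n. x ^ Suc n)" by simp
  have "(\<Sum>n. x ^ Suc n) = x * v" unfolding v_def by (simp add: suminf_mult[OF sm])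
  moreover have "(\<Sum>n. x ^ Suc n) = v * x" unfolding v_def by (simp add: suminf_mult2[OF sm] power_commutes)
  ultimately show ?thesis using that[of v] e by (simp add: algebra_simps)
qed

lemma inverse_commute:
  fixes u v y :: "'a::monoid_mult"
  assumes "v * u = 1" "u * v = 1" "y * u = u * y"
  shows "y * v = v * y"
proof -
  have "y * v = (v * u) * (y * v)" using assms by simp
  also have "\<dots> = v * (y * u) * v" using assms(3) by (simp add: mult.assoc)
  also have "\<dots> = v * y" using assms(2) by (simp add: mult.assoc)
  finally show ?thesis .
qed

text \<open>
  The inverse is \<open>v = v\<^sup>2 u\<close>, a product of commuting positive elements.
\<close>

lemma psd_inverse:
  fixes u v :: "'a::cstar_algebra_1"
  assumes "psd u" "v * u = 1" "u * v = 1"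
  shows "psd v"
proof -
  have su: "star u = u" using psd_selfadjoint[OF assms(1)] by (simp add: selfadjoint_def)
  have "star v * u = 1" using arg_cong[OF assms(3), of star] by (simp add: star_mult star_one su)
  then have "star v = v" by (metis assms(3) mult.assoc mult.right_neutral mult_1)
  then have "selfadjoint v" by (simp add: selfadjoint_def)
  then have "psd (v * v)" by (rule psd_square)
  moreover have "u * (v * v) = (v * v) * u" using assms(2,3) by (metis mult.assoc mult.right_neutral mult_1)
  ultimately have "psd ((v * v) * u)" using assms(1) by (intro psd_mult[of "v * v" u]) simp_all
  moreover have "(v * v) * u = v" using assms(2) by (simp add: mult.assoc)
  ultimately show ?thesis by simp
qed

lemma psd_shift_inverse:
  fixes a :: "'a::cstar_algebra_1"
  assumes "psd a" "0 < d"
  obtains v where "v * (of_real d + a) = 1" "(of_real d + a) * v = 1" "psd v"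
proof -
  define r where "r = norm a"
  have le: "norm (of_real r - a) \<le> r" using psd_norm_of_real_minus[OF assms(1)] by (simp add: r_def)
  have dr: "0 < d + r" using assms(2) by (simp add: r_def add_pos_nonneg)
  define x where "x = (1 / (d + r)) *\<^sub>R (of_real r - a)"
  have "norm x < 1" using le assms(2) dr by (simp add: x_def divide_simps)
  then obtain w where w: "w * (1 - x) = 1" "(1 - x) * w = 1" using neumann_inverse by blast
  have e: "of_real d + a = (d + r) *\<^sub>R (1 - x)"
    using dr by (simp add: x_def scaleR_diff_right of_real_def scaleR_add_left)
  define v where "v = (1 / (d + r)) *\<^sub>R w"
  have v: "v * (of_real d + a) = 1" "(of_real d + a) * v = 1"
    unfolding e v_def using w dr by (simp_all)
  have "psd (of_real d + a)" using assms by (intro psd_add psd_of_real) simp_all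
  then show ?thesis using that v psd_inverse by blast
qed

text \<open>
  The modulus of \<open>y\<close> is the root \<open>h\<close> of \<open>y\<^sup>2\<close>. To see that \<open>p = h + y\<close> is positive, let
  \<open>v\<close> be the inverse of \<open>h + d\<close> with \<open>d > 0\<close>, and \<open>w = v p\<close>. Since \<open>p\<^sup>2 = 2 h p\<close>, the
  element \<open>p - d w\<close> equals \<open>v p\<^sup>2 / 2\<close> and is positive, while \<open>\<parallel>w\<parallel> \<le> 2\<close> independently of
  \<open>d\<close>. Let \<open>d\<close> tend to \<open>0\<close>.
\<close>

lemma selfadjoint_abs:
  fixes y :: "'a::cstar_algebra_1"
  assumes y: "selfadjoint y"
  obtains h where "psd h" "h * h = y * y" "h * y = y * h" "psd (h + y)" "psd (h - y)"
proof -
  obtain h where h: "psd h" "h * h = y * y" "\<And>z. z * (y * y) = (y * y) * z \<Longrightarrow> z * h = h * z"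
    using psd_sqrt[OF psd_square[OF y]] by blast
  have hy: "h * y = y * h" using h(3)[of y] by (simp add: mult.assoc)
  have pos: "psd (h + q)" if q: "selfadjoint q" "h * h = q * q" "h * q = q * h" for q
  proof -
    define p where "p = h + q"
    have sp: "selfadjoint p" using q h(1) by (simp add: p_def selfadjoint_arith psd_selfadjoint)
    have hp: "h * p = p * h" by (simp add: p_def algebra_simps q)
    have pp: "p * p = 2 *\<^sub>R (h * p)" by (simp add: p_def algebra_simps q scaleR_2)
    have ex: "\<exists>w. norm w \<le> 2 \<and> psd (p - d *\<^sub>R w)" if d: "0 < d" for d
    proof -
      obtain v where v: "v * (of_real d + h) = 1" "(of_real d + h) * v = 1" "psd v"
        using psd_shift_inverse[OF h(1) d] by blast
      have "h * v = v * h" by (rule inverse_commute[OF v(1,2)]) (simp add: algebra_simps of_real_def)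
      have pv: "p * v = v * p" by (rule inverse_commute[OF v(1,2)]) (simp add: algebra_simps of_real_def hp)
      define w where "w = v * p"
      have sw: "selfadjoint w" unfolding w_def using pv v(3) sp by (intro selfadjoint_mult) (auto simp: psd_selfadjoint)
      have psd1: "psd (h * v)" using h(1) v(3) \<open>h * v = v * h\<close> by (intro psd_mult)
      have one: "d *\<^sub>R v + h * v = 1" using v(2) by (simp add: algebra_simps of_real_def)
      then have "of_real 1 - h * v = d *\<^sub>R v" by (simp add: algebra_simps)
      then have "psd (of_real 1 - h * v)" using v(3) d by (simp add: psd_scaleR)
      then have nhv: "norm (h * v) \<le> 1" using psd1 by (intro psd_norm_le) simp_all
      have "w * w = v * (p * v) * p" by (simp add: w_def mult.assoc)
      also have "\<dots> = v * v * (p * p)" by (simp add: pv mult.assoc)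
      also have "\<dots> = 2 *\<^sub>R (v * v * h * p)" by (simp add: pp mult.assoc)
      also have "v * v * h * p = (h * v) * w"
        unfolding w_def using \<open>h * v = v * h\<close> by (metis mult.assoc)
      finally have ww: "w * w = 2 *\<^sub>R ((h * v) * w)" .
      have "(norm w)\<^sup>2 = norm (w * w)" using norm_selfadjoint_square[OF sw] by simp
      also have "\<dots> = 2 * norm ((h * v) * w)" by (simp add: ww)
      also have "\<dots> \<le> 2 * (norm (h * v) * norm w)" by (simp add: norm_mult_ineq)
      also have "\<dots> \<le> 2 * (1 * norm w)" using nhv by (intro mult_left_mono mult_right_mono) simp_all
      finally have "norm w * norm w \<le> 2 * norm w" by (simp add: power2_eq_square)
      then have nw: "norm w \<le> 2" by (cases "w = 0") auto
      have "p = (d *\<^sub>R v + h * v) * p" using one by simp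
      then have "p - d *\<^sub>R w = (h * v) * p" by (simp add: w_def algebra_simps)
      also have "\<dots> = (1/2) *\<^sub>R (v * (p * p))" using \<open>h * v = v * h\<close> by (simp add: pp mult.assoc)
      finally have eq: "p - d *\<^sub>R w = (1/2) *\<^sub>R (v * (p * p))" .
      have "v * (p * p) = (p * p) * v" using pv by (metis mult.assoc)
      then have "psd (v * (p * p))" using v(3) psd_square[OF sp] by (intro psd_mult[of v "p * p"])
      then have "psd (p - d *\<^sub>R w)" unfolding eq by (intro psd_scaleR) simp_all
      then show ?thesis using nw by blast
    qed
    have "\<forall>n. \<exists>w. norm w \<le> 2 \<and> psd (p - inverse (real (Suc n)) *\<^sub>R w)" by (intro allI ex) simp
    then obtain w where w: "\<And>n. norm (w n) \<le> 2" "\<And>n. psd (p - inverse (real (Suc n)) *\<^sub>R w n)"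
      by metis
    have "(\<lambda>n. inverse (real (Suc n)) *\<^sub>R w n) \<longlonglongrightarrow> 0"
    proof (rule Lim_null_comparison[where g = "\<lambda>n. inverse (real (Suc n)) * 2"])
      show "\<forall>\<^sub>F n in sequentially. norm (inverse (real (Suc n)) *\<^sub>R w n) \<le> inverse (real (Suc n)) * 2"
        using w(1) by (intro always_eventually allI) (simp add: mult_left_mono)
      show "(\<lambda>n. inverse (real (Suc n)) * 2) \<longlonglongrightarrow> 0"
        using LIMSEQ_inverse_real_of_nat tendsto_mult_left_zero by blast
    qed
    then have "(\<lambda>n. p - inverse (real (Suc n)) *\<^sub>R w n) \<longlonglongrightarrow> p - 0" by (intro tendsto_intros)
    then show ?thesis using psd_closed[of "\<lambda>n. p - inverse (real (Suc n)) *\<^sub>R w n"] w(2) by (simp add: p_def)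
  qed
  have "psd (h + y)" by (rule pos[OF y h(2) hy])
  moreover have "psd (h + (-y))"
    by (rule pos[OF selfadjoint_arith(3)[OF y]]) (simp_all add: h(2) hy)
  ultimately show ?thesis using that[OF h(1,2) hy] by simp
qed

section \<open>Every star-square is positive\<close>

lemma star_square_sum_psd: "psd (star z * z + z * star (z::'a::cstar_algebra_1))"
proof -
  define h where "h = real_part z"
  define k where "k = imag_part z"
  have sa: "selfadjoint h" "selfadjoint k" by (simp_all add: h_def k_def selfadjoint_real_part selfadjoint_imag_part)
  have z: "z = h + \<i> *\<^sub>C k" by (simp add: h_def k_def real_part_imag_part)
  have sz: "star z = h - \<i> *\<^sub>C k"
    unfolding z using sa by (simp add: star_add star_scaleC selfadjoint_def scaleC_uminus_left)
  have "star z * z + z * star z = 2 *\<^sub>R (h * h) + 2 *\<^sub>R (k * k)"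
    unfolding sz unfolding z by (simp add: algebra_simps scaleC_mult_left scaleC_mult_right scaleC_i_i scaleC_diff_right scaleR_2 scaleC_add_right)
  then show ?thesis using sa by (simp add: psd_add psd_scaleR psd_square)
qed

text \<open>
  With \<open>a = - star z * z\<close> the element \<open>z * star z\<close> is positive, so \<open>1 + z * star z\<close> is
  invertible, and hence so is \<open>1 + star z * z = 1 - a\<close>. If \<open>c\<close> is the inverse, then
  \<open>1 - a \<ge> 1 / \<parallel>c\<parallel>\<close>, which is impossible for a positive element \<open>a\<close> of norm \<open>1\<close>.
\<close>

lemma neg_star_square_zero_unit:
  fixes z :: "'a::cstar_algebra_1"
  assumes neg: "psd (- (star z * z))" and nz: "norm z = 1"
  shows False
proof -
  define a where "a = - (star z * z)"
  have a: "psd a" "norm a = 1" using neg nz cstar_identity[of z] by (simp_all add: a_def)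
  have "psd (star z * z + z * star z + a)" using a(1) star_square_sum_psd by (intro psd_add[of "star z * z + z * star z"])
  then have b: "psd (z * star z)" by (simp add: a_def)
  obtain v where v: "v * (1 + z * star z) = 1" "(1 + z * star z) * v = 1"
    using psd_shift_inverse[OF b, of 1] by auto
  define c where "c = 1 - star z * v * z"
  have "(1 - a) * c = 1 + star z * z - star z * ((1 + z * star z) * v) * z"
    by (simp add: c_def a_def algebra_simps)
  then have c1: "(1 - a) * c = 1" by (simp add: v)
  have "c * (1 - a) = 1 + star z * z - star z * (v * (1 + z * star z)) * z"
    by (simp add: c_def a_def algebra_simps)
  then have c2: "c * (1 - a) = 1" by (simp add: v)
  have pa: "psd (1 - a)" using psd_norm_minus[of a] a by (simp add: psd_selfadjoint)
  have pc: "psd c" by (rule psd_inverse[OF pa c2 c1])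
  define K where "K = norm c"
  have "c \<noteq> 0" using c1 by auto
  then have K: "0 < K" by (simp add: K_def)
  have "psd (of_real K - c)" using pc by (simp add: K_def psd_norm_minus psd_selfadjoint)
  then have "psd ((of_real K - c) * (1 - a))"
  proof (rule psd_mult[OF _ pa])
    show "(of_real K - c) * (1 - a) = (1 - a) * (of_real K - c)"
      unfolding left_diff_distrib[of "of_real K" c "1 - a"] right_diff_distrib[of "1 - a" "of_real K" c] c1 c2
      by (simp add: algebra_simps of_real_def)
  qed
  moreover have "(of_real K - c) * (1 - a) = K *\<^sub>R (1 - a) - 1"
    using c2 by (simp add: algebra_simps of_real_def)
  ultimately have "psd ((1/K) *\<^sub>R (K *\<^sub>R (1 - a) - 1))" using K by (intro psd_scaleR) simp_all
  moreover have "(1/K) *\<^sub>R (K *\<^sub>R (1 - a) - 1) = of_real (1 - 1/K) - a"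
    using K by (simp add: algebra_simps of_real_def)
  ultimately have "psd (of_real (1 - 1/K) - a)" by simp
  moreover have "psd (of_real (max 0 (1 - 1/K) - (1 - 1/K)) :: 'a)" by (intro psd_of_real) simp
  ultimately have "psd (of_real (1 - 1/K) - a + of_real (max 0 (1 - 1/K) - (1 - 1/K)))" by (rule psd_add)
  then have "psd (of_real (max 0 (1 - 1/K)) - a)" by (simp add: algebra_simps)
  then have "norm a \<le> max 0 (1 - 1/K)" using a by (intro psd_norm_le) simp_all
  then show False using K a by (simp add: max_def split: if_splits)
qed

lemma neg_star_square_zero:
  fixes z :: "'a::cstar_algebra_1"
  assumes "psd (- (star z * z))"
  shows "z = 0"
proof (rule ccontr)
  assume "z \<noteq> 0"
  define w where "w = (1 / norm z) *\<^sub>R z"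
  have "norm w = 1" using \<open>z \<noteq> 0\<close> by (simp add: w_def)
  moreover have "- (star w * w) = (1 / norm z * (1 / norm z)) *\<^sub>R (- (star z * z))"
    by (simp add: w_def star_scaleR)
  then have "psd (- (star w * w))" using assms by (simp only:) (intro psd_scaleR, simp_all)
  ultimately show False using neg_star_square_zero_unit by blast
qed

text \<open>
  Kaplansky: if \<open>h\<close> is the modulus of \<open>y = star x * x\<close> and \<open>w = h - y\<close> is twice its
  negative part, then \<open>z = x w\<close> satisfies \<open>- star z * z = h w\<^sup>2 \<ge> 0\<close>. Therefore \<open>z = 0\<close>,
  and this forces \<open>w = 0\<close>.
\<close>

theorem psd_star_square: "psd (star x * (x::'a::cstar_algebra_1))"
proof -
  define y where "y = star x * x"
  have sy: "selfadjoint y" by (simp add: y_def selfadjoint_star_mult)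
  obtain h where h: "psd h" "h * h = y * y" "h * y = y * h" "psd (h + y)" "psd (h - y)"
    using selfadjoint_abs[OF sy] by blast
  define w where "w = h - y"
  have sw: "selfadjoint w" using h by (simp add: w_def psd_selfadjoint)
  have yw: "y * w = - (h * w)" by (simp add: w_def algebra_simps h)
  have wy: "w * y = y * w" by (simp add: w_def algebra_simps h)
  have wh: "w * h = h * w" by (simp add: w_def algebra_simps h)
  have "- (star (x * w) * (x * w)) = - (w * y * w)"
    using sw by (simp add: star_mult y_def selfadjoint_def mult.assoc)
  also have "\<dots> = - ((y * w) * w)" by (simp add: wy)
  also have "\<dots> = h * (w * w)" unfolding yw by (simp add: mult.assoc)
  finally have e: "- (star (x * w) * (x * w)) = h * (w * w)" .
  have "psd (h * (w * w))" 
  proof (intro psd_mult[of h "w * w"] h psd_square[OF sw])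
    show "h * (w * w) = (w * w) * h" by (metis wh mult.assoc)
  qed
  then have "x * w = 0" using e neg_star_square_zero[of "x * w"] by simp
  then have hww: "h * (w * w) = 0" using e by simp
  have "w * w = h * w - y * w" by (simp add: w_def algebra_simps)
  then have ww: "w * w = 2 *\<^sub>R (h * w)" by (simp add: yw scaleR_2)
  have "(w * w) * (w * w) = 2 *\<^sub>R ((h * w) * (w * w))" by (metis ww mult_scaleR_left)
  also have "(h * w) * (w * w) = (h * (w * w)) * w" by (simp add: mult.assoc)
  finally have "(w * w) * (w * w) = 0" by (simp add: hww)
  moreover have "selfadjoint (w * w)" using sw by (simp add: selfadjoint_mult)
  ultimately have "(norm (w * w))\<^sup>2 = 0" using norm_selfadjoint_square[of "w * w"] by simp
  then have "w = 0" using norm_selfadjoint_square[OF sw] by simp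
  then have "y = h" by (simp add: w_def)
  then show ?thesis using h by (simp add: y_def)
qed

lemma psd_conj:
  fixes a x :: "'a::cstar_algebra_1"
  assumes "psd a"
  shows "psd (star x * a * x)"
proof -
  obtain m where m: "psd m" "m * m = a" using psd_sqrt[OF assms] by blast
  have "star m = m" using psd_selfadjoint[OF m(1)] by (simp add: selfadjoint_def)
  then have "star (m * x) * (m * x) = star x * a * x"
    unfolding m(2)[symmetric] by (simp add: star_mult mult.assoc)
  then show ?thesis using psd_star_square by metis
qed

section \<open>Directedness of the positive unit ball\<close>

text \<open>
  With \<open>d = b - a\<close> the difference \<open>u - v\<close> of the inverses is the sum of \<open>v d v\<close> and
  \<open>(v d) u (d v)\<close>.
\<close>

lemma psd_inverse_antimono:
  fixes a b u v :: "'a::cstar_algebra_1"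
  assumes "psd a" "psd (b - a)" "u * a = 1" "a * u = 1" "v * b = 1" "b * v = 1"
  shows "psd (u - v)"
proof -
  define d where "d = b - a"
  have b: "psd b" using psd_add[OF assms(1,2)] by simp
  have pu: "psd u" and pv: "psd v" using assms b psd_inverse by blast+
  have sd: "star d = d" and sv: "star v = v"
    using assms(2) pv psd_selfadjoint by (auto simp: d_def selfadjoint_def)
  have e1: "u - v = v * d * u"
  proof -
    have "v * d * u = (v * b) * u - v * (a * u)" by (simp add: d_def algebra_simps)
    then show ?thesis using assms by simp
  qed
  have e2: "u - v = u * d * v"
  proof -
    have "u * d * v = u * (b * v) - (u * a) * v" by (simp add: d_def algebra_simps)
    then show ?thesis using assms by simp
  qed
  have "u = v + u * d * v" using e2 by (simp add: algebra_simps)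
  then have "u - v = v * d * (v + u * d * v)" using e1 by metis
  also have "\<dots> = star v * d * v + star (d * v) * u * (d * v)"
    by (simp add: star_mult sd sv algebra_simps)
  finally show ?thesis using assms(2) pu by (simp add: d_def psd_add psd_conj)
qed

text \<open>
  The map sending \<open>a\<close> to \<open>a (1 - a)\<^sup>-\<^sup>1\<close> is an order isomorphism of the positive part of
  the open unit ball onto the cone, with inverse \<open>t \<mapsto> 1 - (1 + t)\<^sup>-\<^sup>1\<close>; upper bounds in
  the cone are given by sums. The last equation shows that \<open>c\<close> belongs to every ideal
  that contains \<open>a\<close> and \<open>b\<close>.
\<close>

lemma psd_directed:
  fixes a b :: "'a::cstar_algebra_1"
  assumes a: "psd a" "norm a < 1" and b: "psd b" "norm b < 1"
  obtains c u v w where "psd c" "norm c < 1" "psd (c - a)" "psd (c - b)" 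
    "c = w * (a * u + b * v)"
proof -
  have ex: "\<exists>u. psd u \<and> u * (1 - x) = 1 \<and> (1 - x) * u = 1 \<and> psd (x * u)" if x: "psd x" "norm x < 1" for x :: 'a
  proof -
    obtain u where u: "u * (1 - x) = 1" "(1 - x) * u = 1" using neumann_inverse[OF x(2)] by blast
    have "psd (of_real (norm x) - x + of_real (1 - norm x))" using x by (intro psd_add psd_of_real psd_norm_minus) (auto simp: psd_selfadjoint)
    then have "psd (1 - x)" by (simp add: algebra_simps)
    then have "psd u" using u psd_inverse by blast
    moreover have "u - x * u = u - u * x"
      using u by (simp add: left_diff_distrib right_diff_distrib)
    then have "x * u = u * x" by simp
    ultimately show ?thesis using u x psd_mult by blast
  qed
  obtain u where u: "psd u" "u * (1 - a) = 1" "(1 - a) * u = 1" "psd (a * u)" using ex[OF a] by blast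
  obtain v where v: "psd v" "v * (1 - b) = 1" "(1 - b) * v = 1" "psd (b * v)" using ex[OF b] by blast
  have ua: "1 + a * u = u" using u(3) by (simp add: algebra_simps)
  have vb: "1 + b * v = v" using v(3) by (simp add: algebra_simps)
  define s where "s = a * u + b * v"
  have s: "psd s" unfolding s_def using u v by (intro psd_add)
  obtain w where w: "w * (of_real 1 + s) = 1" "(of_real 1 + s) * w = 1" "psd w" using psd_shift_inverse[OF s, of 1] by auto
  define c where "c = 1 - w"
  have "c = w * s" using w by (simp add: c_def algebra_simps)
  have "psd ((1 - a) - w)"
  proof (rule psd_inverse_antimono[OF u(1) _ u(3,2) w(1,2)])
    have "(of_real 1 + s) - u = b * v" using ua by (simp add: s_def algebra_simps)
    then show "psd ((of_real 1 + s) - u)" using v by simp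
  qed
  then have ca: "psd (c - a)" by (simp add: c_def algebra_simps)
  have "psd ((1 - b) - w)"
  proof (rule psd_inverse_antimono[OF v(1) _ v(3,2) w(1,2)])
    have "(of_real 1 + s) - v = a * u" using vb by (simp add: s_def algebra_simps)
    then show "psd ((of_real 1 + s) - v)" using u by simp
  qed
  then have cb: "psd (c - b)" by (simp add: c_def algebra_simps)
  have pc: "psd c" using psd_add[OF ca a(1)] by simp
  define r where "r = norm s"
  have r: "0 \<le> r" by (simp add: r_def)
  have "psd (w - of_real (1 / (1 + r)))"
  proof (rule psd_inverse_antimono[where a = "of_real 1 + s" and b = "of_real (1 + r)"])
    show "psd (of_real 1 + s)" using psd_add[OF psd_one s] by simp
    show "psd (of_real (1 + r) - (of_real 1 + s))" using s psd_norm_minus[of s] by (simp add: r_def psd_selfadjoint)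
    show "of_real (1 / (1 + r)) * of_real (1 + r) = (1::'a)" "of_real (1 + r) * of_real (1 / (1 + r)) = (1::'a)"
      unfolding of_real_mult[symmetric] using r by simp_all
  qed (use w in auto)
  moreover have "w - of_real (1 / (1 + r)) = of_real (1 - 1 / (1 + r)) - c" by (simp add: c_def algebra_simps)
  ultimately have "norm c \<le> 1 - 1 / (1 + r)" using pc r by (intro psd_norm_le) simp_all
  then have "norm c < 1" using r by (smt (verit) zero_less_divide_1_iff)
  then show ?thesis using that[of c w u v] pc ca cb \<open>c = w * s\<close> by (simp add: s_def)
qed

section \<open>The unitization\<close>

text \<open>
  The pair \<open>(x, c)\<close> represents \<open>x + c 1\<close>.
\<close>

typedef (overloaded) ('a::cstar_algebra) unitization = "UNIV :: ('a \<times> complex) set"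
  morphisms rep_unitization Unitization ..

setup_lifting type_definition_unitization

lift_definition alg_part :: "'a::cstar_algebra unitization \<Rightarrow> 'a" is fst .
lift_definition scalar_part :: "'a::cstar_algebra unitization \<Rightarrow> complex" is snd .
lift_definition to_unitization :: "'a::cstar_algebra \<Rightarrow> 'a unitization" is "\<lambda>x. (x, 0)" .

lemma unitization_eq_iff:
  "u = v \<longleftrightarrow> alg_part u = alg_part v \<and> scalar_part u = scalar_part v"
  by transfer (auto simp: prod_eq_iff)

definition left_mult :: "'a::cstar_algebra unitization \<Rightarrow> 'a \<Rightarrow> 'a" where
  "left_mult u y = alg_part u * y + scalar_part u *\<^sub>C y"

lemma bounded_linear_scaleC: "bounded_linear (\<lambda>y::'a::complex_normed_vector. c *\<^sub>C y)"
  by (rule bounded_linear_intro[where K="cmod c"])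
    (simp_all add: scaleC_add_right scaleC_scaleR norm_scaleC)

lemma bounded_linear_scaleC_left: "bounded_linear (\<lambda>c. c *\<^sub>C (y::'a::complex_normed_vector))"
proof (rule bounded_linear_intro[where K="norm y"])
  show "(r *\<^sub>R c) *\<^sub>C y = r *\<^sub>R (c *\<^sub>C y)" for r and c :: complex
    unfolding scaleR_conv_of_real scaleC_scaleC[symmetric] scaleC_of_real ..
qed (simp_all add: scaleC_add_left norm_scaleC)

lemma bounded_linear_left_mult: "bounded_linear (left_mult u)"
  unfolding left_mult_def[abs_def]
  by (intro bounded_linear_add bounded_linear_mult_right bounded_linear_scaleC)

lemma scaleC_of_real_mult: "(complex_of_real r * c) *\<^sub>C x = r *\<^sub>R (c *\<^sub>C (x::'a::complex_normed_vector))"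
  unfolding scaleC_scaleC[symmetric] scaleC_of_real ..

instantiation unitization :: (cstar_algebra) real_algebra_1
begin

lift_definition zero_unitization :: "'a unitization" is "(0, 0)" .
lift_definition one_unitization :: "'a unitization" is "(0, 1)" .
lift_definition plus_unitization :: "'a unitization \<Rightarrow> 'a unitization \<Rightarrow> 'a unitization"
  is "\<lambda>(x, c) (y, d). (x + y, c + d)" .
lift_definition minus_unitization :: "'a unitization \<Rightarrow> 'a unitization \<Rightarrow> 'a unitization"
  is "\<lambda>(x, c) (y, d). (x - y, c - d)" .
lift_definition uminus_unitization :: "'a unitization \<Rightarrow> 'a unitization"
  is "\<lambda>(x, c). (- x, - c)" .
lift_definition times_unitization :: "'a unitization \<Rightarrow> 'a unitization \<Rightarrow> 'a unitization"
  is "\<lambda>(x, c) (y, d). (x * y + c *\<^sub>C y + d *\<^sub>C x, c * d)" .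
lift_definition scaleR_unitization :: "real \<Rightarrow> 'a unitization \<Rightarrow> 'a unitization"
  is "\<lambda>r (x, c). (r *\<^sub>R x, complex_of_real r * c)" .

lemma parts_simps [simp]:
  "alg_part 0 = 0" "scalar_part 0 = 0"
  "alg_part 1 = 0" "scalar_part 1 = 1"
  "alg_part (u + v) = alg_part u + alg_part v" "scalar_part (u + v) = scalar_part u + scalar_part v"
  "alg_part (u - v) = alg_part u - alg_part v" "scalar_part (u - v) = scalar_part u - scalar_part v"
  "alg_part (- u) = - alg_part u" "scalar_part (- u) = - scalar_part u"
  "alg_part (r *\<^sub>R u) = r *\<^sub>R alg_part u" "scalar_part (r *\<^sub>R u) = complex_of_real r * scalar_part u"
  "alg_part (u * v) = alg_part u * alg_part v + scalar_part u *\<^sub>C alg_part v + scalar_part v *\<^sub>C alg_part u"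
  "scalar_part (u * v) = scalar_part u * scalar_part v"
  "alg_part (to_unitization x) = x" "scalar_part (to_unitization x) = 0"
  by (transfer; auto)+

instance
proof
  fix u v w :: "'a unitization" and r s :: real
  have eqI: "p = q" if "alg_part p = alg_part q" "scalar_part p = scalar_part q" for p q :: "'a unitization"
    using that by (simp add: unitization_eq_iff)
  show "u + v + w = u + (v + w)" "u + v = v + u" "0 + u = u" "- u + u = 0" "u - v = u + - v"
    by (rule eqI; simp add: algebra_simps)+
  show "r *\<^sub>R (u + v) = r *\<^sub>R u + r *\<^sub>R v" "(r + s) *\<^sub>R u = r *\<^sub>R u + s *\<^sub>R u"
    "r *\<^sub>R s *\<^sub>R u = (r * s) *\<^sub>R u" "1 *\<^sub>R u = u"
    by (rule eqI; simp add: algebra_simps)+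
  show "u * v * w = u * (v * w)" "(u + v) * w = u * w + v * w" "u * (v + w) = u * v + u * w"
    by (rule eqI; simp add: algebra_simps scaleC_add_right scaleC_add_left scaleC_mult_left
        scaleC_mult_right scaleC_scaleC)+
  show "1 * u = u" "u * 1 = u"
    by (rule eqI; simp add: scaleC_zero_right scaleC_zero_left scaleC_one)+
  show "r *\<^sub>R u * v = r *\<^sub>R (u * v)" "u * r *\<^sub>R v = r *\<^sub>R (u * v)"
    by (rule eqI; simp add: scaleR_add_right scaleC_scaleR scaleC_of_real_mult)+
  have "scalar_part (0 :: 'a unitization) \<noteq> scalar_part 1" by simp
  then show "(0 :: 'a unitization) \<noteq> 1" by metis
qed

end

lemma left_mult_simps:
  "left_mult (u + v) y = left_mult u y + left_mult v y"
  "left_mult (u * v) y = left_mult u (left_mult v y)"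
  "left_mult (r *\<^sub>R u) y = r *\<^sub>R left_mult u y"
  "left_mult 0 y = 0"
  "left_mult 1 y = y"
  "left_mult (to_unitization x) y = x * y"
proof -
  show "left_mult (u + v) y = left_mult u y + left_mult v y"
    by (simp add: left_mult_def scaleC_add_left distrib_right)
  show "left_mult (u * v) y = left_mult u (left_mult v y)"
    by (simp add: left_mult_def distrib_left distrib_right mult.assoc scaleC_add_right scaleC_mult_left
        scaleC_mult_right scaleC_scaleC)
  show "left_mult (r *\<^sub>R u) y = r *\<^sub>R left_mult u y"
    unfolding left_mult_def parts_simps scaleC_scaleC[symmetric] scaleC_of_real
    by (simp add: scaleR_add_right)
  show "left_mult 0 y = 0" "left_mult 1 y = y" "left_mult (to_unitization x) y = x * y"
    by (simp_all add: left_mult_def scaleC_zero_left scaleC_one)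
qed

lemma onorm_left_mult_embed: "onorm (left_mult (to_unitization x)) = norm (x::'a::cstar_algebra)"
proof (rule antisym)
  show "onorm (left_mult (to_unitization x)) \<le> norm x"
    by (rule onorm_bound) (simp_all add: left_mult_simps norm_mult_ineq)
  show "norm x \<le> onorm (left_mult (to_unitization x))"
  proof (cases "x = 0")
    case False
    have "norm (x * star x) \<le> onorm (left_mult (to_unitization x)) * norm (star x)"
      using onorm[OF bounded_linear_left_mult, of "to_unitization x" "star x"] by (simp add: left_mult_simps)
    moreover have "norm (x * star x) = norm x * norm x"
      using cstar_identity[of "star x"] by (simp add: star_star norm_star power2_eq_square)
    ultimately show ?thesis using False by (simp add: norm_star)
  qed (simp add: onorm_pos_le bounded_linear_left_mult)
qed

instantiation unitization :: (cstar_algebra) real_normed_algebra_1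
begin

text \<open>
  The operator norm of left multiplication is degenerate on the pairs if the algebra
  already has a unit. The maximum with the modulus of the scalar part is a C*-norm in
  either case.
\<close>

definition norm_unitization :: "'a unitization \<Rightarrow> real" where
  "norm_unitization u = max (onorm (left_mult u)) (cmod (scalar_part u))"
definition dist_unitization :: "'a unitization \<Rightarrow> 'a unitization \<Rightarrow> real" where
  "dist_unitization u v = norm (u - v)"
definition sgn_unitization :: "'a unitization \<Rightarrow> 'a unitization" where
  "sgn_unitization u = u /\<^sub>R norm u"
definition uniformity_unitization :: "('a unitization \<times> 'a unitization) filter" where
  "uniformity_unitization = (INF e\<in>{0 <..}. principal {(u, v). dist u v < e})"
definition open_unitization :: "'a unitization set \<Rightarrow> bool" where
  "open_unitization U \<longleftrightarrow> (\<forall>u\<in>U. eventually (\<lambda>(u', v). u' = u \<longrightarrow> v \<in> U) uniformity)"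

instance
proof
  fix u v :: "'a unitization" and r :: real
  note bl = bounded_linear_left_mult
  show "dist u v = norm (u - v)" by (rule dist_unitization_def)
  show "sgn u = u /\<^sub>R norm u" by (rule sgn_unitization_def)
  show "uniformity = (INF e\<in>{0 <..}. principal {(u, v::'a unitization). dist u v < e})"
    by (rule uniformity_unitization_def)
  show "open U \<longleftrightarrow> (\<forall>u\<in>U. eventually (\<lambda>(u', v). u' = u \<longrightarrow> v \<in> U) uniformity)" for U :: "'a unitization set"
    by (rule open_unitization_def)
  show "norm u = 0 \<longleftrightarrow> u = 0"
  proof
    assume n: "norm u = 0"
    then have "cmod (scalar_part u) \<le> 0" by (simp add: norm_unitization_def max_def split: if_splits)
    then have s: "scalar_part u = 0" by simp
    then have e: "u = to_unitization (alg_part u)" by (simp add: unitization_eq_iff)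
    have "onorm (left_mult u) \<le> 0" using n by (simp add: norm_unitization_def max_def split: if_splits)
    then have "norm (alg_part u) \<le> 0" using onorm_left_mult_embed[of "alg_part u"] e by simp
    then show "u = 0" using s by (simp add: unitization_eq_iff)
  next
    assume "u = 0"
    moreover have "left_mult (0 :: 'a unitization) = (\<lambda>y. 0)" by (rule ext) (simp add: left_mult_simps)
    ultimately show "norm u = 0" by (simp add: norm_unitization_def onorm_zero)
  qed
  have "left_mult (u + v) = (\<lambda>y. left_mult u y + left_mult v y)"
    by (rule ext) (simp add: left_mult_simps)
  then have "onorm (left_mult (u + v)) \<le> onorm (left_mult u) + onorm (left_mult v)"
    using onorm_triangle[OF bl bl, of u v] by simp
  moreover have "cmod (scalar_part (u + v)) \<le> cmod (scalar_part u) + cmod (scalar_part v)"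
    by (simp add: norm_triangle_ineq)
  ultimately show "norm (u + v) \<le> norm u + norm v"
    unfolding norm_unitization_def by linarith
  have "left_mult (r *\<^sub>R u) = (\<lambda>y. r *\<^sub>R left_mult u y)"
    by (rule ext) (simp add: left_mult_simps)
  then have "onorm (left_mult (r *\<^sub>R u)) = \<bar>r\<bar> * onorm (left_mult u)"
    using onorm_scaleR[OF bl, of r u] by simp
  then show "norm (r *\<^sub>R u) = \<bar>r\<bar> * norm u"
    by (simp add: norm_unitization_def norm_mult max_mult_distrib_left)
  have "left_mult (u * v) = left_mult u \<circ> left_mult v"
    by (rule ext) (simp add: left_mult_simps)
  then have "onorm (left_mult (u * v)) \<le> onorm (left_mult u) * onorm (left_mult v)"
    using onorm_compose[OF bl bl, of u v] by simp
  also have "\<dots> \<le> norm u * norm v"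
    by (intro mult_mono) (auto simp: norm_unitization_def onorm_pos_le bl le_max_iff_disj)
  moreover have "cmod (scalar_part (u * v)) \<le> norm u * norm v"
    unfolding parts_simps norm_mult by (intro mult_mono) (auto simp: norm_unitization_def le_max_iff_disj)
  ultimately show "norm (u * v) \<le> norm u * norm v"
    by (simp add: norm_unitization_def[of "u * v"])
  have "onorm (left_mult (1::'a unitization)) \<le> 1"
    by (rule onorm_bound) (simp_all add: left_mult_simps)
  then show "norm (1::'a unitization) = 1"
    by (simp add: norm_unitization_def max_def)
qed

end

instantiation unitization :: (cstar_algebra) complex_normed_vector
begin

lift_definition scaleC_unitization :: "complex \<Rightarrow> 'a unitization \<Rightarrow> 'a unitization"
  is "\<lambda>a (x, c). (a *\<^sub>C x, a * c)" .

lemma scaleC_parts [simp]: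
  "alg_part (a *\<^sub>C u) = a *\<^sub>C alg_part u" "scalar_part (a *\<^sub>C u) = a * scalar_part u"
  by (transfer; auto)+

lemma left_mult_scaleC: "left_mult (a *\<^sub>C u) y = a *\<^sub>C left_mult u y"
  by (simp add: left_mult_def scaleC_mult_left scaleC_add_right scaleC_scaleC)

lemma norm_scaleC_unitization_le: "norm (a *\<^sub>C u) \<le> cmod a * norm (u :: 'a unitization)"
proof -
  have "onorm (left_mult (a *\<^sub>C u)) \<le> cmod a * onorm (left_mult u)"
    by (rule onorm_bound)
      (auto simp: left_mult_scaleC norm_scaleC mult.assoc intro!: mult_left_mono mult_nonneg_nonneg
        onorm onorm_pos_le bounded_linear_left_mult)
  then show ?thesis
    by (auto simp: norm_unitization_def norm_mult max_mult_distrib_left le_max_iff_disj)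
qed

instance
proof
  fix u v :: "'a unitization" and a b :: complex and r :: real
  show "a *\<^sub>C (u + v) = a *\<^sub>C u + a *\<^sub>C v" "(a + b) *\<^sub>C u = a *\<^sub>C u + b *\<^sub>C u"
    "complex_of_real r *\<^sub>C u = r *\<^sub>R u"
    by (simp_all add: unitization_eq_iff scaleC_add_right scaleC_add_left scaleC_of_real algebra_simps)
  show ss: "a *\<^sub>C b *\<^sub>C u = (a * b) *\<^sub>C u" for a b :: complex and u :: "'a unitization"
    by (simp add: unitization_eq_iff scaleC_scaleC)
  show "norm (a *\<^sub>C u) = cmod a * norm u"
  proof (cases "a = 0")
    case True
    then have "a *\<^sub>C u = 0" by (simp add: unitization_eq_iff scaleC_zero_left)
    then show ?thesis using True by simp
  next
    case False
    have "(1 / a) *\<^sub>C a *\<^sub>C u = u"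
      using False by (simp add: ss) (simp add: unitization_eq_iff scaleC_one)
    then have "norm u \<le> cmod (1 / a) * norm (a *\<^sub>C u)" by (metis norm_scaleC_unitization_le)
    then have "cmod a * norm u \<le> norm (a *\<^sub>C u)" using False by (simp add: norm_divide field_simps)
    then show ?thesis using norm_scaleC_unitization_le[of a u] by simp
  qed
qed

end

lemma norm_embed: "norm (to_unitization x) = norm (x::'a::cstar_algebra)"
  by (simp add: norm_unitization_def onorm_left_mult_embed)

lemma embed_simps:
  "to_unitization (x + y) = to_unitization x + to_unitization y" "to_unitization (x - y) = to_unitization x - to_unitization y" "to_unitization (- x) = - to_unitization x"
  "to_unitization (x * y) = to_unitization x * to_unitization y" "to_unitization (r *\<^sub>R x) = r *\<^sub>R to_unitization x" "to_unitization 0 = 0"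
  by (simp_all add: unitization_eq_iff scaleC_zero_left)

lemma norm_alg_part: "norm (alg_part u) \<le> 2 * norm u"
proof -
  have "to_unitization (alg_part u) = u - scalar_part u *\<^sub>C 1"
    by (simp add: unitization_eq_iff scaleC_zero_right)
  then have "norm (alg_part u) \<le> norm u + cmod (scalar_part u)"
    using norm_triangle_ineq4[of u "scalar_part u *\<^sub>C 1"] norm_embed[of "alg_part u"]
    by (simp add: norm_scaleC)
  moreover have "cmod (scalar_part u) \<le> norm u" by (simp add: norm_unitization_def)
  ultimately show ?thesis by simp
qed

lemma norm_scalar_part: "cmod (scalar_part u) \<le> norm u"
  by (simp add: norm_unitization_def)

lemma parts_decompose: "to_unitization (alg_part u) + scalar_part u *\<^sub>C 1 = u"
  unfolding unitization_eq_iff by (simp add: scaleC_zero_right)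

lemma bounded_linear_embed: "bounded_linear (to_unitization :: 'a::cstar_algebra \<Rightarrow> _)"
proof (rule bounded_linear_intro[where K=1])
  show "norm (to_unitization x) \<le> norm x * 1" for x :: 'a by (simp add: norm_embed)
qed (rule embed_simps)+

lemma bounded_linear_alg_part: "bounded_linear (alg_part :: 'a::cstar_algebra unitization \<Rightarrow> 'a)"
proof (rule bounded_linear_intro[where K=2])
  show "norm (alg_part u) \<le> norm u * 2" for u :: "'a unitization"
    using norm_alg_part[of u] by linarith
qed simp_all

lemma bounded_linear_scalar_part: "bounded_linear (scalar_part :: 'a::cstar_algebra unitization \<Rightarrow> complex)"
proof (rule bounded_linear_intro[where K=1])
  show "scalar_part (r *\<^sub>R u) = r *\<^sub>R scalar_part u" for r and u :: "'a unitization"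
    by (simp add: scaleR_conv_of_real[of r "scalar_part u"])
qed (simp_all add: norm_scalar_part)

instantiation unitization :: (cstar_algebra) cstar_algebra
begin

lift_definition star_unitization :: "'a unitization \<Rightarrow> 'a unitization"
  is "\<lambda>(x, c). (star x, cnj c)" .

lemma star_parts [simp]:
  "alg_part (star u) = star (alg_part u)" "scalar_part (star u) = cnj (scalar_part u)"
  by (transfer; auto)+

lemma norm_square_le: "(norm u)\<^sup>2 \<le> norm (star u * (u::'a unitization))"
proof -
  define K where "K = onorm (left_mult (star u * u))"
  have K0: "0 \<le> K" by (simp add: K_def onorm_pos_le bounded_linear_left_mult)
  have "norm (left_mult u y) \<le> sqrt K * norm y" for y
  proof -
    have "star (left_mult u y) * left_mult u y = star y * left_mult (star u * u) y"
      by (simp add: left_mult_def star_add star_mult star_scaleC algebra_simps scaleC_mult_left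
          scaleC_mult_right scaleC_add_left scaleC_add_right scaleC_scaleC)
    then have "(norm (left_mult u y))\<^sup>2 \<le> norm (star y) * norm (left_mult (star u * u) y)"
      using cstar_identity[of "left_mult u y"] norm_mult_ineq[of "star y" "left_mult (star u * u) y"] by simp
    also have "\<dots> \<le> norm y * (K * norm y)"
      unfolding norm_star K_def by (intro mult_left_mono onorm bounded_linear_left_mult norm_ge_zero)
    also have "\<dots> = (sqrt K * norm y)\<^sup>2" using K0 by (simp add: power2_eq_square power_mult_distrib algebra_simps)
    finally show ?thesis using K0 by (simp add: power2_le_iff_abs_le)
  qed
  then have "onorm (left_mult u) \<le> sqrt K" using K0 by (intro onorm_bound) simp_all
  then have "(onorm (left_mult u))\<^sup>2 \<le> (sqrt K)\<^sup>2"
    by (intro power_mono onorm_pos_le bounded_linear_left_mult)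
  then have "(onorm (left_mult u))\<^sup>2 \<le> K" using K0 by simp
  moreover have "(cmod (scalar_part u))\<^sup>2 = cmod (scalar_part (star u * u))"
    by (simp add: norm_mult power2_eq_square)
  ultimately show ?thesis
    by (auto simp: norm_unitization_def K_def max_def)
qed

lemma norm_star_unitization: "norm (star u) = norm (u::'a unitization)"
proof -
  have ss: "star (star v) = v" for v :: "'a unitization" by (simp add: unitization_eq_iff star_star)
  have le: "norm v \<le> norm (star v)" for v :: "'a unitization"
  proof (cases "v = 0")
    case False
    have "norm v * norm v \<le> norm (star v) * norm v"
      using norm_square_le[of v] norm_mult_ineq[of "star v" v] by (simp add: power2_eq_square)
    then show ?thesis using False by simp
  qed simp
  show ?thesis using le[of u] le[of "star u"] by (simp add: ss)
qed

instance
proof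
  fix u v :: "'a unitization" and a :: complex
  show "a *\<^sub>C u * v = a *\<^sub>C (u * v)" "u * a *\<^sub>C v = a *\<^sub>C (u * v)"
    "star (star u) = u" "star (u + v) = star u + star v" "star (a *\<^sub>C u) = cnj a *\<^sub>C star u"
    "star (u * v) = star v * star u"
    by (simp_all add: unitization_eq_iff scaleC_add_right scaleC_mult_left scaleC_mult_right scaleC_scaleC
        star_star star_add star_scaleC star_mult algebra_simps)
  have "norm (star u * u) \<le> norm u * norm u"
    using norm_mult_ineq[of "star u" u] by (simp add: norm_star_unitization)
  then show "norm (star u * u) = (norm u)\<^sup>2" using norm_square_le[of u] by (simp add: power2_eq_square)
  show "\<exists>u::'a unitization. u \<noteq> 0" by (intro exI[of _ 1]) simp
  show "convergent X" if "Cauchy X" for X :: "nat \<Rightarrow> 'a unitization"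
  proof -
    have "Cauchy (\<lambda>n. alg_part (X n))" "Cauchy (\<lambda>n. scalar_part (X n))"
      using that by (auto intro: bounded_linear.Cauchy bounded_linear_alg_part bounded_linear_scalar_part)
    then obtain x c where "(\<lambda>n. alg_part (X n)) \<longlonglongrightarrow> x" "(\<lambda>n. scalar_part (X n)) \<longlonglongrightarrow> c"
      by (meson Cauchy_convergent convergent_def)
    then have "(\<lambda>n. to_unitization (alg_part (X n)) + scalar_part (X n) *\<^sub>C 1) \<longlonglongrightarrow> to_unitization x + c *\<^sub>C 1"
      by (intro tendsto_add bounded_linear.tendsto[OF bounded_linear_embed]
          bounded_linear.tendsto[OF bounded_linear_scaleC_left])
    then show ?thesis unfolding parts_decompose by (rule convergentI)
  qed
qed

end

instance unitization :: (cstar_algebra) cstar_algebra_1 ..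

lemma star_embed: "star (to_unitization x) = to_unitization (star x)"
  by (simp add: unitization_eq_iff)

section \<open>The order of a C*-algebra\<close>

lemma embed_alg_part: "scalar_part u = 0 \<Longrightarrow> to_unitization (alg_part u) = u"
  by (simp add: unitization_eq_iff)

lemma selfadjoint_embed: "selfadjoint (to_unitization x) \<longleftrightarrow> selfadjoint x"
  by (simp add: selfadjoint_def unitization_eq_iff)

text \<open>
  If an element of the algebra is positive in the unitization, the scalar part of its
  positive root has square \<open>0\<close>, so this root lies in the algebra.
\<close>

lemma positive_cone_iff: "x \<in> positive_cone \<longleftrightarrow> psd (to_unitization x)"
proof
  assume "x \<in> positive_cone"
  then obtain y where "x = star y * y" by (auto simp: positive_cone_def)
  then show "psd (to_unitization x)" using psd_star_square[of "to_unitization y"] by (simp add: star_embed embed_simps)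
next
  assume "psd (to_unitization x)"
  then obtain h where h: "psd h" "h * h = to_unitization x" using psd_sqrt by blast
  have "scalar_part (h * h) = 0" unfolding h by simp
  then have "h = to_unitization (alg_part h)" by (simp add: embed_alg_part)
  then obtain y where y: "h = to_unitization y" by blast
  have "selfadjoint y" using psd_selfadjoint[OF h(1)] by (simp add: y selfadjoint_embed)
  have "to_unitization (y * y) = to_unitization x" using h(2) by (simp add: y embed_simps)
  then have "alg_part (to_unitization (y * y)) = alg_part (to_unitization x)" by simp
  then have "x = star y * y" using \<open>selfadjoint y\<close> by (simp add: selfadjoint_def)
  then show "x \<in> positive_cone" by (auto simp: positive_cone_def)
qed

definition cone_le :: "'a::cstar_algebra \<Rightarrow> 'a \<Rightarrow> bool"  (infix "\<preceq>" 50) where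
  "x \<preceq> y \<longleftrightarrow> y - x \<in> positive_cone"

lemma cone_zero: "0 \<in> positive_cone"
  by (simp add: positive_cone_iff embed_simps psd_0)

lemma cone_add: "x \<in> positive_cone \<Longrightarrow> y \<in> positive_cone \<Longrightarrow> x + y \<in> positive_cone"
  by (simp add: positive_cone_iff embed_simps psd_add)

lemma cone_scaleR: "x \<in> positive_cone \<Longrightarrow> 0 \<le> r \<Longrightarrow> r *\<^sub>R x \<in> positive_cone"
  by (simp add: positive_cone_iff embed_simps psd_scaleR)

lemma cone_sum: "(\<And>i. i \<in> I \<Longrightarrow> f i \<in> positive_cone) \<Longrightarrow> sum f I \<in> positive_cone"
  by (induction I rule: infinite_finite_induct) (auto simp: cone_zero cone_add)

lemma cone_closed: "closed (positive_cone :: 'a::cstar_algebra set)"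
  unfolding closed_sequential_limits
proof (intro allI impI, elim conjE)
  fix x :: "nat \<Rightarrow> 'a" and l
  assume *: "\<forall>n. x n \<in> positive_cone" "x \<longlonglongrightarrow> l"
  have "(\<lambda>n. to_unitization (x n)) \<longlonglongrightarrow> to_unitization l"
    by (rule bounded_linear.tendsto[OF bounded_linear_embed *(2)])
  with *(1) show "l \<in> positive_cone"
    unfolding positive_cone_iff using psd_closed[of "\<lambda>n. to_unitization (x n)" "to_unitization l"] by simp
qed

lemma cone_selfadjoint: "x \<in> positive_cone \<Longrightarrow> selfadjoint x"
  using psd_selfadjoint[of "to_unitization x"] by (simp add: positive_cone_iff selfadjoint_embed)

lemma cone_le_refl: "x \<preceq> x" by (simp add: cone_le_def cone_zero)

lemma cone_le_trans: "x \<preceq> y \<Longrightarrow> y \<preceq> z \<Longrightarrow> x \<preceq> z"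
  using cone_add[of "y - x" "z - y"] by (simp add: cone_le_def)

lemma cone_le_add: "x \<preceq> y \<Longrightarrow> x' \<preceq> y' \<Longrightarrow> x + x' \<preceq> y + y'"
  using cone_add[of "y - x" "y' - x'"] by (simp add: cone_le_def algebra_simps)

lemma cone_le_scaleR: "x \<preceq> y \<Longrightarrow> 0 \<le> r \<Longrightarrow> r *\<^sub>R x \<preceq> r *\<^sub>R y"
  using cone_scaleR[of "y - x" r] by (simp add: cone_le_def algebra_simps)

lemma cone_norm_mono: "x \<in> positive_cone \<Longrightarrow> x \<preceq> y \<Longrightarrow> norm x \<le> norm y"
  using psd_norm_mono[of "to_unitization x" "to_unitization y"]
  by (simp add: cone_le_def positive_cone_iff embed_simps norm_embed)

text \<open>
  The modulus of an element of the algebra lies in the algebra, because the scalar part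
  of its square vanishes.
\<close>

lemma selfadjoint_decompose:
  fixes x :: "'a::cstar_algebra"
  assumes "selfadjoint x"
  obtains p q where "p \<in> positive_cone" "q \<in> positive_cone" "x = p - q" "norm p \<le> norm x" "norm q \<le> norm x"
proof -
  have sa: "selfadjoint (to_unitization x)" using assms by (simp add: selfadjoint_embed)
  obtain h where h: "psd h" "h * h = to_unitization x * to_unitization x" "psd (h + to_unitization x)" "psd (h - to_unitization x)"
    using selfadjoint_abs[OF sa] by blast
  have "scalar_part (h * h) = 0" unfolding h by simp
  then have "h = to_unitization (alg_part h)" by (simp add: embed_alg_part)
  then obtain y where y: "h = to_unitization y" by blast
  have "(norm h)\<^sup>2 = (norm (to_unitization x))\<^sup>2"
    using norm_selfadjoint_square[OF sa] norm_selfadjoint_square[of h] h(1,2) by (simp add: psd_selfadjoint)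
  then have ny: "norm y = norm x" by (simp add: y norm_embed)
  define p q where "p = (1/2) *\<^sub>R (y + x)" and "q = (1/2) *\<^sub>R (y - x)"
  have "y + x \<in> positive_cone" "y - x \<in> positive_cone"
    using h by (simp_all add: positive_cone_iff embed_simps y)
  then have "p \<in> positive_cone" "q \<in> positive_cone"
    unfolding p_def q_def by (simp_all add: cone_scaleR)
  moreover have "x = p - q"
    unfolding p_def q_def scaleR_diff_right[symmetric] by (simp add: scaleR_2[symmetric])
  moreover have "norm p \<le> norm x" "norm q \<le> norm x"
    using norm_triangle_ineq[of y x] norm_triangle_ineq4[of y x] ny by (simp_all add: p_def q_def)
  ultimately show ?thesis using that by blast
qed

lemma cone_directed2:
  fixes a b :: "'a::cstar_algebra"
  assumes "a \<in> positive_cone" "norm a < 1" "b \<in> positive_cone" "norm b < 1"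
  obtains c where "c \<in> positive_cone" "norm c < 1" "a \<preceq> c" "b \<preceq> c"
proof -
  have "psd (to_unitization a)" "norm (to_unitization a) < 1" "psd (to_unitization b)" "norm (to_unitization b) < 1"
    using assms by (simp_all add: positive_cone_iff norm_embed)
  then obtain c u v w where c: "psd c" "norm c < 1" "psd (c - to_unitization a)" "psd (c - to_unitization b)"
    "c = w * (to_unitization a * u + to_unitization b * v)"
    by (rule psd_directed)
  have "scalar_part c = 0" by (simp add: c(5))
  then have "c = to_unitization (alg_part c)" by (simp add: embed_alg_part)
  then obtain d where d: "c = to_unitization d" by blast
  show ?thesis
    using that[of d] c(1-4) unfolding d by (simp add: positive_cone_iff cone_le_def embed_simps norm_embed)
qed

lemma cone_directed:
  fixes F :: "'a::cstar_algebra set"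
  assumes "finite F" "\<And>x. x \<in> F \<Longrightarrow> x \<in> positive_cone \<and> norm x < 1"
  shows "\<exists>e\<in>positive_cone. norm e < 1 \<and> (\<forall>x\<in>F. x \<preceq> e)"
  using assms
proof (induction F rule: finite_induct)
  case empty
  show ?case by (intro bexI[of _ 0]) (simp_all add: cone_zero)
next
  case (insert x F)
  obtain e where e: "e \<in> positive_cone" "norm e < 1" "\<And>y. y \<in> F \<Longrightarrow> y \<preceq> e"
    using insert by blast
  obtain c where "c \<in> positive_cone" "norm c < 1" "x \<preceq> c" "e \<preceq> c"
    using cone_directed2[of x e] insert.prems[of x] e by blast
  then show ?case using e(3) cone_le_trans by (intro bexI[of _ c]) auto
qed

section \<open>The unit as an order unit\<close>

text \<open>
  The inequality comes from the unitization: multiply \<open>\<parallel>x\<parallel> 1 - x \<ge> 0\<close> by \<open>e\<close> on both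
  sides.
\<close>

lemma unit_facts:
  fixes e :: "'a::cstar_algebra"
  assumes "\<And>x. e * x = x" "\<And>x. x * e = x"
  shows "e \<in> positive_cone" "norm e = 1" "selfadjoint x \<Longrightarrow> x \<preceq> norm x *\<^sub>R e"
proof -
  have "star (star e * e) = star e * e" by (simp add: star_mult star_star)
  then have se: "star e = e" using assms by (simp add: star_star)
  then have "e = star e * e" using assms by simp
  then show "e \<in> positive_cone" by (auto simp: positive_cone_def)
  obtain y :: 'a where "y \<noteq> 0" using nontrivial by blast
  then have "e \<noteq> 0" using assms(1)[of y] by auto
  moreover have "norm e * norm e = norm e" using cstar_identity[of e] se assms by (simp add: power2_eq_square)
  ultimately show "norm e = 1" by simp
  assume sx: "selfadjoint x"
  have "psd (of_real (norm x) - to_unitization x)"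
    using psd_norm_minus[of "to_unitization x"] sx by (simp add: selfadjoint_embed norm_embed)
  then have "psd (star (to_unitization e) * (of_real (norm x) - to_unitization x) * to_unitization e)" by (rule psd_conj)
  moreover have "star (to_unitization e) * (of_real (norm x) - to_unitization x) * to_unitization e = to_unitization (norm x *\<^sub>R e - x)"
    by (simp add: star_embed se of_real_def algebra_simps embed_simps(4)[symmetric] assms)
       (simp add: embed_simps)
  ultimately show "x \<preceq> norm x *\<^sub>R e" by (simp add: cone_le_def positive_cone_iff)
qed

section \<open>Hahn-Banach\<close>

definition sublinear :: "('b::real_vector \<Rightarrow> real) \<Rightarrow> bool" where
  "sublinear p \<longleftrightarrow> (\<forall>x y. p (x + y) \<le> p x + p y) \<and> (\<forall>r\<ge>0. \<forall>x. p (r *\<^sub>R x) = r * p x)"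

lemma sublinearD:
  assumes "sublinear p"
  shows "p (x + y) \<le> p x + p y" "0 \<le> r \<Longrightarrow> p (r *\<^sub>R x) = r * p x" "p 0 = 0" "- p (- x) \<le> p x"
proof -
  show *: "p (x + y) \<le> p x + p y" "0 \<le> r \<Longrightarrow> p (r *\<^sub>R x) = r * p x" for x y r
    using assms by (auto simp: sublinear_def)
  show 0: "p 0 = 0" using *(2)[of 0 0] by simp
  show "- p (- x) \<le> p x" using *(1)[of x "-x"] 0 by simp
qed

lemma sublinearI:
  assumes "\<And>x y. p (x + y) \<le> p x + p y" "\<And>r x. 0 < r \<Longrightarrow> p (r *\<^sub>R x) \<le> r * p x" "p 0 = 0"
  shows "sublinear p"
proof -
  have "p (r *\<^sub>R x) = r * p x" if "0 \<le> r" for r x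
  proof (cases "r = 0")
    case False
    then have r: "0 < r" using that by simp
    have "p (inverse r *\<^sub>R (r *\<^sub>R x)) \<le> inverse r * p (r *\<^sub>R x)" using r by (intro assms(2)) simp
    then have "r * p x \<le> p (r *\<^sub>R x)" using r by (simp add: field_simps)
    then show ?thesis using assms(2)[OF r, of x] by simp
  qed (simp add: assms(3))
  then show ?thesis using assms(1) by (simp add: sublinear_def)
qed

lemma sublinear_Inf:
  fixes S :: "'b::real_vector \<Rightarrow> real set"
  assumes ne: "\<And>x. S x \<noteq> {}" and bb: "\<And>x. bdd_below (S x)"
    and add: "\<And>x y s t. s \<in> S x \<Longrightarrow> t \<in> S y \<Longrightarrow> \<exists>u\<in>S (x + y). u \<le> s + t"
    and scale: "\<And>r x s. 0 < r \<Longrightarrow> s \<in> S x \<Longrightarrow> \<exists>u\<in>S (r *\<^sub>R x). u \<le> r * s"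
    and zero: "0 \<in> S 0" "\<And>s. s \<in> S 0 \<Longrightarrow> 0 \<le> s"
  shows "sublinear (\<lambda>x. Inf (S x))"
proof (rule sublinearI)
  fix x y
  have "Inf (S (x + y)) - t \<le> Inf (S x)" if t: "t \<in> S y" for t
  proof (rule cInf_greatest[OF ne])
    fix s assume "s \<in> S x"
    then obtain u where "u \<in> S (x + y)" "u \<le> s + t" using add t by blast
    then show "Inf (S (x + y)) - t \<le> s" using cInf_lower[OF _ bb, of u "x + y"] by linarith
  qed
  then have "Inf (S (x + y)) - Inf (S x) \<le> Inf (S y)"
    by (intro cInf_greatest[OF ne]) (simp add: algebra_simps)
  then show "Inf (S (x + y)) \<le> Inf (S x) + Inf (S y)" by simp
next
  fix r :: real and x assume r: "0 < r"
  have "Inf (S (r *\<^sub>R x)) / r \<le> Inf (S x)"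
  proof (rule cInf_greatest[OF ne])
    fix s assume "s \<in> S x"
    then obtain u where "u \<in> S (r *\<^sub>R x)" "u \<le> r * s" using scale r by blast
    then have "Inf (S (r *\<^sub>R x)) \<le> r * s" using cInf_lower[OF _ bb, of u "r *\<^sub>R x"] by linarith
    then show "Inf (S (r *\<^sub>R x)) / r \<le> s" using r by (simp add: divide_le_eq mult.commute)
  qed
  then show "Inf (S (r *\<^sub>R x)) \<le> r * Inf (S x)" using r by (simp add: divide_le_eq mult.commute)
next
  show "Inf (S 0) = 0" using zero by (intro cInf_eq_minimum)
qed

text \<open>
  The functional is \<open>q x = inf {p (x + t a) - t p a | t \<ge> 0}\<close>. It shows that a minimal
  sublinear functional is odd.
\<close>

lemma sublinear_reduce:
  fixes p :: "'b::real_vector \<Rightarrow> real"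
  assumes p: "sublinear p"
  obtains q where "sublinear q" "\<And>x. q x \<le> p x" "q (- a) \<le> - p a"
proof -
  define S where "S x = (\<lambda>t. p (x + t *\<^sub>R a) - t * p a) ` {0..}" for x
  define q where "q x = Inf (S x)" for x
  have lb: "- p (- x) \<le> p (x + t *\<^sub>R a) - t * p a" if "0 \<le> t" for x t
  proof -
    have "p (t *\<^sub>R a) \<le> p (x + t *\<^sub>R a) + p (- x)"
      using sublinearD(1)[OF p, of "x + t *\<^sub>R a" "-x"] by simp
    then show ?thesis using sublinearD(2)[OF p that, of a] by simp
  qed
  have SI: "p (x + t *\<^sub>R a) - t * p a \<in> S x" if "0 \<le> t" for x t using that by (auto simp: S_def)
  have bb: "bdd_below (S x)" for x by (rule bdd_belowI[of _ "- p (- x)"]) (auto simp: S_def lb)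
  have le: "q x \<le> p (x + t *\<^sub>R a) - t * p a" if "0 \<le> t" for x t
    unfolding q_def by (rule cInf_lower[OF SI bb]) (rule that)
  have qp: "q x \<le> p x" for x using le[of 0 x] by simp
  have "sublinear q"
    unfolding q_def
  proof (rule sublinear_Inf)
    show "S x \<noteq> {}" for x by (auto simp: S_def)
    show "bdd_below (S x)" for x by (rule bb)
    fix x y s s' assume "s \<in> S x" "s' \<in> S y"
    then obtain t t' where t: "0 \<le> t" "0 \<le> t'" "s = p (x + t *\<^sub>R a) - t * p a" "s' = p (y + t' *\<^sub>R a) - t' * p a"
      by (auto simp: S_def)
    have "p ((x + y) + (t + t') *\<^sub>R a) - (t + t') * p a \<le> s + s'"
      using sublinearD(1)[OF p, of "x + t *\<^sub>R a" "y + t' *\<^sub>R a"] by (simp add: t algebra_simps)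
    then show "\<exists>u\<in>S (x + y). u \<le> s + s'" using SI[of "t + t'" "x + y"] t by auto
  next
    fix r :: real and x s assume r: "0 < r" and "s \<in> S x"
    then obtain t where t: "0 \<le> t" "s = p (x + t *\<^sub>R a) - t * p a" by (auto simp: S_def)
    have "p (r *\<^sub>R x + (r * t) *\<^sub>R a) - (r * t) * p a \<le> r * s"
      using sublinearD(2)[OF p, of r "x + t *\<^sub>R a"] r
      by (simp add: t right_diff_distrib mult.assoc scaleR_add_right)
    then show "\<exists>u\<in>S (r *\<^sub>R x). u \<le> r * s" using SI[of "r * t" "r *\<^sub>R x"] t r by auto
  next
    show "0 \<in> S 0" using SI[of 0 0] sublinearD(3)[OF p] by simp
    show "0 \<le> s" if "s \<in> S 0" for s using that by (auto simp: S_def sublinearD(2)[OF p])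
  qed
  moreover have "q (- a) \<le> - p a" using le[of 1 "- a"] sublinearD(3)[OF p] by simp
  ultimately show ?thesis using that qp by blast
qed

lemma exists_minimal_sublinear:
  fixes p :: "'b::real_vector \<Rightarrow> real"
  assumes p: "sublinear p"
  obtains m where "sublinear m" "\<And>x. m x \<le> p x" "\<And>q. sublinear q \<Longrightarrow> (\<And>x. q x \<le> m x) \<Longrightarrow> q = m"
proof -
  define A where "A = {q. sublinear q \<and> (\<forall>x. q x \<le> p x)}"
  define P where "P = (\<lambda>f g :: 'b \<Rightarrow> real. \<forall>x. g x \<le> f x)"
  have "\<exists>m\<in>A. \<forall>q\<in>A. P m q \<longrightarrow> q = m"
  proof (rule predicate_Zorn)
    show "partial_order_on A (relation_of P A)"
      by (rule partial_order_on_relation_ofI) (auto simp: P_def fun_eq_iff intro: order_trans antisym)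
    fix C assume "C \<in> Chains (relation_of P A)"
    then have CA: "C \<subseteq> A" and chain: "\<And>f g. f \<in> C \<Longrightarrow> g \<in> C \<Longrightarrow> P f g \<or> P g f"
      by (auto simp: Chains_def relation_of_def)
    show "\<exists>u\<in>A. \<forall>a\<in>C. P a u"
    proof (cases "C = {}")
      case True
      then show ?thesis using p by (auto simp: A_def)
    next
      case False
      have sub: "sublinear f" "f x \<le> p x" if "f \<in> C" for f x using CA that by (auto simp: A_def)
      define u where "u x = (INF f\<in>C. f x)" for x
      have lb: "- p (- x) \<le> f x" if "f \<in> C" for f x
        using sublinearD(4)[OF sub(1)[OF that], of x] sub(2)[OF that, of "-x"] by linarith
      have bb: "bdd_below ((\<lambda>f. f x) ` C)" for x by (rule bdd_belowI2[of _ "- p (- x)"]) (rule lb)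
      have le: "u x \<le> f x" if "f \<in> C" for f x unfolding u_def by (rule cINF_lower[OF bb that])
      have "sublinear (\<lambda>x. Inf ((\<lambda>f. f x) ` C))"
      proof (rule sublinear_Inf)
        show "(\<lambda>f. f x) ` C \<noteq> {}" for x using False by simp
        show "bdd_below ((\<lambda>f. f x) ` C)" for x by (rule bb)
        fix x y s t assume "s \<in> (\<lambda>f. f x) ` C" "t \<in> (\<lambda>f. f y) ` C"
        then obtain f g where fg: "f \<in> C" "s = f x" "g \<in> C" "t = g y" by blast
        from chain[OF fg(1,3)] obtain h where h: "h \<in> C" "\<And>x. h x \<le> f x" "\<And>x. h x \<le> g x"
          using fg by (auto simp: P_def)
        have "h (x + y) \<le> s + t"
          using sublinearD(1)[OF sub(1)[OF h(1)], of x y] h(2)[of x] h(3)[of y] fg by linarith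
        then show "\<exists>u\<in>(\<lambda>f. f (x + y)) ` C. u \<le> s + t" using h(1) by blast
      next
        fix r :: real and x s assume "0 < r" "s \<in> (\<lambda>f. f x) ` C"
        then show "\<exists>u\<in>(\<lambda>f. f (r *\<^sub>R x)) ` C. u \<le> r * s"
          using sublinearD(2)[OF sub(1)] by fastforce
      next
        show "0 \<in> (\<lambda>f. f 0) ` C" "\<And>s. s \<in> (\<lambda>f. f 0) ` C \<Longrightarrow> 0 \<le> s"
          using False sublinearD(3)[OF sub(1)] by force+
      qed
      then have "sublinear u" by (simp add: u_def[abs_def])
      moreover have "u x \<le> p x" for x
        using False le sub(2) by (meson ex_in_conv order_trans)
      ultimately have "u \<in> A" by (simp add: A_def)
      then show ?thesis using le by (auto simp: P_def)
    qed
  qed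
  then obtain m where m: "m \<in> A" "\<And>q. q \<in> A \<Longrightarrow> P m q \<Longrightarrow> q = m" by blast
  show ?thesis
  proof (rule that[of m])
    show "sublinear m" "\<And>x. m x \<le> p x" using m(1) by (auto simp: A_def)
    show "q = m" if q: "sublinear q" "\<And>x. q x \<le> m x" for q
    proof (rule m(2))
      show "q \<in> A" using q m(1) unfolding A_def by (auto intro: order_trans[OF q(2)])
    qed (use q in \<open>simp add: P_def\<close>)
  qed
qed

text \<open>
  A minimal sublinear functional below \<open>p\<close> is linear. No subspace occurs in this form of
  the theorem: prescribed values and constraints are built into \<open>p\<close>.
\<close>

theorem hahn_banach_sublinear:
  fixes p :: "'b::real_vector \<Rightarrow> real"
  assumes "sublinear p"
  obtains f where "linear f" "\<And>x. f x \<le> p x"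
proof -
  obtain m where m: "sublinear m" "\<And>x. m x \<le> p x"
    and min: "\<And>q. sublinear q \<Longrightarrow> (\<And>x. q x \<le> m x) \<Longrightarrow> q = m"
    using exists_minimal_sublinear[OF assms] by blast
  have odd: "m (- a) = - m a" for a
  proof -
    obtain q where "sublinear q" "\<And>x. q x \<le> m x" "q (- a) \<le> - m a"
      using sublinear_reduce[OF m(1)] by blast
    then have "m (- a) \<le> - m a" using min by metis
    then show ?thesis using sublinearD(4)[OF m(1), of a] by simp
  qed
  have "linear m"
  proof (rule linearI)
    fix x y
    have "m (- x + - y) \<le> m (- x) + m (- y)" by (rule sublinearD(1)[OF m(1)])
    then have "m x + m y \<le> m (x + y)" using odd[of x] odd[of y] odd[of "x + y"] by simp
    then show "m (x + y) = m x + m y" using sublinearD(1)[OF m(1), of x y] by simp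
  next
    fix r :: real and x
    show "m (r *\<^sub>R x) = r *\<^sub>R m x"
    proof (cases "0 \<le> r")
      case True
      then show ?thesis using sublinearD(2)[OF m(1)] by simp
    next
      case False
      then have "m ((- r) *\<^sub>R x) = - r * m x" using sublinearD(2)[OF m(1), of "- r" x] by simp
      then show ?thesis using odd[of "r *\<^sub>R x"] by simp
    qed
  qed
  then show ?thesis using that m(2) by blast
qed

section \<open>Positive functionals\<close>

definition positive_functional :: "('a::cstar_algebra \<Rightarrow> real) \<Rightarrow> bool" where
  "positive_functional \<phi> \<longleftrightarrow> bounded_linear \<phi> \<and> (\<forall>x\<in>positive_cone. 0 \<le> \<phi> x)"

lemma positive_functional_mono:
  assumes "positive_functional \<phi>" "x \<preceq> y"
  shows "\<phi> x \<le> \<phi> y"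
proof -
  interpret bounded_linear \<phi> using assms by (simp add: positive_functional_def)
  have "0 \<le> \<phi> (y - x)" using assms by (auto simp: positive_functional_def cone_le_def)
  then show ?thesis by (simp add: diff)
qed

lemma real_part_add: "real_part (x + y) = real_part x + real_part (y::'a::cstar_algebra)"
  by (simp add: real_part_def star_add scaleR_add_right)

lemma real_part_scaleR: "real_part (r *\<^sub>R x) = r *\<^sub>R real_part (x::'a::cstar_algebra)"
  by (simp add: real_part_def star_scaleR scaleR_add_right)

lemma linear_bounded_by_norm:
  fixes f :: "'b::real_normed_vector \<Rightarrow> real"
  assumes "linear f" "\<And>x. f x \<le> norm x"
  shows "bounded_linear f"
proof (rule bounded_linear_intro[where K=1])
  interpret linear f by fact
  show "f (x + y) = f x + f y" "f (r *\<^sub>R x) = r *\<^sub>R f x" for x y r by (simp_all add: add scale)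
  show "norm (f x) \<le> norm x * 1" for x
    using assms(2)[of x] assms(2)[of "-x"] by (simp add: neg abs_le_iff)
qed

text \<open>
  Hahn-Banach is applied to the infimum of \<open>\<parallel>y\<parallel> - t \<parallel>x0\<parallel>\<close> over all positive \<open>y\<close> and
  \<open>t \<ge> 0\<close> with \<open>real_part x + t x0 \<preceq> y\<close>. The choice \<open>t = 0\<close> makes the functional
  positive and bounded by the norm; at \<open>- x0\<close> the choice \<open>t = 1\<close>, \<open>y = 0\<close> gives
  \<open>\<phi> x0 \<ge> \<parallel>x0\<parallel>\<close>. That the infimum is finite is due to the monotonicity of the norm.
\<close>

lemma norming_positive_functional:
  fixes x0 :: "'a::cstar_algebra"
  assumes x0: "x0 \<in> positive_cone"
  obtains \<phi> where "positive_functional \<phi>" "\<And>x. \<phi> x \<le> norm x" "norm x0 \<le> \<phi> x0"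
proof -
  define S where "S x = {norm y - t * norm x0 | y t. y \<in> positive_cone \<and> 0 \<le> t \<and> real_part x + t *\<^sub>R x0 \<preceq> y}" for x
  have SI: "norm y - t * norm x0 \<in> S x"
    if "y \<in> positive_cone" "0 \<le> t" "real_part x + t *\<^sub>R x0 \<preceq> y" for y t x
    using that by (auto simp: S_def)
  have dec: "\<exists>p q. p \<in> positive_cone \<and> q \<in> positive_cone \<and> real_part x = p - q \<and> norm p \<le> norm x \<and> norm q \<le> norm x" for x :: 'a
  proof -
    obtain p q where pq: "p \<in> positive_cone" "q \<in> positive_cone" "real_part x = p - q"
      "norm p \<le> norm (real_part x)" "norm q \<le> norm (real_part x)"
      using selfadjoint_decompose[OF selfadjoint_real_part[of x]] .
    have "norm p \<le> norm x" "norm q \<le> norm x" using pq(4,5) norm_real_part[of x] by linarith+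
    then show ?thesis using pq(1-3) by blast
  qed
  have lb: "- norm x \<le> s" if "s \<in> S x" for s x
  proof -
    obtain y t where y: "y \<in> positive_cone" "0 \<le> t" "real_part x + t *\<^sub>R x0 \<preceq> y" "s = norm y - t * norm x0"
      using \<open>s \<in> S x\<close> by (auto simp: S_def)
    obtain p q where pq: "p \<in> positive_cone" "q \<in> positive_cone" "real_part x = p - q" "norm q \<le> norm x"
      using dec by blast
    have "y + q - t *\<^sub>R x0 = (y - (real_part x + t *\<^sub>R x0)) + p" by (simp add: pq(3))
    also have "\<dots> \<in> positive_cone" using y(3) pq(1) by (intro cone_add) (simp_all add: cone_le_def)
    finally have "t *\<^sub>R x0 \<preceq> y + q" by (simp add: cone_le_def)
    then have "norm (t *\<^sub>R x0) \<le> norm (y + q)" using x0 y(2) by (intro cone_norm_mono cone_scaleR)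
    also have "\<dots> \<le> norm y + norm x" using norm_triangle_ineq[of y q] pq(4) by simp
    finally show ?thesis using y(2,4) by simp
  qed
  have ex: "\<exists>s\<in>S x. s \<le> norm x" for x
  proof -
    obtain p q where pq: "p \<in> positive_cone" "q \<in> positive_cone" "real_part x = p - q" "norm p \<le> norm x"
      using dec by blast
    have "norm p - 0 * norm x0 \<in> S x" using pq by (intro SI) (simp_all add: cone_le_def)
    then show ?thesis using pq(4) by auto
  qed
  have bb: "bdd_below (S x)" for x by (rule bdd_belowI) (rule lb)
  have "sublinear (\<lambda>x. Inf (S x))"
  proof (rule sublinear_Inf)
    show "S x \<noteq> {}" for x using ex[of x] by auto
    show "bdd_below (S x)" for x by (rule bb)
    fix x x' s s' assume "s \<in> S x" "s' \<in> S x'"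
    then obtain y t y' t' where *: "y \<in> positive_cone" "0 \<le> t" "real_part x + t *\<^sub>R x0 \<preceq> y" "s = norm y - t * norm x0"
      "y' \<in> positive_cone" "0 \<le> t'" "real_part x' + t' *\<^sub>R x0 \<preceq> y'" "s' = norm y' - t' * norm x0"
      unfolding S_def by blast
    have "norm (y + y') - (t + t') * norm x0 \<in> S (x + x')"
    proof (rule SI)
      show "real_part (x + x') + (t + t') *\<^sub>R x0 \<preceq> y + y'"
        using cone_le_add[OF *(3,7)] by (simp add: real_part_add scaleR_add_left ac_simps)
    qed (use * in \<open>auto intro: cone_add\<close>)
    moreover have "norm (y + y') - (t + t') * norm x0 \<le> s + s'"
      using norm_triangle_ineq[of y y'] by (simp add: * algebra_simps)
    ultimately show "\<exists>u\<in>S (x + x'). u \<le> s + s'" by blast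
  next
    fix r :: real and x s assume r: "0 < r" and "s \<in> S x"
    then obtain y t where *: "y \<in> positive_cone" "0 \<le> t" "real_part x + t *\<^sub>R x0 \<preceq> y" "s = norm y - t * norm x0"
      unfolding S_def by blast
    have "norm (r *\<^sub>R y) - (r * t) * norm x0 \<in> S (r *\<^sub>R x)"
    proof (rule SI)
      show "real_part (r *\<^sub>R x) + (r * t) *\<^sub>R x0 \<preceq> r *\<^sub>R y"
        using cone_le_scaleR[OF *(3), of r] r by (simp add: real_part_scaleR scaleR_add_right)
    qed (use * r in \<open>auto intro: cone_scaleR\<close>)
    moreover have "norm (r *\<^sub>R y) - (r * t) * norm x0 \<le> r * s" using r by (simp add: * algebra_simps)
    ultimately show "\<exists>u\<in>S (r *\<^sub>R x). u \<le> r * s" by blast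
  next
    have "norm (0::'a) - 0 * norm x0 \<in> S 0"
      by (rule SI) (simp_all add: cone_zero real_part_selfadjoint selfadjoint_arith cone_le_refl)
    then show "0 \<in> S 0" by simp
    show "0 \<le> s" if "s \<in> S 0" for s using lb[OF that] by simp
  qed
  then obtain f where f: "linear f" "\<And>x. f x \<le> Inf (S x)" using hahn_banach_sublinear by blast
  interpret f: linear f by fact
  have le: "f x \<le> s" if "s \<in> S x" for x s using f(2)[of x] cInf_lower[OF that bb] by linarith
  have le_norm: "f x \<le> norm x" for x using ex[of x] le by (meson order_trans)
  have "0 \<le> f x" if "x \<in> positive_cone" for x
  proof -
    have "real_part (- x) = - x" using that by (intro real_part_selfadjoint selfadjoint_arith cone_selfadjoint)
    then have "norm (0::'a) - 0 * norm x0 \<in> S (- x)" using that by (intro SI) (simp_all add: cone_zero cone_le_def)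
    then have "f (- x) \<le> 0" using le by simp
    then show ?thesis by (simp add: f.neg)
  qed
  moreover have "real_part (- x0) = - x0" using x0 by (intro real_part_selfadjoint selfadjoint_arith cone_selfadjoint)
  then have "norm (0::'a) - 1 * norm x0 \<in> S (- x0)" by (intro SI) (simp_all add: cone_zero cone_le_refl)
  then have "norm x0 \<le> f x0" using le[of "- norm x0" "- x0"] by (simp add: f.neg)
  moreover have "bounded_linear f" using f(1) le_norm by (rule linear_bounded_by_norm)
  ultimately show ?thesis using that[of f] le_norm by (simp add: positive_functional_def)
qed

section \<open>Exponential decay of summable orbits\<close>

lemma bounded_clinearD:
  assumes "bounded_clinear f"
  shows "bounded_linear f" "f (x + y) = f x + f y" "f (x - y) = f x - f y" "f (- x) = - f x"
    "f (r *\<^sub>R x) = r *\<^sub>R f x" "f (c *\<^sub>C x) = c *\<^sub>C f x" "f 0 = 0"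
proof -
  show bl: "bounded_linear f" and c: "f (c *\<^sub>C x) = c *\<^sub>C f x"
    using assms by (auto simp: bounded_clinear_def)
  interpret bounded_linear f by (rule bl)
  show "f (x + y) = f x + f y" "f (x - y) = f x - f y" "f (- x) = - f x" "f (r *\<^sub>R x) = r *\<^sub>R f x" "f 0 = 0"
    by (simp_all add: add diff neg scale)
qed

lemma bounded_clinear_intro:
  assumes "\<And>x y. f (x + y) = f x + f y" "\<And>c x. f (c *\<^sub>C x) = c *\<^sub>C f x" "\<And>x. norm (f x) \<le> K * norm x"
  shows "bounded_clinear f"
  unfolding bounded_clinear_def
proof (intro conjI allI)
  show "bounded_linear f"
  proof (rule bounded_linear_intro[where K=K])
    show "f (r *\<^sub>R x) = r *\<^sub>R f x" for r x using assms(2)[of "complex_of_real r" x] by (simp add: scaleC_of_real)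
  qed (use assms in \<open>auto simp: mult.commute\<close>)
qed (rule assms)

lemma bounded_clinear_compose: "bounded_clinear f \<Longrightarrow> bounded_clinear g \<Longrightarrow> bounded_clinear (\<lambda>x. f (g x))"
  unfolding bounded_clinear_def by (auto intro: bounded_linear_compose)

lemma bounded_clinear_id: "bounded_clinear (\<lambda>x. x)"
  unfolding bounded_clinear_def by (auto intro: bounded_linear_ident)

lemma bounded_clinear_funpow:
  fixes f :: "'a::complex_normed_vector \<Rightarrow> 'a"
  shows "bounded_clinear f \<Longrightarrow> bounded_clinear (f ^^ n)"
proof (induction n)
  case 0
  have "f ^^ 0 = (\<lambda>x. x)" by (rule ext) simp
  then show ?case using bounded_clinear_id by metis
next
  case (Suc n)
  have "f ^^ Suc n = (\<lambda>x. f ((f ^^ n) x))" by (rule ext) simp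
  with Suc show ?case using bounded_clinear_compose[of f "f ^^ n"] by simp
qed

lemma bounded_clinear_scaleC: "bounded_clinear f \<Longrightarrow> bounded_clinear (\<lambda>x. c *\<^sub>C f x)"
  unfolding bounded_clinear_def
  by (auto intro: bounded_linear_compose[OF bounded_linear_scaleC] simp: scaleC_scaleC mult.commute)

lemma cone_norm_bound_extends:
  fixes f :: "'a::cstar_algebra \<Rightarrow> 'b::complex_normed_vector"
  assumes f: "bounded_clinear f" and le: "\<And>x. x \<in> positive_cone \<Longrightarrow> norm (f x) \<le> K * norm x" and K: "0 \<le> K"
  shows "norm (f x) \<le> 4 * K * norm x"
proof -
  have sa: "norm (f y) \<le> 2 * K * norm y" if "selfadjoint y" for y
  proof -
    obtain p q where pq: "p \<in> positive_cone" "q \<in> positive_cone" "y = p - q" "norm p \<le> norm y" "norm q \<le> norm y"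
      using selfadjoint_decompose[OF \<open>selfadjoint y\<close>] .
    have "norm (f y) \<le> norm (f p) + norm (f q)" unfolding pq(3) bounded_clinearD(3)[OF f] by (rule norm_triangle_ineq4)
    also have "\<dots> \<le> K * norm y + K * norm y"
      using le[OF pq(1)] le[OF pq(2)] mult_left_mono[OF pq(4) K] mult_left_mono[OF pq(5) K] by linarith
    finally show ?thesis by simp
  qed
  have "f x = f (real_part x) + \<i> *\<^sub>C f (imag_part x)"
    using bounded_clinearD(2,6)[OF f] real_part_imag_part[of x] by metis
  then have "norm (f x) \<le> norm (f (real_part x)) + norm (f (imag_part x))"
    using norm_triangle_ineq[of "f (real_part x)" "\<i> *\<^sub>C f (imag_part x)"] by (simp add: norm_scaleC)
  also have "\<dots> \<le> 2 * K * norm (real_part x) + 2 * K * norm (imag_part x)"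
    by (intro add_mono sa selfadjoint_real_part selfadjoint_imag_part)
  also have "\<dots> \<le> 2 * K * norm x + 2 * K * norm x"
    using K by (intro add_mono mult_left_mono norm_real_part norm_imag_part) simp_all
  finally show ?thesis by simp
qed

text \<open>
  The tails \<open>r m\<close> of the series satisfy \<open>r m \<le> C (r m - r (m + 1))\<close>.
\<close>

lemma geometric_decay_of_tails:
  fixes g :: "nat \<Rightarrow> real"
  assumes g0: "\<And>n. 0 \<le> g n" and C: "1 \<le> C" and le: "\<And>m N. (\<Sum>n<N. g (m + n)) \<le> C * g m"
  shows "g m \<le> C * (1 - 1/C) ^ m * g 0"
proof -
  have sm: "summable (\<lambda>n. g (m + n))" for m
    by (rule summableI_nonneg_bounded[OF g0 le])
  define r where "r m = (\<Sum>n. g (m + n))" for m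
  have r_le: "r m \<le> C * g m" for m unfolding r_def by (rule suminf_le_const[OF sm le])
  have r_rec: "r m = g m + r (Suc m)" for m
    using suminf_split_head[OF sm, of m] by (simp add: r_def)
  have step: "r (Suc m) \<le> (1 - 1/C) * r m" for m
  proof -
    have "r m / C \<le> g m" using r_le[of m] C by (simp add: divide_le_eq mult.commute)
    then show ?thesis using r_rec[of m] by (simp add: left_diff_distrib)
  qed
  have q: "0 \<le> 1 - 1/C" using C by simp
  have "r m \<le> (1 - 1/C) ^ m * r 0" for m
  proof (induction m)
    case (Suc m)
    have "r (Suc m) \<le> (1 - 1/C) * r m" by (rule step)
    also have "\<dots> \<le> (1 - 1/C) * ((1 - 1/C) ^ m * r 0)" using q Suc by (intro mult_left_mono)
    finally show ?case by (simp add: mult.assoc)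
  qed simp
  moreover have "g m \<le> r m" using r_rec[of m] suminf_nonneg[OF sm, of "Suc m"] g0 by (simp add: r_def)
  moreover have "(1 - 1/C) ^ m * r 0 \<le> (1 - 1/C) ^ m * (C * g 0)"
    using q r_le[of 0] by (intro mult_left_mono) simp_all
  ultimately show ?thesis by (smt (verit) mult.assoc mult.commute)
qed

lemma funpow_cone: "positive_operator S \<Longrightarrow> x \<in> positive_cone \<Longrightarrow> (S ^^ n) x \<in> positive_cone"
  by (induction n) (auto simp: positive_operator_def)

lemma positive_functional_compose:
  assumes "positive_functional \<phi>" "bounded_linear S" "positive_operator S"
  shows "positive_functional (\<lambda>x. \<phi> (S x))"
  using assms by (auto simp: positive_functional_def positive_operator_def intro: bounded_linear_compose)

text \<open>
  The hypothesis says that the norms of the functionals \<open>\<phi> \<circ> S\<^sup>n\<close>, computed on the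
  positive part of the unit ball, sum up to at most \<open>C\<close> times the norm of \<open>\<phi>\<close>. Applied
  to \<open>\<phi> \<circ> S\<^sup>m\<close> it bounds all tails of this series, so the norms decay geometrically,
  uniformly in \<open>\<phi>\<close>; a norming \<open>\<phi>\<close> turns this into a bound for \<open>S\<^sup>n\<close>.
\<close>

theorem exponential_decay:
  fixes S :: "'a::cstar_algebra \<Rightarrow> 'a"
  assumes S: "bounded_clinear S" "positive_operator S"
    and H: "\<And>\<phi> K N x. positive_functional \<phi> \<Longrightarrow> (\<And>y. y \<in> positive_cone \<Longrightarrow> norm y < 1 \<Longrightarrow> \<phi> y \<le> K)
        \<Longrightarrow> (\<And>n. x n \<in> positive_cone \<and> norm (x n) < 1) \<Longrightarrow> (\<Sum>n<N. \<phi> ((S ^^ n) (x n))) \<le> C * K"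
  obtains M q where "0 < q" "q < 1" "0 \<le> M" "\<And>n x. norm ((S ^^ n) x) \<le> M * q ^ n * norm x"
proof -
  define B where "B = {y \<in> positive_cone. norm (y::'a) < 1}"
  have B0: "0 \<in> B" by (simp add: B_def cone_zero)
  (* At least 2, so that the ratio 1 - 1 / C' lies strictly between 0 and 1. *)
  define C' where "C' = max C 2"
  define q where "q = 1 - 1 / C'"
  have q: "0 < q" "q < 1" by (auto simp: q_def C'_def max_def field_simps)
  have bcl: "bounded_clinear (S ^^ n)" for n by (rule bounded_clinear_funpow[OF S(1)])
  have pos: "positive_operator (S ^^ n)" for n using funpow_cone[OF S(2)] by (simp add: positive_operator_def)
  have cone_bound: "norm ((S ^^ n) x) \<le> (2 * C') * q ^ n * norm x" if x: "x \<in> positive_cone" for n x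
  proof -
    obtain \<phi> where \<phi>: "positive_functional \<phi>" "\<And>x. \<phi> x \<le> norm x" "norm ((S ^^ n) x) \<le> \<phi> ((S ^^ n) x)"
      using norming_positive_functional[OF funpow_cone[OF S(2) x]] by blast
    interpret \<phi>: bounded_linear \<phi> using \<phi>(1) by (simp add: positive_functional_def)
    define g where "g n = (SUP y\<in>B. \<phi> ((S ^^ n) y))" for n
    have bdd: "bdd_above ((\<lambda>y. \<phi> ((S ^^ n) y)) ` B)" for n
    proof -
      obtain L where L: "\<And>x. norm ((S ^^ n) x) \<le> norm x * L" "0 < L"
        using bounded_linear.pos_bounded[OF bounded_clinearD(1)[OF bcl[of n]]] by blast
      have "\<phi> ((S ^^ n) y) \<le> L" if "y \<in> B" for y
      proof -
        have "\<phi> ((S ^^ n) y) \<le> norm y * L" using \<phi>(2) L(1) order_trans by blast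
        also have "\<dots> \<le> 1 * L" using that L(2) by (intro mult_right_mono) (auto simp: B_def)
        finally show ?thesis by simp
      qed
      then show ?thesis by (intro bdd_aboveI2)
    qed
    have upper: "\<phi> ((S ^^ n) y) \<le> g n" if "y \<in> B" for y n
      unfolding g_def by (rule cSUP_upper[OF that bdd])
    have g0: "0 \<le> g n" for n using upper[OF B0, of n] by (simp add: bounded_clinearD(7)[OF bcl] \<phi>.zero)
    have sum_le: "(\<Sum>k<N. g (m + k)) \<le> C' * g m" for m N
    proof (rule field_le_epsilon)
      fix e :: real assume e: "0 < e"
      define \<delta> where "\<delta> = e / (real N + 1)"
      have \<delta>: "0 < \<delta>" using e by (simp add: \<delta>_def)
      have "\<exists>y\<in>B. g k - \<delta> < \<phi> ((S ^^ k) y)" for k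
        using less_cSUP_iff[OF _ bdd, of "g k - \<delta>" k] B0 \<delta> by (auto simp: g_def)
      then obtain y where y: "\<And>k. y k \<in> B" "\<And>k. g k - \<delta> < \<phi> ((S ^^ k) (y k))" by metis
      have "(\<Sum>k<N. g (m + k)) \<le> (\<Sum>k<N. \<phi> ((S ^^ m) ((S ^^ k) (y (m + k)))) + \<delta>)"
      proof (rule sum_mono)
        fix k
        have "(S ^^ (m + k)) (y (m + k)) = (S ^^ m) ((S ^^ k) (y (m + k)))" by (simp add: funpow_add)
        then show "g (m + k) \<le> \<phi> ((S ^^ m) ((S ^^ k) (y (m + k)))) + \<delta>"
          using y(2)[of "m + k"] by simp
      qed
      also have "\<dots> = (\<Sum>k<N. \<phi> ((S ^^ m) ((S ^^ k) (y (m + k))))) + real N * \<delta>"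
        by (simp add: sum.distrib)
      also have "(\<Sum>k<N. \<phi> ((S ^^ m) ((S ^^ k) (y (m + k))))) \<le> C * g m"
      proof (rule H)
        show "positive_functional (\<lambda>x. \<phi> ((S ^^ m) x))"
          by (rule positive_functional_compose[OF \<phi>(1) bounded_clinearD(1)[OF bcl] pos])
        show "\<phi> ((S ^^ m) y) \<le> g m" if "y \<in> positive_cone" "norm y < 1" for y
          using that by (intro upper) (simp add: B_def)
        show "y (m + n) \<in> positive_cone \<and> norm (y (m + n)) < 1" for n using y(1) by (simp add: B_def)
      qed
      also have "C * g m \<le> C' * g m" using g0 by (intro mult_right_mono) (simp_all add: C'_def)
      also have "real N * \<delta> \<le> e" using e by (simp add: \<delta>_def field_simps)
      finally show "(\<Sum>k<N. g (m + k)) \<le> C' * g m + e" by simp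
    qed
    have "g n \<le> C' * q ^ n * g 0"
      unfolding q_def by (rule geometric_decay_of_tails[OF g0 _ sum_le]) (simp add: C'_def)
    also have "g 0 \<le> 1"
      unfolding g_def
    proof (rule cSUP_least)
      fix y assume "y \<in> B"
      then show "\<phi> ((S ^^ 0) y) \<le> 1" using \<phi>(2)[of y] by (simp add: B_def)
    qed (use B0 in auto)
    then have "C' * q ^ n * g 0 \<le> C' * q ^ n * 1" using q by (intro mult_left_mono) (simp_all add: C'_def)
    finally have gn: "g n \<le> C' * q ^ n" by simp
    show ?thesis
    proof (cases "x = 0")
      case True
      then show ?thesis by (simp add: bounded_clinearD(7)[OF bcl])
    next
      case False
      define y where "y = (1 / (2 * norm x)) *\<^sub>R x"
      have "y \<in> B" using False x by (simp add: B_def y_def cone_scaleR)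
      have "\<phi> ((S ^^ n) y) = (1 / (2 * norm x)) * \<phi> ((S ^^ n) x)"
        unfolding y_def bounded_clinearD(5)[OF bcl] \<phi>.scaleR by simp
      then have "(1 / (2 * norm x)) * \<phi> ((S ^^ n) x) \<le> C' * q ^ n"
        using upper[OF \<open>y \<in> B\<close>, of n] gn by simp
      then have "\<phi> ((S ^^ n) x) \<le> C' * q ^ n * (2 * norm x)" using False by (simp add: field_simps)
      then show ?thesis using \<phi>(3) by (simp add: mult_ac)
    qed
  qed
  have "norm ((S ^^ n) x) \<le> (8 * C') * q ^ n * norm x" for n x
    using cone_norm_bound_extends[OF bcl cone_bound, of n x] q by (simp add: C'_def mult_ac)
  then show ?thesis using that[of q "8 * C'"] q by (simp add: C'_def)
qed

section \<open>Integrals of positive functions\<close>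

text \<open>
  The integral is a limit of Riemann sums, which lie in the cone.
\<close>

lemma integral_cone:
  fixes f :: "real \<Rightarrow> 'a::cstar_algebra"
  assumes "f integrable_on {a..b}" "\<And>t. t \<in> {a..b} \<Longrightarrow> f t \<in> positive_cone"
  shows "integral {a..b} f \<in> positive_cone"
proof -
  have "integral {a..b} f \<in> closure positive_cone"
    unfolding closure_approachable
  proof (intro allI impI)
    fix e :: real assume e: "0 < e"
    have "(f has_integral integral {a..b} f) (cbox a b)" using assms(1) by (simp add: integrable_integral)
    from has_integral[THEN iffD1, OF this, rule_format, OF e] obtain \<gamma> where \<gamma>: "gauge \<gamma>" "\<And>p. p tagged_division_of (cbox a b) \<Longrightarrow> \<gamma> fine p \<Longrightarrow>
        norm ((\<Sum>(x, k)\<in>p. measure lborel k *\<^sub>R f x) - integral {a..b} f) < e"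
      by (elim exE conjE) simp
    obtain p where p: "p tagged_division_of (cbox a b)" "\<gamma> fine p" using fine_division_exists[OF \<gamma>(1)] .
    have "(\<Sum>(x, k)\<in>p. measure lborel k *\<^sub>R f x) \<in> positive_cone"
    proof (rule cone_sum)
      fix i assume "i \<in> p"
      obtain x k where xk: "i = (x, k)" by (cases i)
      have i: "i = (x, k)" "(x, k) \<in> p" using \<open>i \<in> p\<close> xk by simp_all
      have "x \<in> {a..b}" using tagged_division_ofD(2,3)[OF p(1) i(2)] by (simp add: subset_iff)
      then show "(case i of (x, k) \<Rightarrow> measure lborel k *\<^sub>R f x) \<in> positive_cone"
        unfolding i(1) split by (intro cone_scaleR assms(2)) simp_all
    qed
    then show "\<exists>y\<in>positive_cone. dist y (integral {a..b} f) < e"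
      using \<gamma>(2)[OF p] unfolding dist_norm by (rule bexI[rotated])
  qed
  then show ?thesis unfolding closure_closed[OF cone_closed] .
qed

section \<open>Uniform boundedness\<close>

text \<open>
  By the Baire category theorem one of the closed sets on which the family is bounded by
  \<open>n\<close> contains a ball.
\<close>

lemma uniform_boundedness:
  fixes F :: "'i \<Rightarrow> 'a::banach \<Rightarrow> 'b::real_normed_vector"
  assumes bl: "\<And>i. i \<in> I \<Longrightarrow> bounded_linear (F i)" and pw: "\<And>x. \<exists>K. \<forall>i\<in>I. norm (F i x) \<le> K"
  obtains M where "0 \<le> M" "\<And>i x. i \<in> I \<Longrightarrow> norm (F i x) \<le> M * norm x"
proof -
  define G where "G n = {x. \<forall>i\<in>I. norm (F i x) \<le> real n}" for n :: nat
  have clo: "closed (G n)" for n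
  proof -
    have "G n = (\<Inter>i\<in>I. {x. norm (F i x) \<le> real n})" by (auto simp: G_def)
    moreover have "closed {x. norm (F i x) \<le> real n}" if "i \<in> I" for i
      by (intro closed_Collect_le continuous_intros bounded_linear.continuous_on[OF bl[OF that]])
    ultimately show ?thesis by auto
  qed
  have cover: "\<Union>(range G) = UNIV"
  proof -
    have "x \<in> \<Union>(range G)" for x
    proof -
      obtain K where "\<forall>i\<in>I. norm (F i x) \<le> K" using pw by blast
      then have "x \<in> G (nat \<lceil>K\<rceil>)" by (auto simp: G_def) (meson order_trans real_nat_ceiling_ge)
      then show ?thesis by blast
    qed
    then show ?thesis by blast
  qed
  have "\<exists>n. interior (G n) \<noteq> {}"
  proof (rule ccontr)
    assume "\<not> ?thesis"
    then have "Met_TC.mtopology interior_of \<Union>(range G) = {}"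
      using clo complete_UNIV
      by (intro Met_TC.metric_Baire_category_alt) auto
    then show False unfolding cover by simp
  qed
  then obtain n a where "a \<in> interior (G n)" by blast
  then obtain r where r: "0 < r" "cball a r \<subseteq> G n" using mem_interior_cball by blast
  have bound: "norm (F i x) \<le> (2 * real n / r) * norm x" if i: "i \<in> I" for i x
  proof (cases "x = 0")
    case True
    then show ?thesis using linear_0[OF bounded_linear.linear[OF bl[OF i]]] by simp
  next
    case False
    interpret bounded_linear "F i" using bl i .
    have "a + (r / norm x) *\<^sub>R x \<in> cball a r" using False r by (simp add: dist_norm)
    then have 1: "norm (F i (a + (r / norm x) *\<^sub>R x)) \<le> real n" using r i by (auto simp: G_def)
    have "a \<in> cball a r" using r by simp
    then have "a \<in> G n" using r(2) by blast
    then have 2: "norm (F i a) \<le> real n" using i by (simp add: G_def)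
    have "F i (a + (r / norm x) *\<^sub>R x) - F i a = (r / norm x) *\<^sub>R F i x" by (simp add: add scaleR)
    then have "norm ((r / norm x) *\<^sub>R F i x) \<le> 2 * real n"
      using norm_triangle_ineq4[of "F i (a + (r / norm x) *\<^sub>R x)" "F i a"] 1 2 by simp
    then show ?thesis using False r by (simp add: field_simps)
  qed
  show ?thesis by (rule that[of "2 * real n / r"]) (use r bound in auto)
qed

section \<open>Resolvents\<close>

lemma resolvent_setI:
  assumes R: "bounded_clinear R" and R_in: "\<And>x. R x \<in> D"
    and right: "\<And>x. z *\<^sub>C R x - A (R x) = x" and left: "\<And>x. x \<in> D \<Longrightarrow> R (z *\<^sub>C x - A x) = x"
  shows "z \<in> resolvent_set D A"
proof -
  have bij: "bij_betw (\<lambda>x. z *\<^sub>C x - A x) D UNIV"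
    by (rule bij_betwI[where g=R]) (use assms in auto)
  have "the_inv_into D (\<lambda>x. z *\<^sub>C x - A x) y = R y" for y
    by (rule the_inv_into_f_eq) (use bij R_in right in \<open>auto simp: bij_betw_def\<close>)
  then have "the_inv_into D (\<lambda>x. z *\<^sub>C x - A x) = R" by (rule ext)
  then show ?thesis using bij R by (simp add: resolvent_set_def)
qed

text \<open>
  The boundedness of the inverse, stated without the inverse: it can then be tested on
  resolvents at other points.
\<close>

lemma resolvent_set_lower_bound:
  assumes "z \<in> resolvent_set D A"
  obtains K where "0 < K" "\<And>y. y \<in> D \<Longrightarrow> norm y \<le> K * norm (z *\<^sub>C y - A y)"
proof -
  let ?f = "\<lambda>x. z *\<^sub>C x - A x"
  have bij: "bij_betw ?f D UNIV" and bl: "bounded_linear (the_inv_into D ?f)"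
    using assms by (auto simp: resolvent_set_def bounded_clinear_def)
  obtain K where K: "\<And>x. norm (the_inv_into D ?f x) \<le> norm x * K" "0 < K"
    using bounded_linear.pos_bounded[OF bl] by blast
  have "norm y \<le> K * norm (?f y)" if "y \<in> D" for y
  proof -
    have "the_inv_into D ?f (?f y) = y"
      using bij that by (intro the_inv_into_f_f) (simp_all add: bij_betw_def)
    then show ?thesis using K(1)[of "?f y"] by (simp add: mult.commute)
  qed
  then show ?thesis using that K(2) by blast
qed

text \<open>
  If \<open>l\<close> is in the resolvent set and \<open>y = R(m) x\<close> with \<open>m\<close> near \<open>l\<close>, then
  \<open>\<parallel>y\<parallel> \<le> 2 K \<parallel>x\<parallel>\<close>: the resolvent is bounded near \<open>l\<close> wherever it exists.
\<close>

lemma lower_bound_perturb: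
  fixes y :: "'a::complex_normed_vector" and l m :: real
  assumes K: "0 < K" and y: "norm y \<le> K * norm (complex_of_real l *\<^sub>C y - v)"
    and d: "\<bar>m - l\<bar> * K \<le> 1/2" and e: "complex_of_real m *\<^sub>C y - v = x"
  shows "norm y \<le> 2 * K * norm x"
proof -
  have "complex_of_real l *\<^sub>C y - v = x - (m - l) *\<^sub>R y"
    using e by (simp add: scaleC_of_real algebra_simps)
  then have "norm y \<le> K * (norm x + \<bar>m - l\<bar> * norm y)"
    using y K norm_triangle_ineq4[of x "(m - l) *\<^sub>R y"] mult_left_mono[of _ _ K] by (smt (verit) norm_scaleR)
  also have "\<dots> = K * norm x + (\<bar>m - l\<bar> * K) * norm y" by (simp add: algebra_simps)
  also have "\<dots> \<le> K * norm x + 1/2 * norm y" using d by (intro add_left_mono mult_right_mono) simp_all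
  finally show ?thesis by simp
qed

section \<open>Neumann series\<close>

lemma neumann_series:
  fixes S :: "'a::{complex_normed_vector,banach} \<Rightarrow> 'a"
  assumes S: "bounded_clinear S" and M: "\<And>n x. norm ((S ^^ n) x) \<le> M * r ^ n * norm x"
    and r: "0 \<le> r" "r < cmod z"
  obtains R where "bounded_clinear R" "\<And>x. z *\<^sub>C R x - S (R x) = x" "\<And>x. R (z *\<^sub>C x - S x) = x"
    "\<And>x. (\<lambda>n. (1/z) ^ Suc n *\<^sub>C (S ^^ n) x) sums R x"
proof -
  have z0: "z \<noteq> 0" using r by auto
  have bcl: "bounded_clinear (S ^^ n)" for n by (rule bounded_clinear_funpow[OF S])
  define f where "f x n = (1/z) ^ Suc n *\<^sub>C (S ^^ n) x" for x n
  define q where "q = r / cmod z"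
  have q: "0 \<le> q" "q < 1" using r by (auto simp: q_def divide_simps)
  have nf: "norm (f x n) \<le> (M / cmod z * norm x) * q ^ n" for x n
  proof -
    have "norm (f x n) = (1 / cmod z) ^ Suc n * norm ((S ^^ n) x)"
      by (simp add: f_def norm_scaleC norm_power norm_divide norm_mult)
    also have "\<dots> \<le> (1 / cmod z) ^ Suc n * (M * r ^ n * norm x)" by (intro mult_left_mono M) simp
    also have "\<dots> = (M / cmod z * norm x) * q ^ n" by (simp add: q_def power_divide)
    finally show ?thesis .
  qed
  have sg: "summable (\<lambda>n. (M / cmod z * norm x) * q ^ n)" for x
    using q by (intro summable_mult summable_geometric) simp
  have sn: "summable (\<lambda>n. norm (f x n))" for x
    by (rule summable_comparison_test'[OF sg[of x], where N=0]) (simp only: real_norm_def abs_norm_cancel, rule nf)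
  note sm = summable_norm_cancel[OF sn]
  define R where "R x = suminf (f x)" for x
  have "bounded_clinear R"
  proof (rule bounded_clinear_intro)
    show "R (x + y) = R x + R y" for x y
    proof -
      have "f (x + y) = (\<lambda>n. f x n + f y n)" by (simp add: f_def bounded_clinearD(2)[OF bcl] scaleC_add_right fun_eq_iff)
      then show ?thesis unfolding R_def using suminf_add[OF sm sm, of x y] by simp
    qed
    show "R (c *\<^sub>C x) = c *\<^sub>C R x" for c x
    proof -
      have "f (c *\<^sub>C x) = (\<lambda>n. c *\<^sub>C f x n)"
        unfolding f_def bounded_clinearD(6)[OF bcl] scaleC_scaleC by (simp add: mult.commute)
      then show ?thesis unfolding R_def using bounded_linear.suminf[OF bounded_linear_scaleC sm, of c x] by simp
    qed
    show "norm (R x) \<le> (M / cmod z * (1 / (1 - q))) * norm x" for x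
    proof -
      have "norm (R x) \<le> (\<Sum>n. norm (f x n))" unfolding R_def by (rule summable_norm[OF sn])
      also have "\<dots> \<le> (\<Sum>n. (M / cmod z * norm x) * q ^ n)" by (intro suminf_le nf sn sg)
      also have "\<dots> = (M / cmod z * norm x) * (1 / (1 - q))"
        using q by (subst suminf_mult) (simp_all add: summable_geometric suminf_geometric)
      finally show ?thesis by (simp add: mult_ac)
    qed
  qed
  moreover have head: "z *\<^sub>C R x = x + R (S x)" for x
  proof -
    have "R x = f x 0 + (\<Sum>n. f x (Suc n))" unfolding R_def using suminf_split_head[OF sm, of x] by simp
    moreover have "f x (Suc n) = (1/z) *\<^sub>C f (S x) n" for n
      by (simp add: f_def scaleC_scaleC funpow_swap1)
    then have "(\<Sum>n. f x (Suc n)) = (1/z) *\<^sub>C R (S x)"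
      unfolding R_def using bounded_linear.suminf[OF bounded_linear_scaleC sm, of "1/z" "S x"] by simp
    moreover have "f x 0 = (1/z) *\<^sub>C x" by (simp add: f_def)
    ultimately show ?thesis using z0 by (simp add: scaleC_add_right scaleC_scaleC scaleC_one)
  qed
  moreover have RS: "R (S x) = S (R x)" for x
  proof -
    have "f (S x) = (\<lambda>n. S (f x n))" unfolding f_def bounded_clinearD(6)[OF S] by (simp add: funpow_swap1)
    then show ?thesis unfolding R_def
      using bounded_linear.suminf[OF bounded_clinearD(1)[OF S] sm, of x] by simp
  qed
  ultimately show ?thesis
  proof (intro that[of R])
    show "z *\<^sub>C R x - S (R x) = x" for x using head RS by simp
    assume "bounded_clinear R"
    then show "R (z *\<^sub>C x - S x) = x" for x using head by (simp add: bounded_clinearD(3,6))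
    show "(\<lambda>n. (1/z) ^ Suc n *\<^sub>C (S ^^ n) x) sums R x" for x
      using summable_sums[OF sm, of x] unfolding R_def by (simp only: f_def[abs_def])
  qed
qed

lemma outside_disc_resolvent:
  fixes S :: "'a::{complex_normed_vector,banach} \<Rightarrow> 'a"
  assumes "bounded_clinear S" "\<And>n x. norm ((S ^^ n) x) \<le> M * r ^ n * norm x" "0 \<le> r" "r < cmod z"
  shows "z \<in> resolvent_set UNIV S"
proof -
  obtain R where "bounded_clinear R" "\<And>x. z *\<^sub>C R x - S (R x) = x" "\<And>x. R (z *\<^sub>C x - S x) = x"
    by (rule neumann_series[OF assms]) blast
  then show ?thesis by (intro resolvent_setI[where R=R]) auto
qed

text \<open>
  If \<open>0\<close> were in the resolvent set, then \<open>\<parallel>y\<parallel> \<le> K\<^sup>n \<parallel>S\<^sup>n y\<parallel>\<close> for all \<open>n\<close>, against the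
  decay of the powers.
\<close>

lemma quasinilpotent_zero_in_spectrum:
  fixes S :: "'a::complex_normed_vector \<Rightarrow> 'a"
  assumes S: "bounded_clinear S" and nt: "\<exists>x::'a. x \<noteq> 0"
    and M: "\<And>r. 0 < r \<Longrightarrow> \<exists>M. \<forall>n x. norm ((S ^^ n) x) \<le> M * r ^ n * norm x"
  shows "0 \<in> spectrum UNIV S"
proof (rule ccontr)
  assume "0 \<notin> spectrum UNIV S"
  then have "0 \<in> resolvent_set UNIV S" by (simp add: spectrum_def)
  then obtain K where K: "0 < K" "\<And>y. norm y \<le> K * norm (0 *\<^sub>C y - S y)"
    by (rule resolvent_set_lower_bound) blast
  have low: "norm y \<le> K ^ n * norm ((S ^^ n) y)" for n y
  proof (induction n)
    case (Suc n)
    have "norm y \<le> K ^ n * norm ((S ^^ n) y)" by (rule Suc)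
    also have "\<dots> \<le> K ^ n * (K * norm (S ((S ^^ n) y)))"
      using K(2)[of "(S ^^ n) y"] K(1) by (intro mult_left_mono) (simp_all add: scaleC_zero_left)
    finally show ?case by (simp add: mult_ac)
  qed simp
  obtain M where M': "\<And>n x. norm ((S ^^ n) x) \<le> M * (1 / (2 * K)) ^ n * norm x"
    using M[of "1 / (2 * K)"] K(1) by auto
  obtain x :: 'a where x: "x \<noteq> 0" using nt by blast
  have "1 \<le> M * (1/2) ^ n" for n
  proof -
    have "norm x \<le> K ^ n * (M * (1 / (2 * K)) ^ n * norm x)"
      by (rule order_trans[OF low mult_left_mono[OF M']]) (use K(1) in simp)
    also have "\<dots> = M * (1/2) ^ n * norm x" using K(1) by (simp add: power_divide power_mult_distrib)
    finally show ?thesis using x by simp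
  qed
  moreover have "(\<lambda>n. M * (1/2) ^ n) \<longlonglongrightarrow> M * 0" by (intro tendsto_mult_left LIMSEQ_realpow_zero) simp_all
  ultimately have "1 \<le> M * 0" by (intro LIMSEQ_le_const) auto
  then show False by simp
qed

section \<open>Strongly continuous semigroups\<close>

definition growth_rate :: "(real \<Rightarrow> 'a::real_normed_vector \<Rightarrow> 'a) \<Rightarrow> real \<Rightarrow> bool" where
  "growth_rate T w \<longleftrightarrow> (\<exists>M. \<forall>t\<ge>0. \<forall>x. norm (T t x) \<le> M * exp (w * t) * norm x)"

lemma growth_rate_mono:
  assumes "growth_rate T v" "v \<le> w"
  shows "growth_rate T w"
proof -
  obtain M where M: "\<And>t x. 0 \<le> t \<Longrightarrow> norm (T t x) \<le> M * exp (v * t) * norm x"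
    using assms(1) by (auto simp: growth_rate_def)
  have "norm (T t x) \<le> \<bar>M\<bar> * exp (w * t) * norm x" if "0 \<le> t" for t x
  proof -
    have "M * exp (v * t) \<le> \<bar>M\<bar> * exp (w * t)"
      using assms(2) that by (intro mult_mono) (simp_all add: mult_right_mono)
    then have "M * exp (v * t) * norm x \<le> \<bar>M\<bar> * exp (w * t) * norm x" by (intro mult_right_mono) simp_all
    then show ?thesis using M[OF that, of x] by linarith
  qed
  then show ?thesis unfolding growth_rate_def by blast
qed

definition time_integral :: "(real \<Rightarrow> 'a::banach \<Rightarrow> 'a) \<Rightarrow> real \<Rightarrow> 'a \<Rightarrow> 'a" where
  "time_integral T \<tau> x = integral {0..\<tau>} (\<lambda>t. T t x)"

locale c0_semigroup =
  fixes T :: "real \<Rightarrow> 'a::{complex_normed_vector,banach} \<Rightarrow> 'a"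
  assumes C0: "C0_semigroup T"
begin

abbreviation "V \<equiv> time_integral T"
abbreviation "D \<equiv> generator_domain T"
abbreviation "A \<equiv> generator T"

lemma bcl: "0 \<le> t \<Longrightarrow> bounded_clinear (T t)"
  and T_0: "T 0 x = x"
  and T_add: "0 \<le> s \<Longrightarrow> 0 \<le> t \<Longrightarrow> T (s + t) x = T s (T t x)"
  and continuous_on_T: "continuous_on {0..} (\<lambda>t. T t x)"
  using C0 by (auto simp: C0_semigroup_def)

lemma T_commute: "0 \<le> s \<Longrightarrow> 0 \<le> t \<Longrightarrow> T s (T t x) = T t (T s x)"
  using T_add[of s t x] T_add[of t s x] by (simp add: add.commute)

lemma T_power: "0 \<le> t \<Longrightarrow> T (real n * t) x = (T t ^^ n) x"
proof (induction n)
  case (Suc n)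
  have "T (real (Suc n) * t) x = T (t + real n * t) x" by (simp add: algebra_simps)
  also have "\<dots> = T t (T (real n * t) x)" using Suc by (intro T_add) simp_all
  finally show ?case using Suc by simp
qed (simp add: T_0)

lemma local_bound:
  obtains M where "1 \<le> M" "\<And>t x. 0 \<le> t \<Longrightarrow> t \<le> b \<Longrightarrow> norm (T t x) \<le> M * norm x"
proof -
  have pw: "\<exists>K. \<forall>t\<in>{0..b}. norm (T t x) \<le> K" for x
  proof -
    have "compact ((\<lambda>t. T t x) ` {0..b})"
      by (intro compact_continuous_image continuous_on_subset[OF continuous_on_T] compact_Icc) auto
    then have "bounded ((\<lambda>t. T t x) ` {0..b})" by (rule compact_imp_bounded)
    then show ?thesis by (auto simp: bounded_iff)
  qed
  have "\<exists>M. 0 \<le> M \<and> (\<forall>t x. t \<in> {0..b} \<longrightarrow> norm (T t x) \<le> M * norm x)"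
    by (rule uniform_boundedness[of "{0..b}" T, OF _ pw]) (auto intro: bounded_clinearD(1)[OF bcl])
  then obtain M where M: "0 \<le> M" "\<And>t x. t \<in> {0..b} \<Longrightarrow> norm (T t x) \<le> M * norm x" by blast
  have "norm (T t x) \<le> max M 1 * norm x" if "0 \<le> t" "t \<le> b" for t x
  proof -
    have "M * norm x \<le> max M 1 * norm x" by (intro mult_right_mono) simp_all
    then show ?thesis using M(2)[of t x] that by simp
  qed
  then show ?thesis using that[of "max M 1"] by simp
qed

lemma growth_rate_from_powers:
  assumes \<tau>: "0 < \<tau>" and r: "0 < r" and M: "0 \<le> M" "\<And>n x. norm (T (real n * \<tau>) x) \<le> M * r ^ n * norm x"
  shows "growth_rate T (ln r / \<tau>)"
proof -
  define w where "w = ln r / \<tau>"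
  obtain L where L: "1 \<le> L" "\<And>t x. 0 \<le> t \<Longrightarrow> t \<le> \<tau> \<Longrightarrow> norm (T t x) \<le> L * norm x"
    using local_bound by blast
  have "norm (T t x) \<le> (L * M * exp (\<bar>w\<bar> * \<tau>)) * exp (w * t) * norm x" if t: "0 \<le> t" for t x
  proof -
    define n where "n = nat \<lfloor>t / \<tau>\<rfloor>"
    define s where "s = t - real n * \<tau>"
    have "real n = of_int \<lfloor>t / \<tau>\<rfloor>" using t \<tau> by (simp add: n_def)
    then have "real n \<le> t / \<tau>" "t / \<tau> \<le> real n + 1" by linarith+
    then have s: "0 \<le> s" "s \<le> \<tau>" using \<tau> by (simp_all add: s_def field_simps)
    have "T t x = T s (T (real n * \<tau>) x)" using T_add[of s "real n * \<tau>" x] s \<tau> by (simp add: s_def)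
    then have "norm (T t x) \<le> L * (M * r ^ n * norm x)"
      using L(2)[OF s] M(2)[of n x] L(1) by (smt (verit) mult_left_mono)
    also have "r ^ n = exp (w * (real n * \<tau>))"
      using r \<tau> by (simp add: w_def exp_of_nat_mult[symmetric] mult.commute)
        (metis exp_ln exp_of_nat2_mult mult.commute)
    also have "w * (real n * \<tau>) = w * t + (- w) * s" by (simp add: s_def algebra_simps)
    also have "L * (M * exp (w * t + (- w) * s) * norm x) \<le> L * (M * (exp (w * t) * exp (\<bar>w\<bar> * \<tau>)) * norm x)"
    proof -
      have "(- w) * s \<le> \<bar>w\<bar> * \<tau>" using s by (intro mult_mono) simp_all
      then have "exp (w * t + (- w) * s) \<le> exp (w * t) * exp (\<bar>w\<bar> * \<tau>)" by (simp add: exp_add[symmetric])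
      then show ?thesis using L(1) M(1) by (intro mult_left_mono mult_right_mono) simp_all
    qed
    finally show ?thesis by (simp add: mult_ac)
  qed
  then show ?thesis unfolding growth_rate_def w_def by blast
qed

lemma growth_rate_exists: "\<exists>w. growth_rate T w"
proof -
  obtain M where M: "1 \<le> M" "\<And>t x. 0 \<le> t \<Longrightarrow> t \<le> 1 \<Longrightarrow> norm (T t x) \<le> M * norm x"
    using local_bound by blast
  have "norm (T (real n * 1) x) \<le> 1 * M ^ n * norm x" for n x
  proof (induction n)
    case (Suc n)
    have "norm (T (real (Suc n) * 1) x) = norm (T 1 (T (real n) x))"
      using T_add[of 1 "real n" x] by (simp add: add.commute)
    also have "\<dots> \<le> M * norm (T (real n) x)" by (rule M(2)) simp_all
    also have "\<dots> \<le> M * (1 * M ^ n * norm x)" using Suc M(1) by (intro mult_left_mono) simp_all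
    finally show ?case by simp
  qed (simp add: T_0)
  then have "growth_rate T (ln M / 1)" using M(1) by (intro growth_rate_from_powers[of 1 M 1]) simp_all
  then show ?thesis by blast
qed

subsection \<open>Integrals of orbits\<close>

lemma integrable_T: "0 \<le> a \<Longrightarrow> (\<lambda>t. T t x) integrable_on {a..b}"
  by (intro integrable_continuous_real continuous_on_subset[OF continuous_on_T]) auto

lemma bounded_clinear_V: 
  assumes "0 \<le> \<tau>"
  shows "bounded_clinear (V \<tau>)"
proof -
  obtain M where M: "1 \<le> M" "\<And>t x. 0 \<le> t \<Longrightarrow> t \<le> \<tau> \<Longrightarrow> norm (T t x) \<le> M * norm x"
    using local_bound by blast
  show ?thesis
  proof (rule bounded_clinear_intro)
    fix x y c
    have "integral {0..\<tau>} (\<lambda>t. T t (x + y)) = integral {0..\<tau>} (\<lambda>t. T t x + T t y)"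
      by (intro integral_cong) (simp add: bounded_clinearD(2)[OF bcl])
    then show "V \<tau> (x + y) = V \<tau> x + V \<tau> y" unfolding time_integral_def
      by (simp add: Henstock_Kurzweil_Integration.integral_add integrable_T)
    have "integral {0..\<tau>} (\<lambda>t. T t (c *\<^sub>C x)) = integral {0..\<tau>} ((\<lambda>y. c *\<^sub>C y) \<circ> (\<lambda>t. T t x))"
      by (intro integral_cong) (simp add: bounded_clinearD(6)[OF bcl])
    then show "V \<tau> (c *\<^sub>C x) = c *\<^sub>C V \<tau> x" unfolding time_integral_def
      by (simp only: integral_linear[OF integrable_T[OF order_refl] bounded_linear_scaleC])
    have "norm (integral {0..\<tau>} (\<lambda>t. T t x)) \<le> (M * norm x) * (\<tau> - 0)"
      using assms M by (intro integral_bound continuous_on_subset[OF continuous_on_T]) auto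
    then show "norm (V \<tau> x) \<le> (M * \<tau>) * norm x" by (simp add: time_integral_def mult_ac)
  qed
qed

lemma V_combine:
  assumes "0 \<le> a" "a \<le> b"
  shows "V a x + integral {a..b} (\<lambda>t. T t x) = V b x"
  unfolding time_integral_def by (rule Henstock_Kurzweil_Integration.integral_combine[OF assms integrable_T]) simp

lemma T_V: 
  assumes "0 \<le> h" "0 \<le> \<tau>"
  shows "T h (V \<tau> x) = V (\<tau> + h) x - V h x"
proof -
  have "T h (V \<tau> x) = integral {0..\<tau>} (T h \<circ> (\<lambda>t. T t x))"
    unfolding time_integral_def
    by (rule integral_linear[OF integrable_T[OF order_refl] bounded_clinearD(1)[OF bcl[OF assms(1)]], symmetric])
  also have "\<dots> = integral {0..\<tau>} ((\<lambda>t. T t x) \<circ> (+) h)"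
    using assms by (intro integral_cong) (simp add: T_add)
  also have "\<dots> = integral {0 + h..\<tau> + h} (\<lambda>t. T t x)" by (rule integral_shift_Icc_real)
  also have "\<dots> = V (\<tau> + h) x - V h x" using V_combine[of h "\<tau> + h" x] assms by (simp add: algebra_simps)
  finally show ?thesis .
qed

lemma V_T:
  assumes "0 \<le> h"
  shows "V \<tau> (T h x) = T h (V \<tau> x)"
proof -
  have "T h (V \<tau> x) = integral {0..\<tau>} (T h \<circ> (\<lambda>t. T t x))"
    unfolding time_integral_def
    by (rule integral_linear[OF integrable_T[OF order_refl] bounded_clinearD(1)[OF bcl[OF assms(1)]], symmetric])
  also have "\<dots> = V \<tau> (T h x)" unfolding time_integral_def
    using assms by (intro integral_cong) (simp add: T_commute)
  finally show ?thesis by simp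
qed

lemma V_0: "V 0 x = 0"
  by (simp add: time_integral_def)

lemma V_right_derivative:
  assumes \<tau>: "0 \<le> \<tau>"
  shows "((\<lambda>h. (V (\<tau> + h) x - V \<tau> x) /\<^sub>R h) \<longlongrightarrow> T \<tau> x) (at_right 0)"
  unfolding tendsto_iff
proof (intro allI impI)
  fix e :: real assume e: "0 < e"
  have "\<forall>\<^sub>F t in at \<tau> within {0..}. dist (T t x) (T \<tau> x) < e / 2"
    using continuous_on_T[of x, unfolded continuous_on_def tendsto_iff, rule_format, of \<tau> "e/2"] \<tau> e by simp
  then obtain d where d: "0 < d" "\<And>t. 0 \<le> t \<Longrightarrow> t \<noteq> \<tau> \<Longrightarrow> dist t \<tau> < d \<Longrightarrow> dist (T t x) (T \<tau> x) < e / 2"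
    unfolding eventually_at by auto
  have "dist ((V (\<tau> + h) x - V \<tau> x) /\<^sub>R h) (T \<tau> x) < e" if h: "0 < h" "h < d" for h
  proof -
    have int: "(\<lambda>t. T t x - T \<tau> x) integrable_on {\<tau>..\<tau> + h}"
      using \<tau> by (intro integrable_diff integrable_T integrable_const_ivl)
    have "V (\<tau> + h) x - V \<tau> x = integral {\<tau>..\<tau> + h} (\<lambda>t. T t x)"
      using V_combine[of \<tau> "\<tau> + h" x] \<tau> h by (simp add: algebra_simps)
    moreover have "integral {\<tau>..\<tau> + h} (\<lambda>t. T t x - T \<tau> x) = integral {\<tau>..\<tau> + h} (\<lambda>t. T t x) - h *\<^sub>R T \<tau> x"
      using \<tau> h by (subst Henstock_Kurzweil_Integration.integral_diff) (simp_all add: integrable_T integrable_const_ivl)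
    ultimately have "(V (\<tau> + h) x - V \<tau> x) /\<^sub>R h - T \<tau> x = integral {\<tau>..\<tau> + h} (\<lambda>t. T t x - T \<tau> x) /\<^sub>R h"
      using h by (simp add: scaleR_diff_right)
    moreover have "norm (integral {\<tau>..\<tau> + h} (\<lambda>t. T t x - T \<tau> x)) \<le> (e / 2) * (\<tau> + h - \<tau>)"
    proof (rule integral_bound)
      show "continuous_on {\<tau>..\<tau> + h} (\<lambda>t. T t x - T \<tau> x)"
        using \<tau> by (intro continuous_intros continuous_on_subset[OF continuous_on_T]) auto
      show "norm (T t x - T \<tau> x) \<le> e / 2" if "t \<in> {\<tau>..\<tau> + h}" for t
        using d(2)[of t] that \<tau> h e by (cases "t = \<tau>") (auto simp: dist_norm)
    qed (use h in simp)
    ultimately have "dist ((V (\<tau> + h) x - V \<tau> x) /\<^sub>R h) (T \<tau> x) \<le> inverse h * ((e / 2) * h)"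
      using h unfolding dist_norm by (simp only: norm_scaleR) (simp add: field_simps)
    also have "\<dots> < e" using h e by simp
    finally show ?thesis .
  qed
  then show "\<forall>\<^sub>F h in at_right 0. dist ((V (\<tau> + h) x - V \<tau> x) /\<^sub>R h) (T \<tau> x) < e"
    using d(1) unfolding eventually_at_right_field by (intro exI[of _ d]) auto
qed

subsection \<open>The generator\<close>

lemma generatorI:
  assumes "((\<lambda>h. (T h x - x) /\<^sub>R h) \<longlongrightarrow> y) (at_right 0)"
  shows "x \<in> D" "A x = y"
  using assms tendsto_Lim[OF _ assms] by (auto simp: generator_domain_def generator_def)

lemma generatorD: "x \<in> D \<Longrightarrow> ((\<lambda>h. (T h x - x) /\<^sub>R h) \<longlongrightarrow> A x) (at_right 0)"
  using generatorI(2) by (auto simp: generator_domain_def)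

lemma generator_V:
  assumes "0 \<le> \<tau>"
  shows "V \<tau> x \<in> D" "A (V \<tau> x) = T \<tau> x - x"
proof -
  have "((\<lambda>h. (V (\<tau> + h) x - V \<tau> x) /\<^sub>R h - (V (0 + h) x - V 0 x) /\<^sub>R h) \<longlongrightarrow> T \<tau> x - T 0 x) (at_right 0)"
    by (intro tendsto_diff V_right_derivative assms order_refl)
  moreover have "\<forall>\<^sub>F h in at_right 0. (V (\<tau> + h) x - V \<tau> x) /\<^sub>R h - (V (0 + h) x - V 0 x) /\<^sub>R h
      = (T h (V \<tau> x) - V \<tau> x) /\<^sub>R h"
    using eventually_at_right_less[of 0]
    by eventually_elim (simp add: T_V assms V_0 algebra_simps)
  ultimately have "((\<lambda>h. (T h (V \<tau> x) - V \<tau> x) /\<^sub>R h) \<longlongrightarrow> T \<tau> x - T 0 x) (at_right 0)"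
    by (rule Lim_transform_eventually)
  then have "((\<lambda>h. (T h (V \<tau> x) - V \<tau> x) /\<^sub>R h) \<longlongrightarrow> T \<tau> x - x) (at_right 0)"
    by (simp add: T_0)
  then show "V \<tau> x \<in> D" "A (V \<tau> x) = T \<tau> x - x" by (rule generatorI)+
qed

lemma V_generator:
  assumes "x \<in> D" "0 \<le> \<tau>"
  shows "V \<tau> (A x) = T \<tau> x - x"
proof (rule tendsto_unique[of "at_right 0"])
  note bl = bounded_clinear_V[OF assms(2)]
  show "((\<lambda>h. V \<tau> ((T h x - x) /\<^sub>R h)) \<longlongrightarrow> V \<tau> (A x)) (at_right 0)"
    by (rule bounded_linear.tendsto[OF bounded_clinearD(1)[OF bl] generatorD[OF assms(1)]])
  have "((\<lambda>h. (T h (V \<tau> x) - V \<tau> x) /\<^sub>R h) \<longlongrightarrow> T \<tau> x - x) (at_right 0)"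
    using generatorD[OF generator_V(1)[OF assms(2)]] generator_V(2)[OF assms(2)] by simp
  moreover have "\<forall>\<^sub>F h in at_right 0. (T h (V \<tau> x) - V \<tau> x) /\<^sub>R h = V \<tau> ((T h x - x) /\<^sub>R h)"
    using eventually_at_right_less[of 0]
    by eventually_elim (simp add: bounded_clinearD(3,5)[OF bl] V_T)
  ultimately show "((\<lambda>h. V \<tau> ((T h x - x) /\<^sub>R h)) \<longlongrightarrow> T \<tau> x - x) (at_right 0)"
    by (rule Lim_transform_eventually)
qed simp

lemma domain_dense: "\<exists>y. (\<forall>n. y n \<in> D) \<and> y \<longlonglongrightarrow> x"
proof -
  have "((\<lambda>h. (V (0 + h) x - V 0 x) /\<^sub>R h) \<longlongrightarrow> T 0 x) (at_right 0)" by (rule V_right_derivative) simp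
  then have lim: "((\<lambda>h. V h x /\<^sub>R h) \<longlongrightarrow> x) (at_right 0)" by (simp add: V_0 T_0)
  have "filterlim (\<lambda>n. inverse (real (Suc n))) (at_right 0) sequentially"
    unfolding filterlim_at using LIMSEQ_inverse_real_of_nat by (auto intro!: always_eventually)
  from filterlim_compose[OF lim this]
  have "(\<lambda>n. V (inverse (real (Suc n))) x /\<^sub>R inverse (real (Suc n))) \<longlonglongrightarrow> x" .
  moreover have "V h x /\<^sub>R h \<in> D" if "0 \<le> h" for h
    using generator_V(1)[OF that, of "x /\<^sub>R h"] bounded_clinearD(5)[OF bounded_clinear_V[OF that]] by simp
  then have "\<forall>n. V (inverse (real (Suc n))) x /\<^sub>R inverse (real (Suc n)) \<in> D"
    by (metis of_nat_0_le_iff inverse_nonnegative_iff_nonnegative)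
  ultimately show ?thesis
    by (intro exI[of _ "\<lambda>n. V (inverse (real (Suc n))) x /\<^sub>R inverse (real (Suc n))"] conjI)
qed

lemma V_steps: "(\<Sum>k<n. T (real k) (V 1 x)) = V (real n) x"
proof (induction n)
  case (Suc n)
  then show ?case using T_V[of "real n" 1 x] by simp
qed (simp add: V_0)

text \<open>
  The integral \<open>V t\<close> of the semigroup over \<open>[0, t]\<close> commutes with \<open>T t\<close> and satisfies
  \<open>A (V t x) = T t x - x\<close>, so an inverse \<open>Q\<close> of \<open>1 - T t\<close> yields the inverse \<open>V t \<circ> Q\<close>
  of \<open>- A\<close>.
\<close>

lemma generator_inverse:
  assumes t: "0 \<le> t" and Q: "bounded_clinear Q" "\<And>x. Q (x - T t x) = x" "\<And>x. Q x - T t (Q x) = x"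
  shows "bounded_clinear (\<lambda>x. V t (Q x))" "V t (Q x) \<in> D" "A (V t (Q x)) = - x"
    "x \<in> D \<Longrightarrow> V t (Q (A x)) = - x"
proof -
  show "bounded_clinear (\<lambda>x. V t (Q x))" by (rule bounded_clinear_compose[OF bounded_clinear_V[OF t] Q(1)])
  show "V t (Q x) \<in> D" by (rule generator_V[OF t])
  show "A (V t (Q x)) = - x" using generator_V(2)[OF t, of "Q x"] Q(3)[of x] by (metis minus_diff_eq)
  assume x: "x \<in> D"
  have commute: "V t (Q y) = Q (V t y)" for y
  proof -
    have "V t y = V t (Q y) - T t (V t (Q y))"
      using bounded_clinearD(3)[OF bounded_clinear_V[OF t], of "Q y" "T t (Q y)"] Q(3)[of y] V_T[OF t, of t "Q y"]
      by simp
    then show ?thesis using Q(2)[of "V t (Q y)"] by simp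
  qed
  have "V t (Q (A x)) = Q (- (x - T t x))" by (simp add: commute V_generator[OF x t])
  then show "V t (Q (A x)) = - x" unfolding bounded_clinearD(4)[OF Q(1)] Q(2) .
qed

text \<open>
  The inverse of \<open>- A\<close> is the integral of \<open>T t\<close> over \<open>[0, \<infinity>)\<close>. It is composed of the
  integral over \<open>[0, 1]\<close> and the Neumann series of \<open>T 1\<close>, a geometric series in place of
  an improper integral.
\<close>

lemma stable_inverse:
  assumes "growth_rate T w" "w < 0"
  obtains R where "bounded_clinear R" "\<And>x. R x \<in> D" "\<And>x. A (R x) = - x"
    "\<And>x. x \<in> D \<Longrightarrow> R (A x) = - x" "\<And>x. (\<lambda>n. V (real n) x) \<longlonglongrightarrow> R x"
proof -
  obtain M where M: "\<And>t x. 0 \<le> t \<Longrightarrow> norm (T t x) \<le> M * exp (w * t) * norm x"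
    using assms(1) by (auto simp: growth_rate_def)
  define q where "q = exp w"
  have q: "0 < q" "q < 1" using assms(2) by (simp_all add: q_def)
  have Tn: "norm ((T 1 ^^ n) x) \<le> M * q ^ n * norm x" for n x
    using M[of "real n" x] T_power[of 1 n x] by (simp add: q_def exp_of_nat_mult[symmetric] mult.commute)
  have "q < cmod 1" "0 \<le> q" using q by simp_all
  obtain N where N: "bounded_clinear N" "\<And>x. 1 *\<^sub>C N x - T 1 (N x) = x" "\<And>x. N (1 *\<^sub>C x - T 1 x) = x"
    "\<And>x. (\<lambda>n. (1/1) ^ Suc n *\<^sub>C (T 1 ^^ n) x) sums N x"
    by (rule neumann_series[OF bcl[OF zero_le_one] Tn \<open>0 \<le> q\<close> \<open>q < cmod 1\<close>]) blast
  note inv = generator_inverse[OF zero_le_one N(1) N(3,2)[unfolded scaleC_one]]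
  have lim: "(\<lambda>n. V (real n) x) \<longlonglongrightarrow> V 1 (N x)" for x
  proof -
    note bl = bounded_clinearD(1)[OF bounded_clinear_V[OF zero_le_one]]
    have "(\<lambda>n. (T 1 ^^ n) x) sums N x" using N(4)[of x] by (simp add: scaleC_one)
    moreover have "(T 1 ^^ n) y = T (real n) y" for n y using T_power[of 1 n y] by simp
    ultimately have "(\<lambda>n. V 1 (T (real n) x)) sums V 1 (N x)" using bounded_linear.sums[OF bl] by simp
    then show ?thesis by (simp add: V_T sums_def V_steps)
  qed
  show ?thesis by (rule that[OF inv lim])
qed

end

section \<open>Rescaled semigroups\<close>

definition rescale :: "complex \<Rightarrow> (real \<Rightarrow> 'a::complex_normed_vector \<Rightarrow> 'a) \<Rightarrow> real \<Rightarrow> 'a \<Rightarrow> 'a" where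
  "rescale z T t x = exp (- z * complex_of_real t) *\<^sub>C T t x"

lemma tendsto_scaleC:
  assumes "(f \<longlongrightarrow> c) F" "(g \<longlongrightarrow> (x::'a::complex_normed_vector)) F"
  shows "((\<lambda>t. f t *\<^sub>C g t) \<longlongrightarrow> c *\<^sub>C x) F"
proof -
  have "bounded_bilinear (\<lambda>(c::complex) (x::'a). c *\<^sub>C x)"
    by standard (auto simp: scaleC_add_left scaleC_add_right scaleC_scaleR norm_scaleC scaleR_conv_of_real
        scaleC_of_real_mult intro: exI[of _ 1])
  then show ?thesis using assms by (rule bounded_bilinear.tendsto)
qed

context c0_semigroup
begin

lemma C0_rescale: "C0_semigroup (rescale z T)"
  unfolding C0_semigroup_def
proof (intro conjI allI impI)
  fix s t :: real and x assume st: "0 \<le> s" "0 \<le> t"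
  show "bounded_clinear (rescale z T t)"
    unfolding rescale_def[abs_def] by (intro bounded_clinear_scaleC bcl st)
  show "rescale z T (s + t) x = rescale z T s (rescale z T t x)"
    using st by (simp add: rescale_def T_add bounded_clinearD(6)[OF bcl] scaleC_scaleC exp_add[symmetric] algebra_simps)
next
  show "rescale z T 0 x = x" for x by (simp add: rescale_def T_0 scaleC_one)
  show "continuous_on {0..} (\<lambda>t. rescale z T t x)" for x
    unfolding continuous_on_def rescale_def
  proof
    fix t :: real assume "t \<in> {0..}"
    then show "((\<lambda>t. exp (- z * complex_of_real t) *\<^sub>C T t x) \<longlongrightarrow> exp (- z * complex_of_real t) *\<^sub>C T t x) (at t within {0..})"
      using continuous_on_T[of x] by (intro tendsto_scaleC tendsto_intros) (simp add: continuous_on_def)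
  qed
qed

lemma growth_rate_rescale:
  assumes "growth_rate T w"
  shows "growth_rate (rescale z T) (w - Re z)"
proof -
  obtain M where M: "\<And>t x. 0 \<le> t \<Longrightarrow> norm (T t x) \<le> M * exp (w * t) * norm x"
    using assms by (auto simp: growth_rate_def)
  have "norm (rescale z T t x) \<le> M * exp ((w - Re z) * t) * norm x" if "0 \<le> t" for t x
  proof -
    have "norm (rescale z T t x) \<le> exp (- Re z * t) * (M * exp (w * t) * norm x)"
      unfolding rescale_def norm_scaleC by (intro mult_mono M that) simp_all
    then show ?thesis by (simp add: left_diff_distrib exp_diff exp_minus field_simps)
  qed
  then show ?thesis unfolding growth_rate_def by blast
qed

lemma generator_rescale:
  assumes "x \<in> D"
  shows "x \<in> generator_domain (rescale z T)" "generator (rescale z T) x = A x - z *\<^sub>C x"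
proof -
  interpret U: c0_semigroup "rescale z T" by standard (rule C0_rescale)
  have "((\<lambda>u. exp (- z * u)) has_field_derivative - z) (at 0)"
    by (auto intro!: derivative_eq_intros)
  then have "((\<lambda>u. (exp (- z * u) - 1) / u) \<longlongrightarrow> - z) (at 0)"
    by (simp add: has_field_derivative_iff)
  moreover have "filterlim complex_of_real (at 0) (at_right 0)"
    unfolding filterlim_at
    by (auto intro!: tendsto_eq_intros eventually_mono[OF eventually_at_right_less[of 0]])
  ultimately have "((\<lambda>t. (exp (- z * complex_of_real t) - 1) / complex_of_real t) \<longlongrightarrow> - z) (at_right 0)"
    by (rule filterlim_compose)
  then have e: "((\<lambda>t. (exp (- z * complex_of_real t) - 1) /\<^sub>R t) \<longlongrightarrow> - z) (at_right 0)"
    by (simp add: scaleR_conv_of_real divide_inverse mult.commute)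
  have "((\<lambda>t. exp (- z * complex_of_real t) *\<^sub>C ((T t x - x) /\<^sub>R t) + ((exp (- z * complex_of_real t) - 1) /\<^sub>R t) *\<^sub>C x)
      \<longlongrightarrow> exp (- z * complex_of_real 0) *\<^sub>C A x + (- z) *\<^sub>C x) (at_right 0)"
    by (intro tendsto_add tendsto_scaleC generatorD assms e tendsto_intros)
  moreover have "exp (- z * complex_of_real t) *\<^sub>C ((T t x - x) /\<^sub>R t) + ((exp (- z * complex_of_real t) - 1) /\<^sub>R t) *\<^sub>C x
      = (rescale z T t x - x) /\<^sub>R t" for t
  proof -
    have "((exp (- z * complex_of_real t) - 1) /\<^sub>R t) *\<^sub>C x = ((exp (- z * complex_of_real t) - 1) *\<^sub>C x) /\<^sub>R t"
      by (simp only: scaleR_conv_of_real scaleC_of_real_mult)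
    then show ?thesis
      by (simp add: rescale_def scaleC_scaleR scaleC_diff_left scaleC_diff_right scaleC_one scaleR_add_right[symmetric]
          del: scaleR_add_right)
  qed
  ultimately have "((\<lambda>t. (rescale z T t x - x) /\<^sub>R t) \<longlongrightarrow> A x - z *\<^sub>C x) (at_right 0)"
    by (simp add: scaleC_one scaleC_uminus_left)
  then show "x \<in> generator_domain (rescale z T)" "generator (rescale z T) x = A x - z *\<^sub>C x" by (rule U.generatorI)+
qed

lemma rescale_rescale: "rescale (- z) (rescale z T) = T"
  by (rule ext)+ (simp add: rescale_def scaleC_scaleC scaleC_one exp_add[symmetric])

lemma domain_rescale: "generator_domain (rescale z T) = D"
proof -
  interpret U: c0_semigroup "rescale z T" by standard (rule C0_rescale)
  show ?thesis using generator_rescale(1)[of _ z] U.generator_rescale(1)[of _ "- z"]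
    by (auto simp: rescale_rescale)
qed

lemma resolvent_from_rescaled:
  assumes R: "bounded_clinear R" "\<And>x. R x \<in> generator_domain (rescale z T)" "\<And>x. generator (rescale z T) (R x) = - x"
    "\<And>x. x \<in> generator_domain (rescale z T) \<Longrightarrow> R (generator (rescale z T) x) = - x"
  shows "R x \<in> D" "z *\<^sub>C R x - A (R x) = x" "x \<in> D \<Longrightarrow> R (z *\<^sub>C x - A x) = x"
proof -
  show RD: "R x \<in> D" using R(2) by (simp add: domain_rescale)
  show "z *\<^sub>C R x - A (R x) = x"
    using R(3)[of x] generator_rescale(2)[OF RD, of z] by (simp add: algebra_simps eq_neg_iff_add_eq_0)
  assume x: "x \<in> D"
  have "R (A x - z *\<^sub>C x) = - x" using R(4)[of x] x generator_rescale(2)[OF x, of z] by (simp add: domain_rescale)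
  then show "R (z *\<^sub>C x - A x) = x" using bounded_clinearD(4)[OF R(1), of "A x - z *\<^sub>C x"] by simp
qed

lemma laplace_resolvent:
  assumes "growth_rate T w" "w < Re z"
  obtains R where "bounded_clinear R" "\<And>x. R x \<in> D" "\<And>x. z *\<^sub>C R x - A (R x) = x"
    "\<And>x. x \<in> D \<Longrightarrow> R (z *\<^sub>C x - A x) = x"
    "\<And>x. (\<lambda>n. time_integral (rescale z T) (real n) x) \<longlonglongrightarrow> R x"
proof -
  interpret U: c0_semigroup "rescale z T" by standard (rule C0_rescale)
  have "w - Re z < 0" using assms(2) by simp
  from growth_rate_rescale[OF assms(1), of z] this
  obtain R where R: "bounded_clinear R" "\<And>x. R x \<in> U.D" "\<And>x. U.A (R x) = - x"
    "\<And>x. x \<in> U.D \<Longrightarrow> R (U.A x) = - x" "\<And>x. (\<lambda>n. U.V (real n) x) \<longlonglongrightarrow> R x"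
    by (rule U.stable_inverse) blast
  show ?thesis by (rule that[OF R(1) resolvent_from_rescaled[OF R(1-4)] R(5)])
qed

text \<open>
  The inclusion of \<open>exp (t \<sigma>(A))\<close> in \<open>\<sigma>(T t)\<close>: apply \<open>generator_inverse\<close> to the
  semigroup \<open>exp (- z t) T t\<close>, whose generator is \<open>A - z\<close>.
\<close>

lemma spectral_inclusion:
  assumes t: "0 \<le> t" and res: "exp (z * complex_of_real t) \<in> resolvent_set UNIV (T t)"
  shows "z \<in> resolvent_set D A"
proof -
  interpret U: c0_semigroup "rescale z T" by standard (rule C0_rescale)
  define c where "c = exp (z * complex_of_real t)"
  let ?f = "\<lambda>x. c *\<^sub>C x - T t x"
  define P where "P = the_inv_into UNIV ?f"
  have bij: "bij_betw ?f UNIV UNIV" and P: "bounded_clinear P"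
    using res by (auto simp: resolvent_set_def c_def P_def)
  have Pf: "P (?f x) = x" for x
    unfolding P_def using bij by (intro the_inv_into_f_f[of ?f UNIV]) (auto simp: bij_betw_def)
  have fP: "?f (P x) = x" for x
    unfolding P_def using bij by (intro f_the_inv_into_f[of ?f UNIV]) (auto simp: bij_betw_def)
  have cf: "c *\<^sub>C (x - rescale z T t x) = ?f x" for x
    by (simp add: rescale_def c_def scaleC_diff_right scaleC_scaleC scaleC_one exp_add[symmetric])
  define Q where "Q x = P (c *\<^sub>C x)" for x
  have Q: "bounded_clinear Q" "Q (x - rescale z T t x) = x" "Q x - rescale z T t (Q x) = x" for x
  proof -
    have "Q = (\<lambda>x. c *\<^sub>C P x)" unfolding Q_def[abs_def] bounded_clinearD(6)[OF P] ..
    then show "bounded_clinear Q" using bounded_clinear_scaleC[OF P] by simp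
    show "Q (x - rescale z T t x) = x" unfolding Q_def cf Pf ..
    have "c *\<^sub>C (Q x - rescale z T t (Q x)) = c *\<^sub>C x" unfolding cf unfolding Q_def fP ..
    then have "(1 / c) *\<^sub>C c *\<^sub>C (Q x - rescale z T t (Q x)) = (1 / c) *\<^sub>C c *\<^sub>C x" by simp
    then show "Q x - rescale z T t (Q x) = x" by (simp add: scaleC_scaleC scaleC_one c_def)
  qed
  note R = U.generator_inverse[OF t Q]
  show ?thesis by (rule resolvent_setI[OF R(1) resolvent_from_rescaled[OF R]])
qed

lemma right_half_plane_resolvent:
  assumes "growth_rate T w" "w < Re z"
  shows "z \<in> resolvent_set D A"
proof -
  obtain R where "bounded_clinear R" "\<And>x. R x \<in> D" "\<And>x. z *\<^sub>C R x - A (R x) = x"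
    "\<And>x. x \<in> D \<Longrightarrow> R (z *\<^sub>C x - A x) = x"
    by (rule laplace_resolvent[OF assms]) blast
  then show ?thesis by (rule resolvent_setI)
qed

end

section \<open>Positive semigroups\<close>

locale positive_semigroup = c0_semigroup T for T :: "real \<Rightarrow> 'a::cstar_algebra \<Rightarrow> 'a" +
  assumes positive_T: "0 \<le> t \<Longrightarrow> positive_operator (T t)"
begin

lemma T_cone: "0 \<le> t \<Longrightarrow> x \<in> positive_cone \<Longrightarrow> T t x \<in> positive_cone"
  using positive_T by (simp add: positive_operator_def)

lemma T_mono: "0 \<le> t \<Longrightarrow> x \<preceq> y \<Longrightarrow> T t x \<preceq> T t y"
  using T_cone[of t "y - x"] by (simp add: cone_le_def bounded_clinearD(3)[OF bcl])

lemma V_cone: "x \<in> positive_cone \<Longrightarrow> V \<tau> x \<in> positive_cone"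
  unfolding time_integral_def by (rule integral_cone[OF integrable_T]) (auto intro: T_cone)

text \<open>
  The hypothesis of \<open>exponential_decay\<close> is verified for \<open>S = T 1\<close>. For \<open>n \<le> t \<le> n + 1\<close>
  the element \<open>T (n + 1) (x (n + 1))\<close> is \<open>T t\<close> applied to \<open>T (n + 1 - t) (x (n + 1))\<close>.
  As \<open>n < N\<close> and \<open>t\<close> vary, the latter elements, divided by \<open>2 M\<close>, range over a compact
  set of positive elements of norm less than \<open>1\<close>. A common upper bound \<open>e\<close> of a finite
  net in this set controls \<open>\<phi> (T (n + 1) (x (n + 1)))\<close> by the integral of \<open>\<phi> (T t e)\<close>
  over \<open>[n, n + 1]\<close>, up to an arbitrarily small error.
\<close>

lemma bounded_integrals_decay:
  assumes C: "\<And>N e. e \<in> positive_cone \<Longrightarrow> norm (V (real N) e) \<le> C * norm e"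
  shows "\<exists>w<0. growth_rate T w"
proof -
  obtain M where M: "1 \<le> M" "\<And>t x. 0 \<le> t \<Longrightarrow> t \<le> 1 \<Longrightarrow> norm (T t x) \<le> M * norm x"
    using local_bound by blast
  define C' where "C' = max C 0"
  have C': "0 \<le> C'" "\<And>N e. e \<in> positive_cone \<Longrightarrow> norm (V (real N) e) \<le> C' * norm e"
  proof -
    show "norm (V (real N) e) \<le> C' * norm e" if "e \<in> positive_cone" for N e
      using C[OF that, of N] mult_right_mono[of C C' "norm e"] by (simp add: C'_def)
  qed (simp add: C'_def)
  have H: "(\<Sum>n<N. \<phi> ((T 1 ^^ n) (x n))) \<le> (1 + 4 * M * C') * K"
    if \<phi>: "positive_functional \<phi>" and K: "\<And>y. y \<in> positive_cone \<Longrightarrow> norm y < 1 \<Longrightarrow> \<phi> y \<le> K"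
      and x: "\<And>n. x n \<in> positive_cone \<and> norm (x n) < 1" for \<phi> K N and x :: "nat \<Rightarrow> 'a"
  proof -
    interpret \<phi>: bounded_linear \<phi> using \<phi> by (simp add: positive_functional_def)
    have K0: "0 \<le> K" using K[of 0] by (simp add: cone_zero \<phi>.zero)
    have \<phi>_le: "\<phi> y \<le> 2 * K * norm y" if y: "y \<in> positive_cone" for y
    proof (cases "y = 0")
      case False
      then have "\<phi> ((1 / (2 * norm y)) *\<^sub>R y) \<le> K" using y by (intro K cone_scaleR) simp_all
      then show ?thesis using False by (simp add: \<phi>.scaleR field_simps)
    qed (simp add: \<phi>.zero)
    have Tpow: "(T 1 ^^ n) y = T (real n) y" for n y using T_power[of 1 n y] by simp
    obtain L where L: "1 \<le> L" "\<And>t x. 0 \<le> t \<Longrightarrow> t \<le> real N \<Longrightarrow> norm (T t x) \<le> L * norm x"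
      using local_bound by blast
    obtain P where P: "\<And>y. norm (\<phi> y) \<le> norm y * P" "0 < P" using \<phi>.pos_bounded by blast
    have shifted: "(\<Sum>n<N. \<phi> (T (real (Suc n)) (x (Suc n)))) \<le> 4 * M * C' * K"
    proof (rule field_le_epsilon)
      fix \<delta> :: real assume \<delta>: "0 < \<delta>"
      (* The net approximates up to \<epsilon>; the N error terms 2 * M * (L * P * \<epsilon>) add up to less than \<delta>. *)
      define \<epsilon> where "\<epsilon> = \<delta> / (2 * M * (real N + 1) * (L * P))"
      have LP: "0 < L * P" using L(1) P(2) by simp
      have \<epsilon>: "0 < \<epsilon>" using \<delta> LP M(1) by (simp add: \<epsilon>_def)
      define Z where "Z = (\<Union>n<N. (\<lambda>s. (1 / (2 * M)) *\<^sub>R T s (x (Suc n))) ` {0..1})"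
      have "compact Z"
        unfolding Z_def
        by (intro compact_UN compact_continuous_image continuous_intros continuous_on_subset[OF continuous_on_T]) auto
      have ZB: "z \<in> positive_cone \<and> norm z < 1" if "z \<in> Z" for z
      proof -
        obtain n where "z \<in> (\<lambda>s. (1 / (2 * M)) *\<^sub>R T s (x (Suc n))) ` {0..1}"
          using \<open>z \<in> Z\<close> unfolding Z_def by (elim UN_E)
        then obtain s where "z = (1 / (2 * M)) *\<^sub>R T s (x (Suc n))" "s \<in> {0..1}" by (elim imageE)
        then have z: "z = (1 / (2 * M)) *\<^sub>R T s (x (Suc n))" "0 \<le> s" "s \<le> 1" by simp_all
        have "M * norm (x (Suc n)) \<le> M * 1"
          using x[of "Suc n"] M(1) by (intro mult_left_mono) simp_all
        then have "norm (T s (x (Suc n))) \<le> M * 1" using M(2)[OF z(2,3), of "x (Suc n)"] by linarith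
        then have "norm z < 1" using M(1) by (simp add: z(1) divide_simps)
        moreover have "z \<in> positive_cone" unfolding z(1) using M(1) x z by (intro cone_scaleR T_cone) auto
        ultimately show ?thesis by simp
      qed
      have "Z \<subseteq> (\<Union>z\<in>Z. ball z \<epsilon>)" using \<epsilon> by auto
      then obtain F where F: "F \<subseteq> Z" "finite F" "Z \<subseteq> (\<Union>z\<in>F. ball z \<epsilon>)"
        by (rule compactE_image[OF \<open>compact Z\<close> open_ball])
      have "\<exists>e\<in>positive_cone. norm e < 1 \<and> (\<forall>y\<in>F. y \<preceq> e)"
        by (rule cone_directed[OF F(2)]) (use F(1) ZB in blast)
      then obtain e where e: "e \<in> positive_cone" "norm e < 1" "\<And>y. y \<in> F \<Longrightarrow> y \<preceq> e" by blast
      have point: "\<phi> (T (real (Suc n)) (x (Suc n))) \<le> 2 * M * (\<phi> (T t e) + L * P * \<epsilon>)"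
        if n: "n < N" and t: "real n \<le> t" "t \<le> real (Suc n)" for n t
      proof -
        define z where "z = (1 / (2 * M)) *\<^sub>R T (real (Suc n) - t) (x (Suc n))"
        have t0: "0 \<le> t" "t \<le> real N" using n t by simp_all
        have "z \<in> Z" unfolding Z_def z_def using n t by (intro UN_I[of n] image_eqI[of _ _ "real (Suc n) - t"]) auto
        then obtain y where y: "y \<in> F" "dist y z < \<epsilon>" using F(3) by auto
        have "T (real (Suc n)) (x (Suc n)) = T t (T (real (Suc n) - t) (x (Suc n)))"
          using T_add[of t "real (Suc n) - t" "x (Suc n)"] t t0 by simp
        also have "\<dots> = (2 * M) *\<^sub>R T t z"
          using M(1) by (simp add: z_def bounded_clinearD(5)[OF bcl[OF t0(1)]])
        finally have "\<phi> (T (real (Suc n)) (x (Suc n))) = 2 * M * \<phi> (T t z)" by (simp add: \<phi>.scaleR)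
        moreover have "\<phi> (T t z) \<le> \<phi> (T t e) + L * P * \<epsilon>"
        proof -
          have "\<phi> (T t z) = \<phi> (T t y) + \<phi> (T t (z - y))"
            by (simp add: bounded_clinearD(3)[OF bcl[OF t0(1)]] \<phi>.diff)
          moreover have "\<phi> (T t y) \<le> \<phi> (T t e)"
            by (intro positive_functional_mono[OF \<phi>] T_mono t0 e(3) y)
          moreover have "\<phi> (T t (z - y)) \<le> L * P * \<epsilon>"
          proof -
            have "\<phi> (T t (z - y)) \<le> norm (T t (z - y)) * P" using P(1)[of "T t (z - y)"] by simp
            also have "\<dots> \<le> (L * norm (z - y)) * P" using P(2) by (intro mult_right_mono L(2) t0) simp
            also have "\<dots> \<le> (L * \<epsilon>) * P"
              using P(2) L(1) y(2) by (intro mult_right_mono mult_left_mono) (simp_all add: dist_norm norm_minus_commute)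
            finally show ?thesis by (simp add: mult_ac)
          qed
          ultimately show ?thesis by linarith
        qed
        ultimately show ?thesis using M(1) by (simp add: mult_left_mono)
      qed
      have step: "\<phi> (T (real (Suc n)) (x (Suc n))) \<le> 2 * M * (\<phi> (V (real (Suc n)) e - V (real n) e) + L * P * \<epsilon>)"
        if n: "n < N" for n
      proof -
        have int: "(\<lambda>t. T t e) integrable_on {real n..real (Suc n)}" by (rule integrable_T) simp
        have int\<phi>: "(\<phi> \<circ> (\<lambda>t. T t e)) integrable_on {real n..real (Suc n)}"
          by (rule integrable_linear[OF int \<phi>.bounded_linear_axioms])
        have "integral {real n..real (Suc n)} (\<phi> \<circ> (\<lambda>t. T t e)) = \<phi> (integral {real n..real (Suc n)} (\<lambda>t. T t e))"
          by (rule integral_linear[OF int \<phi>.bounded_linear_axioms])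
        also have "integral {real n..real (Suc n)} (\<lambda>t. T t e) = V (real (Suc n)) e - V (real n) e"
          using V_combine[of "real n" "real (Suc n)" e] by (simp add: algebra_simps)
        finally have eq: "integral {real n..real (Suc n)} (\<phi> \<circ> (\<lambda>t. T t e)) = \<phi> (V (real (Suc n)) e - V (real n) e)" .
        define c where "c = \<phi> (T (real (Suc n)) (x (Suc n))) / (2 * M) - L * P * \<epsilon>"
        have "integral {real n..real (Suc n)} (\<lambda>_. c) \<le> integral {real n..real (Suc n)} (\<phi> \<circ> (\<lambda>t. T t e))"
        proof (rule integral_le[OF integrable_const_ivl int\<phi>])
          fix t assume "t \<in> {real n..real (Suc n)}"
          then show "c \<le> (\<phi> \<circ> (\<lambda>t. T t e)) t" using point[OF n, of t] M(1) by (simp add: c_def field_simps)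
        qed
        then have "c \<le> \<phi> (V (real (Suc n)) e - V (real n) e)" unfolding eq by simp
        then show ?thesis using M(1) by (simp add: c_def field_simps)
      qed
      have "(\<Sum>n<N. \<phi> (T (real (Suc n)) (x (Suc n))))
          \<le> (\<Sum>n<N. 2 * M * (\<phi> (V (real (Suc n)) e - V (real n) e) + L * P * \<epsilon>))"
        by (intro sum_mono step) simp
      also have "\<dots> = 2 * M * ((\<Sum>n<N. \<phi> (V (real (Suc n)) e) - \<phi> (V (real n) e)) + real N * (L * P * \<epsilon>))"
        by (simp add: sum_distrib_left[symmetric] sum.distrib \<phi>.diff)
      also have "(\<Sum>n<N. \<phi> (V (real (Suc n)) e) - \<phi> (V (real n) e)) = \<phi> (V (real N) e)"
        by (subst sum_lessThan_telescope[of "\<lambda>n. \<phi> (V (real n) e)"]) (simp add: V_0 \<phi>.zero)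
      also have "\<phi> (V (real N) e) \<le> 2 * K * C'"
      proof -
        have "norm (V (real N) e) \<le> C' * 1"
          using C'(2)[OF e(1), of N] C'(1) e(2) mult_left_mono[of "norm e" 1 C'] by linarith
        then have "2 * K * norm (V (real N) e) \<le> 2 * K * C'" using K0 by (intro mult_left_mono) simp_all
        then show ?thesis using \<phi>_le[OF V_cone[OF e(1)], of "real N"] by linarith
      qed
      also have "real N * (L * P * \<epsilon>) \<le> \<delta> / (2 * M)"
      proof -
        have "real N * (L * P * \<epsilon>) = (real N / (real N + 1)) * (\<delta> / (2 * M))"
          using L(1) P(2) by (simp add: \<epsilon>_def)
        also have "\<dots> \<le> 1 * (\<delta> / (2 * M))" using M(1) \<delta> by (intro mult_right_mono) simp_all
        finally show ?thesis by simp
      qed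
      finally have "(\<Sum>n<N. \<phi> (T (real (Suc n)) (x (Suc n)))) \<le> 2 * M * (2 * K * C' + \<delta> / (2 * M))"
        using M(1) by (simp add: mult_left_mono)
      then show "(\<Sum>n<N. \<phi> (T (real (Suc n)) (x (Suc n)))) \<le> 4 * M * C' * K + \<delta>"
        using M(1) by (simp add: distrib_left mult_ac)
    qed
    have "(\<Sum>n<N. \<phi> ((T 1 ^^ n) (x n))) \<le> (\<Sum>n<Suc N. \<phi> (T (real n) (x n)))"
    proof -
      have "0 \<le> \<phi> (T (real N) (x N))"
        using \<phi> T_cone[of "real N" "x N"] x by (simp add: positive_functional_def)
      then show ?thesis by (simp add: Tpow)
    qed
    also have "\<dots> = \<phi> (x 0) + (\<Sum>n<N. \<phi> (T (real (Suc n)) (x (Suc n))))"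
      by (subst sum.lessThan_Suc_shift) (simp add: T_0)
    also have "\<dots> \<le> K + 4 * M * C' * K" using shifted K[of "x 0"] x by (intro add_mono) simp_all
    finally show ?thesis by (simp add: algebra_simps)
  qed
  show ?thesis
  proof (rule exponential_decay[OF bcl[OF zero_le_one] positive_T[OF zero_le_one] H])
    fix M' q :: real
    assume q: "0 < q" "q < 1" "0 \<le> M'" "\<And>n x. norm ((T 1 ^^ n) x) \<le> M' * q ^ n * norm x"
    have "growth_rate T (ln q / 1)"
      by (rule growth_rate_from_powers[OF zero_less_one q(1) q(3)]) (simp only: T_power[OF zero_le_one] q(4))
    then show ?thesis using q by (intro exI[of _ "ln q"]) simp
  qed
qed

lemma rescale_of_real: "rescale (complex_of_real l) T t x = exp (- l * t) *\<^sub>R T t x"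
proof -
  have "exp (- complex_of_real l * complex_of_real t) = complex_of_real (exp (- l * t))"
    by (simp add: exp_of_real[symmetric])
  then show ?thesis by (simp only: rescale_def scaleC_of_real)
qed

lemma positive_semigroup_rescale: "positive_semigroup (rescale (complex_of_real l) T)"
proof
  show "C0_semigroup (rescale (complex_of_real l) T)" by (rule C0_rescale)
  show "positive_operator (rescale (complex_of_real l) T t)" if "0 \<le> t" for t
    unfolding positive_operator_def rescale_of_real using that by (auto intro: cone_scaleR T_cone)
qed

lemma growth_rate_rescale_of_real: "growth_rate (rescale (complex_of_real l) T) w \<longleftrightarrow> growth_rate T (w + l)"
proof
  interpret U: positive_semigroup "rescale (complex_of_real l) T" by (rule positive_semigroup_rescale)
  assume "growth_rate (rescale (complex_of_real l) T) w"
  then show "growth_rate T (w + l)" using U.growth_rate_rescale[of w "- complex_of_real l"] by (simp add: rescale_rescale)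
next
  assume "growth_rate T (w + l)"
  then show "growth_rate (rescale (complex_of_real l) T) w" using growth_rate_rescale[of "w + l" "complex_of_real l"] by simp
qed

lemma bounded_laplace_growth:
  assumes "\<And>N e. e \<in> positive_cone \<Longrightarrow> norm (time_integral (rescale (complex_of_real l) T) (real N) e) \<le> C * norm e"
  shows "\<exists>w<l. growth_rate T w"
proof -
  interpret U: positive_semigroup "rescale (complex_of_real l) T" by (rule positive_semigroup_rescale)
  obtain w where "w < 0" "growth_rate (rescale (complex_of_real l) T) w"
    using U.bounded_integrals_decay[OF assms] by blast
  then show ?thesis unfolding growth_rate_rescale_of_real by (intro exI[of _ "w + l"]) simp
qed

text \<open>
  The last clause compares the Laplace integral over \<open>[0, N]\<close> at \<open>l\<close> with the resolvent
  at \<open>m\<close>: on this interval \<open>exp (- l t) \<le> 2 exp (- m t)\<close>, and the remaining part of the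
  integral that defines the resolvent is positive.
\<close>

lemma positive_resolvent:
  assumes "growth_rate T w" "w < m"
  obtains R where "bounded_clinear R" "\<And>x. R x \<in> D" "\<And>x. complex_of_real m *\<^sub>C R x - A (R x) = x"
    "\<And>x. x \<in> D \<Longrightarrow> R (complex_of_real m *\<^sub>C x - A x) = x"
    "\<And>x. x \<in> positive_cone \<Longrightarrow> R x \<in> positive_cone"
    "\<And>l N x. x \<in> positive_cone \<Longrightarrow> (m - l) * real N \<le> ln 2 \<Longrightarrow>
       time_integral (rescale (complex_of_real l) T) (real N) x \<preceq> 2 *\<^sub>R R x"
proof -
  interpret U: positive_semigroup "rescale (complex_of_real m) T" by (rule positive_semigroup_rescale)
  have "w < Re (complex_of_real m)" using assms(2) by simp
  then obtain R where R: "bounded_clinear R" "\<And>x. R x \<in> D" "\<And>x. complex_of_real m *\<^sub>C R x - A (R x) = x"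
    "\<And>x. x \<in> D \<Longrightarrow> R (complex_of_real m *\<^sub>C x - A x) = x" "\<And>x. (\<lambda>n. U.V (real n) x) \<longlonglongrightarrow> R x"
    by (rule laplace_resolvent[OF assms(1)]) blast
  have R_cone: "R x \<in> positive_cone" if "x \<in> positive_cone" for x
    by (rule closed_sequentially[OF cone_closed _ R(5)]) (rule U.V_cone[OF that])
  have tail: "U.V (real N) x \<preceq> R x" if x: "x \<in> positive_cone" for N x
    unfolding cone_le_def
  proof (rule closed_sequentially[OF cone_closed])
    show "(\<lambda>n. U.V (real (n + N)) x - U.V (real N) x) \<longlonglongrightarrow> R x - U.V (real N) x"
      by (intro tendsto_diff tendsto_const LIMSEQ_ignore_initial_segment R)
    show "U.V (real (n + N)) x - U.V (real N) x \<in> positive_cone" for n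
    proof -
      have "U.V (real (n + N)) x - U.V (real N) x = rescale (complex_of_real m) T (real N) (U.V (real n) x)"
        using U.T_V[of "real N" "real n" x] by simp
      then show ?thesis using U.T_cone[OF _ U.V_cone[OF x]] by simp
    qed
  qed
  have compare: "time_integral (rescale (complex_of_real l) T) (real N) x \<preceq> 2 *\<^sub>R U.V (real N) x"
    if x: "x \<in> positive_cone" and l: "(m - l) * real N \<le> ln 2" for l N x
  proof -
    interpret W: positive_semigroup "rescale (complex_of_real l) T" by (rule positive_semigroup_rescale)
    have "2 *\<^sub>R U.V (real N) x - W.V (real N) x
      = integral {0..real N} (\<lambda>t. 2 *\<^sub>R rescale (complex_of_real m) T t x - rescale (complex_of_real l) T t x)"
      unfolding time_integral_def
      by (simp add: Henstock_Kurzweil_Integration.integral_diff U.integrable_T W.integrable_T integrable_cmul)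
    also have "\<dots> \<in> positive_cone"
    proof (rule integral_cone)
      show "(\<lambda>t. 2 *\<^sub>R rescale (complex_of_real m) T t x - rescale (complex_of_real l) T t x) integrable_on {0..real N}"
        by (intro integrable_diff integrable_cmul U.integrable_T W.integrable_T) simp_all
      fix t assume t: "t \<in> {0..real N}"
      have "(m - l) * t \<le> ln 2"
      proof (cases "0 \<le> m - l")
        case True
        then have "(m - l) * t \<le> (m - l) * real N" using t by (intro mult_left_mono) simp_all
        then show ?thesis using l by linarith
      next
        case False
        then have "(m - l) * t \<le> 0" using t by (intro mult_nonpos_nonneg) simp_all
        then show ?thesis using ln_gt_zero[of 2] by linarith
      qed
      then have "exp (- l * t) \<le> exp (ln 2 + - m * t)" unfolding exp_le_cancel_iff by (simp add: algebra_simps)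
      also have "exp (ln 2 + - m * t) = 2 * exp (- m * t)" by (simp only: exp_add) simp
      finally have "0 \<le> 2 * exp (- m * t) - exp (- l * t)" by linarith
      then have "(2 * exp (- m * t) - exp (- l * t)) *\<^sub>R T t x \<in> positive_cone"
        using t x by (intro cone_scaleR T_cone) simp_all
      then show "2 *\<^sub>R rescale (complex_of_real m) T t x - rescale (complex_of_real l) T t x \<in> positive_cone"
        by (simp add: rescale_of_real scaleR_diff_left)
    qed
    finally show ?thesis by (simp add: cone_le_def)
  qed
  have final: "time_integral (rescale (complex_of_real l) T) (real N) x \<preceq> 2 *\<^sub>R R x"
    if "x \<in> positive_cone" "(m - l) * real N \<le> ln 2" for l N x
    by (rule cone_le_trans[OF compare[OF that] cone_le_scaleR[OF tail[OF that(1)]]]) simp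
  show ?thesis by (rule that[OF R(1-4) R_cone final])
qed

lemma small_shift:
  fixes N :: nat
  assumes "0 < (K::real)"
  obtains d where "0 < d" "d * K \<le> 1/2" "d * real N \<le> ln 2"
proof -
  define d where "d = min (1 / (2 * K)) (ln 2 / (real N + 1))"
  have "0 < d" using assms by (simp add: d_def)
  moreover have "d \<le> 1 / (2 * K)" by (simp add: d_def)
  then have "d * K \<le> 1/2" using assms by (simp add: field_simps)
  moreover have "d * real N \<le> ln 2"
  proof -
    have "d * real N \<le> (ln 2 / (real N + 1)) * real N" by (intro mult_right_mono) (simp_all add: d_def)
    also have "\<dots> \<le> ln 2" by (simp add: field_simps)
    finally show ?thesis .
  qed
  ultimately show ?thesis using that by blast
qed

text \<open>
  Each truncated Laplace integral at \<open>l\<close> is dominated by twice the resolvent at some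
  \<open>m > l\<close>, where \<open>m\<close> depends on the truncation but is close enough to \<open>l\<close> for a uniform
  bound.
\<close>

lemma resolvent_growth:
  assumes res: "complex_of_real l \<in> resolvent_set D A" and g: "\<And>w. l < w \<Longrightarrow> growth_rate T w"
  shows "\<exists>w<l. growth_rate T w"
proof -
  obtain K where K: "0 < K" "\<And>y. y \<in> D \<Longrightarrow> norm y \<le> K * norm (complex_of_real l *\<^sub>C y - A y)"
    using res by (rule resolvent_set_lower_bound) blast
  show ?thesis
  proof (rule bounded_laplace_growth)
    fix N :: nat and e :: 'a assume e: "e \<in> positive_cone"
    interpret W: positive_semigroup "rescale (complex_of_real l) T" by (rule positive_semigroup_rescale)
    obtain d where d: "0 < d" "d * K \<le> 1/2" "d * real N \<le> ln 2" using small_shift[OF K(1)] by blast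
    have "growth_rate T (l + d / 2)" using d by (intro g) simp
    moreover have "l + d / 2 < l + d" using d by simp
    ultimately obtain R where R: "\<And>x. R x \<in> D" "\<And>x. complex_of_real (l + d) *\<^sub>C R x - A (R x) = x"
      "\<And>l' N x. x \<in> positive_cone \<Longrightarrow> ((l + d) - l') * real N \<le> ln 2 \<Longrightarrow>
       time_integral (rescale (complex_of_real l') T) (real N) x \<preceq> 2 *\<^sub>R R x"
      by (rule positive_resolvent) blast
    have "norm (R e) \<le> 2 * K * norm e"
      by (rule lower_bound_perturb[OF K(1) K(2)[OF R(1)] _ R(2)]) (use d in simp)
    moreover have "norm (W.V (real N) e) \<le> norm (2 *\<^sub>R R e)"
      using R(3)[OF e, of l N] d by (intro cone_norm_mono W.V_cone e) simp
    ultimately show "norm (W.V (real N) e) \<le> (4 * K) * norm e" by simp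
  qed
qed

section \<open>Spectral bound and growth bound\<close>

lemma power_bound:
  assumes "growth_rate T w" "0 \<le> t"
  obtains M where "\<And>n x. norm ((T t ^^ n) x) \<le> M * exp (w * t) ^ n * norm x"
proof -
  obtain M where M: "\<And>s x. 0 \<le> s \<Longrightarrow> norm (T s x) \<le> M * exp (w * s) * norm x"
    using assms(1) unfolding growth_rate_def by blast
  have "norm ((T t ^^ n) x) \<le> M * exp (w * t) ^ n * norm x" for n x
  proof -
    have "exp (w * (real n * t)) = exp (w * t) ^ n" by (simp add: exp_of_nat_mult[symmetric] mult_ac)
    then show ?thesis using M[of "real n * t" x] T_power[OF assms(2), of n x] assms(2) by simp
  qed
  then show ?thesis using that by blast
qed

lemma operator_resolvent:
  assumes "growth_rate T w" "0 \<le> t" "exp (w * t) < cmod z"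
  shows "z \<in> resolvent_set UNIV (T t)"
proof -
  obtain M where "\<And>n x. norm ((T t ^^ n) x) \<le> M * exp (w * t) ^ n * norm x"
    using power_bound[OF assms(1,2)] by blast
  then show ?thesis by (rule outside_disc_resolvent[OF bcl[OF assms(2)]]) (use assms(3) in simp_all)
qed

lemma bounds_infinite:
  assumes g: "\<And>w. growth_rate T w"
  shows "spectrum D A = {}" "growth_bound T = -\<infinity>"
proof -
  show "spectrum D A = {}"
    unfolding spectrum_def using right_half_plane_resolvent[OF g] by (metis Compl_UNIV_eq UNIV_eq_I lt_ex)
  have rad: "spectral_radius (T t) = 0" if t: "0 < t" for t
  proof -
    have "0 \<in> spectrum UNIV (T t)"
    proof (rule quasinilpotent_zero_in_spectrum[OF bcl nontrivial])
      fix r :: real assume r: "0 < r"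
      then have "exp (ln r / t * t) = r" using t by simp
      then show "\<exists>M. \<forall>n x. norm ((T t ^^ n) x) \<le> M * r ^ n * norm x"
        using power_bound[OF g[of "ln r / t"], of t] t by (metis less_imp_le)
    qed (use t in simp)
    moreover have "z = 0" if "z \<in> spectrum UNIV (T t)" for z
    proof (rule ccontr)
      assume "z \<noteq> 0"
      then have "exp (ln (cmod z / 2) / t * t) < cmod z" using t by simp
      then have "z \<in> resolvent_set UNIV (T t)" using t by (intro operator_resolvent[OF g[of "ln (cmod z / 2) / t"]]) simp_all
      then show False using that by (simp add: spectrum_def)
    qed
    ultimately have "spectrum UNIV (T t) = {0}" by blast
    then show ?thesis by (simp add: spectral_radius_def)
  qed
  show "growth_bound T = -\<infinity>"
    unfolding growth_bound_def
  proof (rule the_equality)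
    show "-\<infinity> \<noteq> (\<infinity>::ereal) \<and> (\<forall>t>0. spectral_radius (T t) =
        (if -\<infinity> = (-\<infinity>::ereal) then 0 else exp (real_of_ereal (-\<infinity>) * t)))" using rad by simp
    fix \<omega> :: ereal
    assume "\<omega> \<noteq> \<infinity> \<and> (\<forall>t>0. spectral_radius (T t) = (if \<omega> = -\<infinity> then 0 else exp (real_of_ereal \<omega> * t)))"
    then have "spectral_radius (T 1) = (if \<omega> = -\<infinity> then 0 else exp (real_of_ereal \<omega> * 1))" by simp
    then show "\<omega> = -\<infinity>" using rad[of 1] by (auto split: if_splits)
  qed
qed

lemma bounds_finite:
  assumes g: "\<And>w. s < w \<Longrightarrow> growth_rate T w" and ng: "\<And>w. w < s \<Longrightarrow> \<not> growth_rate T w"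
  shows "complex_of_real s \<in> spectrum D A" "spectral_bound D A = ereal s" "growth_bound T = ereal s"
proof -
  show spec: "complex_of_real s \<in> spectrum D A"
    using resolvent_growth[of s] g ng by (auto simp: spectrum_def)
  have le: "Re z \<le> s" if "z \<in> spectrum D A" for z
  proof (rule ccontr)
    assume "\<not> Re z \<le> s"
    then have "z \<in> resolvent_set D A"
      using right_half_plane_resolvent[OF g, of "(s + Re z) / 2" z] by simp
    then show False using that by (simp add: spectrum_def)
  qed
  show "spectral_bound D A = ereal s"
    unfolding spectral_bound_def
  proof (rule antisym)
    show "(SUP z\<in>spectrum D A. ereal (Re z)) \<le> ereal s" by (rule SUP_least) (simp add: le)
    show "ereal s \<le> (SUP z\<in>spectrum D A. ereal (Re z))" by (rule SUP_upper2[OF spec]) simp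
  qed
  have rad: "spectral_radius (T t) = exp (s * t)" if t: "0 < t" for t
  proof -
    have mem: "complex_of_real (exp (s * t)) \<in> spectrum UNIV (T t)"
      using spectral_inclusion[of t "complex_of_real s"] t spec by (auto simp: spectrum_def exp_of_real[symmetric])
    have upper: "cmod z \<le> exp (s * t)" if "z \<in> spectrum UNIV (T t)" for z
    proof (rule ccontr)
      assume "\<not> cmod z \<le> exp (s * t)"
      then have z: "exp (s * t) < cmod z" by simp
      then obtain r where r: "exp (s * t) < r" "r < cmod z" using dense by blast
      then have r0: "0 < r" using exp_gt_zero[of "s * t"] by linarith
      have "s * t < ln r" using r r0 by (metis exp_less_cancel_iff exp_ln)
      then have "s < ln r / t" using t by (simp add: field_simps)
      moreover have "exp (ln r / t * t) < cmod z" using t r r0 by simp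
      ultimately have "z \<in> resolvent_set UNIV (T t)" using t by (intro operator_resolvent[OF g[of "ln r / t"]]) simp_all
      then show False using that by (simp add: spectrum_def)
    qed
    show ?thesis
      unfolding spectral_radius_def
      by (rule cSup_eq_maximum) (use mem upper in \<open>auto intro!: image_eqI[OF _ mem]\<close>)
  qed
  show "growth_bound T = ereal s"
    unfolding growth_bound_def
  proof (rule the_equality)
    show "ereal s \<noteq> \<infinity> \<and> (\<forall>t>0. spectral_radius (T t) =
        (if ereal s = -\<infinity> then 0 else exp (real_of_ereal (ereal s) * t)))" using rad by simp
    fix \<omega> :: ereal
    assume *: "\<omega> \<noteq> \<infinity> \<and> (\<forall>t>0. spectral_radius (T t) = (if \<omega> = -\<infinity> then 0 else exp (real_of_ereal \<omega> * t)))"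
    then have "spectral_radius (T 1) = (if \<omega> = -\<infinity> then 0 else exp (real_of_ereal \<omega> * 1))" by simp
    then have "\<omega> \<noteq> -\<infinity>" "real_of_ereal \<omega> = s" using rad[of 1] by (auto split: if_splits)
    then show "\<omega> = ereal s" using * by (cases \<omega>) auto
  qed
qed

lemma growth_dichotomy:
  obtains "\<And>w. growth_rate T w" | s where "\<And>w. s < w \<Longrightarrow> growth_rate T w" "\<And>w. w < s \<Longrightarrow> \<not> growth_rate T w"
proof (cases "\<forall>w. growth_rate T w")
  case True
  then show ?thesis using that by blast
next
  case False
  then obtain v where v: "\<not> growth_rate T v" by blast
  define W where "W = {w. growth_rate T w}"
  have ne: "W \<noteq> {}" using growth_rate_exists by (auto simp: W_def)
  have "v \<le> w" if "w \<in> W" for w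
    using that v growth_rate_mono[of T w v] by (cases "w \<le> v") (auto simp: W_def)
  then have bb: "bdd_below W" by (rule bdd_belowI)
  have "growth_rate T w" if "Inf W < w" for w
    using that cInf_lessD[OF ne, of w] growth_rate_mono[of T _ w] by (auto simp: W_def)
  moreover have "\<not> growth_rate T w" if "w < Inf W" for w
    using that cInf_lower[OF _ bb, of w] by (auto simp: W_def)
  ultimately show ?thesis using that(2) by blast
qed

end

section \<open>The unital case\<close>

lemma star_imag: "selfadjoint y \<Longrightarrow> real_part (\<i> *\<^sub>C y) = (0::'a::cstar_algebra)"
  by (simp add: real_part_def star_scaleC selfadjoint_def scaleC_uminus_left)

context c0_semigroup
begin

lemma generator_add: "x \<in> D \<Longrightarrow> y \<in> D \<Longrightarrow> x + y \<in> D \<and> A (x + y) = A x + A y"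
proof -
  assume xy: "x \<in> D" "y \<in> D"
  have "((\<lambda>h. (T h x - x) /\<^sub>R h + (T h y - y) /\<^sub>R h) \<longlongrightarrow> A x + A y) (at_right 0)"
    by (intro tendsto_add generatorD xy)
  moreover have "\<forall>\<^sub>F h in at_right 0. (T h x - x) /\<^sub>R h + (T h y - y) /\<^sub>R h = (T h (x + y) - (x + y)) /\<^sub>R h"
    using eventually_at_right_less[of 0]
    by eventually_elim (simp add: bounded_clinearD(2)[OF bcl] algebra_simps)
  ultimately have "((\<lambda>h. (T h (x + y) - (x + y)) /\<^sub>R h) \<longlongrightarrow> A x + A y) (at_right 0)"
    by (rule Lim_transform_eventually)
  then show ?thesis using generatorI by blast
qed

lemma generator_scaleC: "x \<in> D \<Longrightarrow> c *\<^sub>C x \<in> D \<and> A (c *\<^sub>C x) = c *\<^sub>C A x"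
proof -
  assume x: "x \<in> D"
  have "((\<lambda>h. c *\<^sub>C ((T h x - x) /\<^sub>R h)) \<longlongrightarrow> c *\<^sub>C A x) (at_right 0)"
    by (intro tendsto_scaleC tendsto_const generatorD x)
  moreover have "\<forall>\<^sub>F h in at_right 0. c *\<^sub>C ((T h x - x) /\<^sub>R h) = (T h (c *\<^sub>C x) - c *\<^sub>C x) /\<^sub>R h"
    using eventually_at_right_less[of 0]
    by eventually_elim (simp add: bounded_clinearD(6)[OF bcl] scaleC_scaleR scaleC_diff_right)
  ultimately have "((\<lambda>h. (T h (c *\<^sub>C x) - c *\<^sub>C x) /\<^sub>R h) \<longlongrightarrow> c *\<^sub>C A x) (at_right 0)"
    by (rule Lim_transform_eventually)
  then show ?thesis using generatorI by blast
qed

lemma generator_scaleR: "x \<in> D \<Longrightarrow> r *\<^sub>R x \<in> D \<and> A (r *\<^sub>R x) = r *\<^sub>R A x"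
  using generator_scaleC[of x "complex_of_real r"] by (simp add: scaleC_of_real)

lemma generator_zero: "0 \<in> D \<and> A 0 = 0"
  using domain_dense generator_scaleC[of _ 0] by (metis scaleC_zero_left)

end

text \<open>
  A positive operator maps differences of positive elements to such differences, that
  is, it preserves self-adjointness.
\<close>

lemma positive_operator_star:
  fixes S :: "'a::cstar_algebra \<Rightarrow> 'a"
  assumes S: "bounded_clinear S" "positive_operator S"
  shows "S (star x) = star (S x)"
proof -
  have sa: "selfadjoint (S y)" if y: "selfadjoint y" for y
  proof -
    obtain p q where pq: "p \<in> positive_cone" "q \<in> positive_cone" "y = p - q"
      using selfadjoint_decompose[OF y] .
    have "selfadjoint (S p)" "selfadjoint (S q)"
      using S(2) pq by (auto simp: positive_operator_def intro: cone_selfadjoint)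
    then show ?thesis unfolding pq(3) bounded_clinearD(3)[OF S(1)] by (rule selfadjoint_arith)
  qed
  have x: "x = real_part x + \<i> *\<^sub>C imag_part x" by (simp add: real_part_imag_part)
  have sx: "star x = real_part x - \<i> *\<^sub>C imag_part x"
    using selfadjoint_real_part[of x] selfadjoint_imag_part[of x] arg_cong[OF x, of star]
    by (simp add: star_add star_scaleC selfadjoint_def scaleC_uminus_left)
  have "star (S x) = star (S (real_part x) + \<i> *\<^sub>C S (imag_part x))"
    using x bounded_clinearD(2,6)[OF S(1)] by metis
  also have "\<dots> = S (real_part x) - \<i> *\<^sub>C S (imag_part x)"
    using sa[OF selfadjoint_real_part[of x]] sa[OF selfadjoint_imag_part[of x]]
    by (simp add: star_add star_scaleC selfadjoint_def scaleC_uminus_left)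
  also have "\<dots> = S (star x)" unfolding sx by (simp add: bounded_clinearD(3,6)[OF S(1)])
  finally show ?thesis by simp
qed

context positive_semigroup
begin

lemma generator_star: "x \<in> D \<Longrightarrow> star x \<in> D \<and> A (star x) = star (A x)"
proof -
  assume x: "x \<in> D"
  have "((\<lambda>h. star ((T h x - x) /\<^sub>R h)) \<longlongrightarrow> star (A x)) (at_right 0)"
    by (rule bounded_linear.tendsto[OF bounded_linear_star generatorD[OF x]])
  moreover have "\<forall>\<^sub>F h in at_right 0. star ((T h x - x) /\<^sub>R h) = (T h (star x) - star x) /\<^sub>R h"
    using eventually_at_right_less[of 0]
    by eventually_elim (simp add: star_scaleR star_diff positive_operator_star[OF bcl positive_T])
  ultimately have "((\<lambda>h. (T h (star x) - star x) /\<^sub>R h) \<longlongrightarrow> star (A x)) (at_right 0)"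
    by (rule Lim_transform_eventually)
  then show ?thesis using generatorI by blast
qed

lemma generator_real_part: "x \<in> D \<Longrightarrow> real_part x \<in> D \<and> A (real_part x) = real_part (A x)"
  using generator_scaleR[of "x + star x" "1/2"] generator_add[of x "star x"] generator_star[of x]
  by (simp add: real_part_def)

end

locale unital_positive_semigroup = positive_semigroup T for T :: "real \<Rightarrow> 'a::cstar_algebra \<Rightarrow> 'a" +
  fixes e :: 'a
  assumes unit: "e * x = x" "x * e = x"
begin

lemma e_cone: "e \<in> positive_cone" and norm_e: "norm e = 1"
  and order_unit: "selfadjoint x \<Longrightarrow> x \<preceq> norm x *\<^sub>R e"
  using unit_facts[of e] unit by blast+

lemma cone_le_scaleR_unit: "r \<le> s \<Longrightarrow> r *\<^sub>R e \<preceq> s *\<^sub>R e"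
  using cone_scaleR[OF e_cone, of "s - r"] by (simp add: cone_le_def scaleR_diff_left)

text \<open>
  By continuity \<open>T t e \<ge> e / 2\<close> for some \<open>t > 0\<close>, hence \<open>T (n t) e \<ge> e / 2\<^sup>n\<close>, and the
  norm cannot decay faster than \<open>2\<^sup>-\<^sup>n\<close>.
\<close>

lemma not_all_growth_rates: "\<exists>w. \<not> growth_rate T w"
proof (rule ccontr)
  assume "\<nexists>w. \<not> growth_rate T w"
  then have g: "growth_rate T w" for w by blast
  have "((\<lambda>t. T t e) \<longlongrightarrow> T 0 e) (at_right 0)"
    using continuous_on_T[of e] unfolding continuous_on_def by (auto intro: tendsto_within_subset)
  then have "\<forall>\<^sub>F t in at_right 0. dist (T t e) e < 1/2"
    using tendstoD[of "\<lambda>t. T t e" "T 0 e" "at_right 0" "1/2"] by (simp add: T_0)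
  then obtain b where b: "0 < b" "\<And>t. 0 < t \<Longrightarrow> t < b \<Longrightarrow> dist (T t e) e < 1/2"
    unfolding eventually_at_right_field by auto
  define t where "t = b / 2"
  have t: "0 < t" "norm (e - T t e) \<le> 1/2" using b(1) b(2)[of t] by (simp_all add: t_def dist_norm norm_minus_commute)
  have "selfadjoint (e - T t e)" using t by (intro selfadjoint_arith cone_selfadjoint e_cone T_cone) simp
  then have "e - T t e \<preceq> (1/2) *\<^sub>R e"
    using order_unit cone_le_scaleR_unit[OF t(2)] cone_le_trans by blast
  moreover have "e = (1/2) *\<^sub>R e + (1/2) *\<^sub>R e" by (simp add: scaleR_add_left[symmetric])
  ultimately have half: "(1/2) *\<^sub>R e \<preceq> T t e" unfolding cone_le_def by (smt (verit) add_diff_cancel_left' diff_diff_eq2 diff_add_eq add_diff_eq)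
  have low: "(1/2) ^ n *\<^sub>R e \<preceq> (T t ^^ n) e" for n
  proof (induction n)
    case (Suc n)
    have "(1/2) ^ Suc n *\<^sub>R e = (1/2) ^ n *\<^sub>R ((1/2) *\<^sub>R e)" by simp
    also have "\<dots> \<preceq> (1/2) ^ n *\<^sub>R T t e" by (rule cone_le_scaleR[OF half]) simp
    also have "(1/2) ^ n *\<^sub>R T t e = T t ((1/2) ^ n *\<^sub>R e)" using t by (simp add: bounded_clinearD(5)[OF bcl])
    finally have "(1/2) ^ Suc n *\<^sub>R e \<preceq> T t ((1/2) ^ n *\<^sub>R e)" .
    then show ?case using T_mono[OF _ Suc, of t] t cone_le_trans by fastforce
  qed (simp add: cone_le_refl)
  (* The growth rate - ln 4 / t makes the powers of T t decay like 1 / 4 ^ n. *)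
  obtain M where M: "\<And>n x. norm ((T t ^^ n) x) \<le> M * exp ((- ln 4 / t) * t) ^ n * norm x"
    using power_bound[OF g[of "- ln 4 / t"], of t] t by (metis less_imp_le)
  have ex: "exp ((- ln 4 / t) * t) = 1/4" using t by (simp add: exp_minus)
  have "1 \<le> M * (1/2) ^ n" for n
  proof -
    have "norm ((1/2) ^ n *\<^sub>R e) \<le> norm ((T t ^^ n) e)"
      by (rule cone_norm_mono[OF cone_scaleR[OF e_cone] low]) simp
    then have "(1/2) ^ n \<le> M * (1/4) ^ n" using M[of n e] unfolding ex by (simp add: norm_e)
    also have "(1/4::real) ^ n = (1/2) ^ n * (1/2) ^ n" by (simp add: power_mult_distrib[symmetric])
    finally show ?thesis by (simp add: field_simps)
  qed
  moreover have "(\<lambda>n. M * (1/2) ^ n) \<longlonglongrightarrow> M * 0" by (intro tendsto_mult_left LIMSEQ_realpow_zero) simp_all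
  ultimately have "1 \<le> M * 0" by (intro LIMSEQ_le_const) auto
  then show False by simp
qed

text \<open>
  If \<open>s x - A x \<ge> r e\<close>, then \<open>(s + d) x - A x \<ge> (r / 2) e\<close> for small \<open>d > 0\<close>. Applying
  the positive resolvent at \<open>s + d\<close> gives \<open>x \<ge> (r / 2) R e\<close>, a bound for \<open>R e\<close> that is
  independent of \<open>d\<close>. By \<open>bounded_laplace_growth\<close> the semigroup would then have a growth
  rate below \<open>s\<close>.
\<close>

lemma range_misses_interior:
  assumes g: "\<And>w. s < w \<Longrightarrow> growth_rate T w" and ng: "\<And>w. w < s \<Longrightarrow> \<not> growth_rate T w"
    and x: "x \<in> D" and r: "0 < r" "r *\<^sub>R e \<preceq> s *\<^sub>R x - A x" and sx: "selfadjoint x"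
  shows False
proof -
  have "\<exists>w<s. growth_rate T w"
  proof (rule bounded_laplace_growth)
    fix N :: nat and y :: 'a assume y: "y \<in> positive_cone"
    interpret W: positive_semigroup "rescale (complex_of_real s) T" by (rule positive_semigroup_rescale)
    (* With d * K \<le> 1 / 2 the perturbation d x is dominated by (r / 2) e. *)
    define K where "K = norm x / r + 1"
    have K: "0 < K" using r(1) by (simp add: K_def add_nonneg_pos)
    obtain d where d: "0 < d" "d * K \<le> 1/2" "d * real N \<le> ln 2" using small_shift[OF K] by blast
    have "growth_rate T (s + d / 2)" using d by (intro g) simp
    moreover have "s + d / 2 < s + d" using d by simp
    ultimately obtain R where R: "bounded_clinear R"
      "\<And>x. x \<in> D \<Longrightarrow> R (complex_of_real (s + d) *\<^sub>C x - A x) = x" "\<And>x. x \<in> positive_cone \<Longrightarrow> R x \<in> positive_cone"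
      "\<And>l' N x. x \<in> positive_cone \<Longrightarrow> ((s + d) - l') * real N \<le> ln 2 \<Longrightarrow>
       time_integral (rescale (complex_of_real l') T) (real N) x \<preceq> 2 *\<^sub>R R x"
      by (rule positive_resolvent) blast
    have "d * norm x \<le> r / 2"
    proof -
      have "d * (norm x / r) \<le> d * K" using d(1) by (intro mult_left_mono) (simp_all add: K_def)
      then have "d * (norm x / r) \<le> 1/2" using d(2) by linarith
      then show ?thesis using r(1) by (simp add: field_simps)
    qed
    then have "norm (- (d *\<^sub>R x)) \<le> r / 2" using d(1) by simp
    moreover have "- (d *\<^sub>R x) \<preceq> norm (- (d *\<^sub>R x)) *\<^sub>R e" by (intro order_unit selfadjoint_arith sx)
    ultimately have "- (d *\<^sub>R x) \<preceq> (r / 2) *\<^sub>R e" using cone_le_scaleR_unit cone_le_trans by blast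
    then have "r *\<^sub>R e + - (d *\<^sub>R x) \<preceq> (s *\<^sub>R x - A x) + (r / 2) *\<^sub>R e" using r(2) by (rule cone_le_add[rotated])
    moreover have "r *\<^sub>R e = (r / 2) *\<^sub>R e + (r / 2) *\<^sub>R e" by (simp add: scaleR_add_left[symmetric])
    ultimately have "(r / 2) *\<^sub>R e \<preceq> (s + d) *\<^sub>R x - A x"
      unfolding cone_le_def by (simp add: algebra_simps)
    then have "R ((s + d) *\<^sub>R x - A x - (r / 2) *\<^sub>R e) \<in> positive_cone" by (intro R(3)) (simp add: cone_le_def)
    moreover have "R ((s + d) *\<^sub>R x - A x) = x" using R(2)[OF x] unfolding scaleC_of_real .
    ultimately have "(r / 2) *\<^sub>R R e \<preceq> x"
      unfolding cone_le_def bounded_clinearD(3)[OF R(1), of _ "(r / 2) *\<^sub>R e"] bounded_clinearD(5)[OF R(1)] by simp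
    then have "norm ((r / 2) *\<^sub>R R e) \<le> norm x" using r(1) by (intro cone_norm_mono cone_scaleR R(3) e_cone) simp_all
    then have Re: "norm (R e) \<le> 2 * norm x / r" using r(1) by (simp add: field_simps)
    have "y \<preceq> norm y *\<^sub>R e" using y by (intro order_unit cone_selfadjoint)
    then have "norm y *\<^sub>R e - y \<in> positive_cone" by (simp add: cone_le_def)
    then have "W.V (real N) (norm y *\<^sub>R e - y) \<in> positive_cone" by (rule W.V_cone)
    then have "W.V (real N) y \<preceq> norm y *\<^sub>R W.V (real N) e"
      by (simp add: cone_le_def bounded_clinearD(3,5)[OF W.bounded_clinear_V])
    then have Vy: "norm (W.V (real N) y) \<le> norm (norm y *\<^sub>R W.V (real N) e)" by (intro cone_norm_mono W.V_cone y)
    have "norm (W.V (real N) e) \<le> norm (2 *\<^sub>R R e)"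
      using R(4)[OF e_cone, of s N] d by (intro cone_norm_mono W.V_cone e_cone) simp
    also have "\<dots> \<le> 4 * norm x / r" using Re by simp
    finally have "norm (W.V (real N) e) * norm y \<le> (4 * norm x / r) * norm y" by (rule mult_right_mono) simp
    then show "norm (W.V (real N) y) \<le> (4 * norm x / r) * norm y" using Vy by (simp add: mult.commute)
  qed
  then show False using ng by blast
qed

text \<open>
  Hahn-Banach is applied to the infimum of all \<open>r\<close> such that
  \<open>real_part x + (s y - A y) \<preceq> r e\<close> for some self-adjoint \<open>y\<close> in the domain. It is
  finite by \<open>range_misses_interior\<close>. The element \<open>y = 0\<close> accounts for positivity and the
  value at \<open>e\<close>; the choices \<open>x = \<plusminus> (s y - A y)\<close> show that the functional vanishes on the
  range of \<open>s - A\<close>.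
\<close>

lemma invariant_real_functional:
  assumes g: "\<And>w. s < w \<Longrightarrow> growth_rate T w" and ng: "\<And>w. w < s \<Longrightarrow> \<not> growth_rate T w"
  obtains f where "linear f" "\<And>x. f x \<le> norm x" "f e = 1" "\<And>x. x \<in> positive_cone \<Longrightarrow> 0 \<le> f x"
    "\<And>x. f (real_part x) = f x" "\<And>x. x \<in> D \<Longrightarrow> f (A x) = s * f x"
proof -
  define S where "S x = {r. \<exists>y\<in>D. selfadjoint y \<and> real_part x + (s *\<^sub>R y - A y) \<preceq> r *\<^sub>R e}" for x
  have SI: "r \<in> S x" if "y \<in> D" "selfadjoint y" "real_part x + (s *\<^sub>R y - A y) \<preceq> r *\<^sub>R e" for r x y
    using that by (auto simp: S_def)
  have SI0: "r \<in> S x" if "real_part x \<preceq> r *\<^sub>R e" for r x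
    using SI[of 0 x r] that generator_zero by (simp add: selfadjoint_arith)
  have lb: "- norm x \<le> r" if "r \<in> S x" for r x
  proof (rule ccontr)
    assume neg: "\<not> - norm x \<le> r"
    obtain y where y: "y \<in> D" "selfadjoint y" "real_part x + (s *\<^sub>R y - A y) \<preceq> r *\<^sub>R e"
      using \<open>r \<in> S x\<close> by (auto simp: S_def)
    have "- real_part x \<preceq> norm (- real_part x) *\<^sub>R e" by (intro order_unit selfadjoint_arith selfadjoint_real_part)
    moreover have "norm (- real_part x) \<le> norm x" by (simp add: norm_real_part)
    ultimately have "- real_part x \<preceq> norm x *\<^sub>R e" using cone_le_scaleR_unit cone_le_trans by blast
    from cone_le_add[OF y(3) this] have *: "s *\<^sub>R y - A y \<preceq> (r + norm x) *\<^sub>R e"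
      by (simp add: scaleR_add_left)
    define z where "z = (-1) *\<^sub>R y"
    have z: "z \<in> D" "A z = - A y" using generator_scaleR[OF y(1), of "-1"] by (simp_all add: z_def)
    have "(- (r + norm x)) *\<^sub>R e \<preceq> s *\<^sub>R z - A z"
      using * unfolding cone_le_def z(2) by (simp add: z_def algebra_simps)
    moreover have "0 < - (r + norm x)" using neg by simp
    moreover have "selfadjoint z" unfolding z_def by (intro selfadjoint_arith y)
    ultimately show False using range_misses_interior[OF g ng z(1)] by blast
  qed
  have up: "norm x \<in> S x" for x
  proof (rule SI0)
    show "real_part x \<preceq> norm x *\<^sub>R e"
      using order_unit[OF selfadjoint_real_part[of x]] cone_le_scaleR_unit[OF norm_real_part[of x]] cone_le_trans by blast
  qed
  have bb: "bdd_below (S x)" for x by (rule bdd_belowI) (rule lb)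
  have "sublinear (\<lambda>x. Inf (S x))"
  proof (rule sublinear_Inf)
    show "S x \<noteq> {}" for x using up[of x] by auto
    show "bdd_below (S x)" for x by (rule bb)
    fix x x' r r' assume "r \<in> S x" "r' \<in> S x'"
    then obtain y y' where *: "y \<in> D" "selfadjoint y" "real_part x + (s *\<^sub>R y - A y) \<preceq> r *\<^sub>R e"
      "y' \<in> D" "selfadjoint y'" "real_part x' + (s *\<^sub>R y' - A y') \<preceq> r' *\<^sub>R e"
      unfolding S_def by blast
    have "r + r' \<in> S (x + x')"
    proof (rule SI)
      show "y + y' \<in> D" using generator_add[OF *(1,4)] by simp
      show "selfadjoint (y + y')" by (intro selfadjoint_arith *)
      show "real_part (x + x') + (s *\<^sub>R (y + y') - A (y + y')) \<preceq> (r + r') *\<^sub>R e"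
        using cone_le_add[OF *(3,6)] generator_add[OF *(1,4)]
        by (simp add: real_part_add scaleR_add_left scaleR_add_right algebra_simps)
    qed
    then show "\<exists>u\<in>S (x + x'). u \<le> r + r'" by blast
  next
    fix c :: real and x r assume c: "0 < c" and "r \<in> S x"
    then obtain y where *: "y \<in> D" "selfadjoint y" "real_part x + (s *\<^sub>R y - A y) \<preceq> r *\<^sub>R e"
      unfolding S_def by blast
    have "c * r \<in> S (c *\<^sub>R x)"
    proof (rule SI)
      show "c *\<^sub>R y \<in> D" using generator_scaleR[OF *(1)] by simp
      show "selfadjoint (c *\<^sub>R y)" by (intro selfadjoint_arith *)
      show "real_part (c *\<^sub>R x) + (s *\<^sub>R c *\<^sub>R y - A (c *\<^sub>R y)) \<preceq> (c * r) *\<^sub>R e"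
        using cone_le_scaleR[OF *(3), of c] c generator_scaleR[OF *(1), of c]
        by (simp add: real_part_scaleR scaleR_add_right scaleR_diff_right mult.commute)
    qed
    then show "\<exists>u\<in>S (c *\<^sub>R x). u \<le> c * r" by blast
  next
    show "0 \<in> S 0" using up[of 0] by simp
    show "0 \<le> r" if "r \<in> S 0" for r using lb[OF that] by simp
  qed
  then obtain f where f: "linear f" "\<And>x. f x \<le> Inf (S x)" using hahn_banach_sublinear by blast
  interpret f: linear f by fact
  have le: "f x \<le> r" if "r \<in> S x" for x r using f(2)[of x] cInf_lower[OF that bb] by linarith
  have rp_neg: "real_part (- x) = - real_part x" for x :: 'a using real_part_scaleR[of "-1" x] by simp
  have rp_sa: "real_part x = x" if "selfadjoint x" for x :: 'a using that by (rule real_part_selfadjoint)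
  have pos: "0 \<le> f x" if "x \<in> positive_cone" for x
  proof -
    have "real_part (- x) \<preceq> 0 *\<^sub>R e"
      using that rp_sa[OF cone_selfadjoint[OF that]] by (simp add: rp_neg cone_le_def)
    then have "f (- x) \<le> 0" by (intro le SI0)
    then show ?thesis by (simp add: f.neg)
  qed
  have fe: "f e = 1"
  proof (rule antisym)
    have re: "real_part e = e" by (rule rp_sa[OF cone_selfadjoint[OF e_cone]])
    show "f e \<le> 1" by (intro le SI0) (simp add: re cone_le_refl)
    have "f (- e) \<le> - 1" by (intro le SI0) (simp add: rp_neg re cone_le_refl)
    then show "1 \<le> f e" by (simp add: f.neg)
  qed
  have f_real: "f (real_part x) = f x" for x
  proof -
    have z: "real_part (x - real_part x) = 0"
      using real_part_add[of x "- real_part x"] rp_neg[of "real_part x"] rp_sa[OF selfadjoint_real_part[of x]] by simp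
    have "f (x - real_part x) \<le> 0" by (intro le SI0) (simp add: z cone_le_refl)
    moreover have "f (- (x - real_part x)) \<le> 0" by (intro le SI0) (simp only: rp_neg z, simp add: cone_le_refl)
    ultimately show ?thesis by (simp add: f.diff f.neg)
  qed
  have inv_sa: "f (A x) = s * f x" if x: "x \<in> D" "selfadjoint x" for x
  proof -
    have sa: "real_part (s *\<^sub>R x - A x) = s *\<^sub>R x - A x"
      using generator_star[OF x(1)] x(2) by (intro rp_sa selfadjoint_arith) (simp_all add: selfadjoint_def)
    have "f (- (s *\<^sub>R x - A x)) \<le> 0"
      by (rule le, rule SI[OF x]) (simp only: rp_neg sa, simp add: cone_le_refl)
    moreover have "f (s *\<^sub>R x - A x) \<le> 0"
    proof (rule le, rule SI)
      show "(-1) *\<^sub>R x \<in> D" using generator_scaleR[OF x(1)] by blast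
      show "selfadjoint ((-1) *\<^sub>R x)" by (intro selfadjoint_arith x)
      have "A ((-1) *\<^sub>R x) = - A x" using generator_scaleR[OF x(1), of "-1"] by simp
      then show "real_part (s *\<^sub>R x - A x) + (s *\<^sub>R (-1) *\<^sub>R x - A ((-1) *\<^sub>R x)) \<preceq> 0 *\<^sub>R e"
        unfolding sa by (simp add: cone_le_refl)
    qed
    ultimately show ?thesis by (simp add: f.diff f.neg f.scale)
  qed
  have inv: "f (A x) = s * f x" if "x \<in> D" for x
  proof -
    have "f (A x) = f (A (real_part x))" using generator_real_part[OF that] f_real[of "A x"] by simp
    also have "\<dots> = s * f (real_part x)"
      using generator_real_part[OF that] by (intro inv_sa selfadjoint_real_part) simp
    finally show ?thesis by (simp add: f_real)
  qed
  show ?thesis using that[OF f(1) le[OF up] fe pos f_real inv] .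
qed

text \<open>
  The state is the complexification of the invariant real functional. For its norm
  rotate the argument \<open>x\<close> by a number \<open>u\<close> of modulus \<open>1\<close> such that \<open>\<phi> (u x) = \<bar>\<phi> x\<bar>\<close>.
\<close>

lemma eigenstate:
  assumes g: "\<And>w. s < w \<Longrightarrow> growth_rate T w" and ng: "\<And>w. w < s \<Longrightarrow> \<not> growth_rate T w"
  obtains \<phi> where "is_state \<phi>" "\<phi> \<in> adjoint_domain D A" "adjoint_op D A \<phi> = (\<lambda>x. complex_of_real s * \<phi> x)"
proof -
  obtain f where f: "linear f" "\<And>x. f x \<le> norm x" "f e = 1" "\<And>x. x \<in> positive_cone \<Longrightarrow> 0 \<le> f x"
    "\<And>x. f (real_part x) = f x" "\<And>x. x \<in> D \<Longrightarrow> f (A x) = s * f x"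
    by (rule invariant_real_functional[OF g ng]) blast+
  interpret f: linear f by fact
  define \<phi> where "\<phi> x = complex_of_real (f x) - \<i> * complex_of_real (f (\<i> *\<^sub>C x))" for x
  have Re_\<phi>: "Re (\<phi> x) = f x" for x by (simp add: \<phi>_def)
  have add: "\<phi> (x + y) = \<phi> x + \<phi> y" for x y
    by (simp add: \<phi>_def f.add scaleC_add_right algebra_simps)
  have scaleR: "\<phi> (r *\<^sub>R x) = complex_of_real r * \<phi> x" for r x
    by (simp add: \<phi>_def f.scale scaleC_scaleR algebra_simps)
  have mult_i: "\<phi> (\<i> *\<^sub>C x) = \<i> * \<phi> x" for x
    by (simp add: \<phi>_def scaleC_i_i f.neg algebra_simps)
  have scale: "\<phi> (c *\<^sub>C x) = c * \<phi> x" for c x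
  proof -
    have "c *\<^sub>C x = (complex_of_real (Re c) + complex_of_real (Im c) * \<i>) *\<^sub>C x"
      by (metis complex_eq mult.commute)
    also have "\<dots> = Re c *\<^sub>R x + Im c *\<^sub>R (\<i> *\<^sub>C x)"
      unfolding scaleC_add_left scaleC_of_real scaleC_of_real_mult ..
    finally have "\<phi> (c *\<^sub>C x) = (complex_of_real (Re c) + \<i> * complex_of_real (Im c)) * \<phi> x"
      by (simp add: add scaleR mult_i algebra_simps)
    then show ?thesis using complex_eq[of c] by simp
  qed
  have norm_le: "cmod (\<phi> x) \<le> norm x" for x
  proof (cases "\<phi> x = 0")
    case False
    define u where "u = cnj (\<phi> x) / complex_of_real (cmod (\<phi> x))"
    have nu: "cmod u = 1" using False by (simp add: u_def norm_divide)
    have "u * \<phi> x = complex_of_real (cmod (\<phi> x))"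
      using False by (simp add: u_def complex_norm_square[symmetric] power2_eq_square mult.commute)
    then have "cmod (\<phi> x) = Re (\<phi> (u *\<^sub>C x))" by (simp add: scale)
    also have "\<dots> \<le> norm (u *\<^sub>C x)" unfolding Re_\<phi> by (rule f(2))
    finally show ?thesis by (simp add: norm_scaleC nu)
  qed simp
  have bc: "bounded_clinear \<phi>"
    by (rule bounded_clinear_intro[where K=1]) (simp_all add: add scale scaleC_complex_def norm_le)
  have sa: "\<phi> x = complex_of_real (f x)" if "selfadjoint x" for x
  proof -
    have "f (\<i> *\<^sub>C x) = f 0" using f(5)[of "\<i> *\<^sub>C x"] star_imag[OF that] by metis
    then show ?thesis by (simp add: \<phi>_def f.zero)
  qed
  have "is_state \<phi>"
    unfolding is_state_def
  proof (intro conjI ballI)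
    show "bounded_clinear \<phi>" by (rule bc)
    show "\<phi> x \<in> \<real>\<^sub>\<ge>\<^sub>0" if "x \<in> positive_cone" for x
      using sa[OF cone_selfadjoint[OF that]] f(4)[OF that] by simp
    show "onorm \<phi> = 1"
    proof (rule antisym)
      show "onorm \<phi> \<le> 1" by (rule onorm_bound) (simp_all add: norm_le)
      have "\<phi> e = 1" using sa[OF cone_selfadjoint[OF e_cone]] f(3) by simp
      then show "1 \<le> onorm \<phi>" using onorm[OF bounded_clinearD(1)[OF bc], of e] norm_e by simp
    qed
  qed
  have inv: "\<phi> (A x) = complex_of_real s * \<phi> x" if "x \<in> D" for x
  proof -
    have "f (\<i> *\<^sub>C A x) = s * f (\<i> *\<^sub>C x)" using generator_scaleC[OF that, of \<i>] f(6)[of "\<i> *\<^sub>C x"] by simp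
    then show ?thesis using f(6)[OF that] by (simp add: \<phi>_def algebra_simps)
  qed
  have bcs: "bounded_clinear (\<lambda>x. complex_of_real s * \<phi> x)"
    using bounded_clinear_scaleC[OF bc, of "complex_of_real s"] by (simp add: scaleC_complex_def)
  have dom: "\<phi> \<in> adjoint_domain D A"
    using bc bcs inv by (auto simp: adjoint_domain_def)
  have "adjoint_op D A \<phi> = (\<lambda>x. complex_of_real s * \<phi> x)"
    unfolding adjoint_op_def
  proof (rule the_equality)
    show "bounded_clinear (\<lambda>x. complex_of_real s * \<phi> x) \<and> (\<forall>x\<in>D. \<phi> (A x) = complex_of_real s * \<phi> x)"
      using bcs inv by blast
    fix \<psi> :: "'a \<Rightarrow> complex"
    assume \<psi>: "bounded_clinear \<psi> \<and> (\<forall>x\<in>D. \<phi> (A x) = \<psi> x)"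
    show "\<psi> = (\<lambda>x. complex_of_real s * \<phi> x)"
    proof
      fix x
      obtain y where y: "\<And>n. y n \<in> D" "y \<longlonglongrightarrow> x" using domain_dense[of x] by blast
      have "(\<lambda>n. \<psi> (y n)) \<longlonglongrightarrow> \<psi> x"
        using \<psi> by (intro bounded_linear.tendsto[OF bounded_clinearD(1) y(2)]) simp
      moreover have "(\<lambda>n. complex_of_real s * \<phi> (y n)) \<longlonglongrightarrow> complex_of_real s * \<phi> x"
        by (intro bounded_linear.tendsto[OF bounded_clinearD(1)[OF bcs] y(2)])
      moreover have "\<psi> (y n) = complex_of_real s * \<phi> (y n)" for n using \<psi> inv[OF y(1)] y(1) by metis
      ultimately show "\<psi> x = complex_of_real s * \<phi> x" by (simp add: LIMSEQ_unique)
    qed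
  qed
  then show ?thesis using that \<open>is_state \<phi>\<close> dom by blast
qed

end

theorem theorem3p3:
  fixes T :: "real \<Rightarrow> 'a::cstar_algebra \<Rightarrow> 'a"
  assumes "C0_semigroup T"
    and "\<forall>t\<ge>0. positive_operator (T t)"
  defines "D \<equiv> generator_domain T"
    and "A \<equiv> generator T"
  shows "spectral_bound D A = growth_bound T \<and>
    (spectrum D A \<noteq> {} \<longrightarrow>
       (\<exists>s::real. spectral_bound D A = ereal s \<and> complex_of_real s \<in> spectrum D A)) \<and>
    (has_unit TYPE('a) \<longrightarrow>
       spectrum D A \<noteq> {} \<and>
       (\<exists>s::real. spectral_bound D A = ereal s \<and>
          (\<exists>\<phi>. is_state \<phi> \<and> \<phi> \<in> adjoint_domain D A \<and>
               adjoint_op D A \<phi> = (\<lambda>x. complex_of_real s * \<phi> x))))"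
proof -
  interpret positive_semigroup T
    by standard (use assms(1,2) in auto)
  show ?thesis
  proof (rule growth_dichotomy)
    assume all: "\<And>w. growth_rate T w"
    have "\<not> has_unit TYPE('a)"
    proof
      assume "has_unit TYPE('a)"
      then obtain e :: 'a where e: "\<And>x. e * x = x" "\<And>x. x * e = x" unfolding has_unit_def by blast
      interpret unital_positive_semigroup T e by standard (rule e)+
      show False using not_all_growth_rates all by blast
    qed
    then show ?thesis
      using bounds_infinite[OF all] by (simp add: D_def A_def spectral_bound_def bot_ereal_def)
  next
    fix s assume s: "\<And>w. s < w \<Longrightarrow> growth_rate T w" "\<And>w. w < s \<Longrightarrow> \<not> growth_rate T w"
    have "\<exists>\<phi>. is_state \<phi> \<and> \<phi> \<in> adjoint_domain D A \<and> adjoint_op D A \<phi> = (\<lambda>x. complex_of_real s * \<phi> x)"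
      if "has_unit TYPE('a)"
    proof -
      obtain e :: 'a where e: "\<And>x. e * x = x" "\<And>x. x * e = x"
        using \<open>has_unit TYPE('a)\<close> unfolding has_unit_def by blast
      interpret unital_positive_semigroup T e by standard (rule e)+
      show ?thesis using eigenstate[OF s] unfolding D_def A_def by blast
    qed
    then show ?thesis using bounds_finite[OF s] unfolding D_def A_def by auto
  qed
qed

end
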